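(* Assume $\sigma(\Gamma) < \infty$. The following conditions are equivalent. (i) For all $\varphi \in \mathrm{Tr}(\Omega)$ there is a unique variational solution of the Dirichlet problem $(D_\varphi)$. (ii) $V(\Omega) = H^1_0(\Omega)$. (iii) $V(\Omega) \cap \mathcal H^1_{\mathcal A}(\Omega) = \{0\}$.
   Context: Setting: $d \ge 2$, $\Omega \subset \mathbb R^d$ is open and bounded with boundary $\Gamma = \partial\Omega$; functions are complex-valued unless said otherwise. For $k,l \in \{1,\ldots,d\}$, $a_{kl} \colon \Omega \to \mathbb R$ is bounded and measurable, and there is $\mu \in (0,1]$ with $\mathrm{Re} \sum_{k,l=1}^d a_{kl}(x)\,\xi_k\,\overline{\xi_l} \ge \mu|\xi|^2$ for all $x \in \Omega$, $\xi \in \mathbb C^d$. Further $b_k, c_0 \colon \Omega \to \mathbb C$ and $c_k \colon \Omega \to \mathbb R$ ($k=1,\ldots,d$) are bounded and measurable. $\mathcal D'(\Omega)$ is the antidual of $\mathcal D(\Omega) = C_c^\infty(\Omega)$. Define $\mathcal A \colon H^1_{\mathrm{loc}}(\Omega) \to \mathcal D'(\Omega)$ by $$\langle \mathcal A u, v\rangle = \sum_{k,l=1}^d \int_\Omega a_{kl}(\partial_l u)\overline{\partial_k v} + \sum_{k=1}^d \int_\Omega b_k u\,\overline{\partial_k v} + \sum_{k=1}^d \int_\Omega c_k(\partial_k u)\overline v + \int_\Omega c_0 u \overline v$$ for $v \in C_c^\infty(\Omega)$. Standing assumption: $0$ is not a Dirichlet eigenvalue, i.e. if $u \in H^1_0(\Omega)$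 and $\mathcal A u = 0$, then $u = 0$. Let $\mathcal H^1_{\mathcal A}(\Omega) = \{u \in H^1(\Omega) : \mathcal A u = 0\}$. Traces: $\sigma$ is the $(d-1)$-dimensional Hausdorff measure on $\Gamma$, and $L_2(\Gamma) = L_2(\Gamma,\sigma)$. For $u \in H^1(\Omega)$ and $\varphi \in L_2(\Gamma)$, $\varphi$ is called a (approximative) trace of $u$ if there are $u_1, u_2, \ldots \in H^1(\Omega) \cap C(\overline\Omega)$ with $u_n \to u$ in $H^1(\Omega)$ and $u_n|_\Gamma \to \varphi$ in $L_2(\Gamma)$. $\mathrm{Tr}(\Omega)$ is the set of $\varphi \in L_2(\Gamma)$ that are a trace of some $u \in H^1(\Omega)$. $V(\Omega) = \{u \in H^1(\Omega) : 0 \text{ is a trace of } u\}$. For $\varphi \in \mathrm{Tr}(\Omega)$, a variational solution of the Dirichlet problem $(D_\varphi)$ is a $u \in \mathcal H^1_{\mathcal A}(\Omega)$ having $\varphi$ as a trace. *)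

theory Defs
  imports "HOL-Analysis.Analysis"
begin

text \<open>
  Functions on an open set \<open>\<Omega>\<close> or on its boundary are total functions whose values elsewhere are
  irrelevant, and the function spaces are sets of representatives.  Those over \<open>\<Omega>\<close> that use the
  complete measure \<^term>\<open>lebesgue_on \<Omega>\<close> are closed under changes on null sets, so equality of
  such sets is equality of the corresponding spaces of classes; the zero space is the set of all
  functions that vanish almost everywhere.
\<close>

definition ae_eq :: "'a measure \<Rightarrow> ('a \<Rightarrow> complex) \<Rightarrow> ('a \<Rightarrow> complex) \<Rightarrow> bool"
  where "ae_eq M f g \<longleftrightarrow> (AE x in M. f x = g x)"

definition L2 :: "'a measure \<Rightarrow> ('a \<Rightarrow> complex) set"
  where "L2 M = {f \<in> borel_measurable M. integrable M (\<lambda>x. (norm (f x))\<^sup>2)}"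

definition L2_norm :: "'a measure \<Rightarrow> ('a \<Rightarrow> complex) \<Rightarrow> real"
  where "L2_norm M f = sqrt (LINT x|M. (norm (f x))\<^sup>2)"

definition partial :: "'n \<Rightarrow> (real^'n \<Rightarrow> complex) \<Rightarrow> real^'n \<Rightarrow> complex"
  where "partial k f x = frechet_derivative f (at x) (axis k 1)"

primrec C_diff :: "nat \<Rightarrow> (real^'n \<Rightarrow> complex) \<Rightarrow> bool"
  where
    "C_diff 0 f \<longleftrightarrow> continuous_on UNIV f"
  | "C_diff (Suc m) f \<longleftrightarrow> (\<forall>x. f differentiable (at x)) \<and> (\<forall>k. C_diff m (partial k f))"

text \<open>Elements of \<open>C\<^sub>c\<^sup>\<infinity>(\<Omega>)\<close> are identified with their extensions by zero.\<close>

definition test_functions :: "(real^'n) set \<Rightarrow> (real^'n \<Rightarrow> complex) set"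
  where "test_functions \<Omega> =
    {v. (\<forall>m. C_diff m v) \<and> compact (closure {x. v x \<noteq> 0}) \<and> closure {x. v x \<noteq> 0} \<subseteq> \<Omega>}"

definition locally_integrable :: "(real^'n) set \<Rightarrow> (real^'n \<Rightarrow> complex) \<Rightarrow> bool"
  where "locally_integrable \<Omega> f \<longleftrightarrow> (\<forall>K. compact K \<and> K \<subseteq> \<Omega> \<longrightarrow> f absolutely_integrable_on K)"

definition has_weak_partial ::
    "(real^'n) set \<Rightarrow> 'n \<Rightarrow> (real^'n \<Rightarrow> complex) \<Rightarrow> (real^'n \<Rightarrow> complex) \<Rightarrow> bool"
  where "has_weak_partial \<Omega> k u g \<longleftrightarrow>
    locally_integrable \<Omega> u \<and> locally_integrable \<Omega> g \<and>
    (\<forall>v\<in>test_functions \<Omega>.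
      (LINT x|lebesgue_on \<Omega>. u x * partial k v x) = - (LINT x|lebesgue_on \<Omega>. g x * v x))"

text \<open>The weak derivative is determined up to a null set; a representative is chosen.\<close>

definition weak_partial :: "(real^'n) set \<Rightarrow> 'n \<Rightarrow> (real^'n \<Rightarrow> complex) \<Rightarrow> real^'n \<Rightarrow> complex"
  where "weak_partial \<Omega> k u = (SOME g. has_weak_partial \<Omega> k u g)"

definition H1 :: "(real^'n) set \<Rightarrow> (real^'n \<Rightarrow> complex) set"
  where "H1 \<Omega> = {u \<in> L2 (lebesgue_on \<Omega>). \<forall>k. \<exists>g\<in>L2 (lebesgue_on \<Omega>). has_weak_partial \<Omega> k u g}"

definition H1_norm :: "(real^'n) set \<Rightarrow> (real^'n \<Rightarrow> complex) \<Rightarrow> real"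
  where "H1_norm \<Omega> u =
    sqrt ((L2_norm (lebesgue_on \<Omega>) u)\<^sup>2 + (\<Sum>k\<in>UNIV. (L2_norm (lebesgue_on \<Omega>) (weak_partial \<Omega> k u))\<^sup>2))"

definition H1_0 :: "(real^'n) set \<Rightarrow> (real^'n \<Rightarrow> complex) set"
  where "H1_0 \<Omega> = {u \<in> H1 \<Omega>. \<exists>v. (\<forall>n. v n \<in> test_functions \<Omega>) \<and>
    (\<lambda>n. H1_norm \<Omega> (\<lambda>x. v n x - u x)) \<longlonglongrightarrow> 0}"

text \<open>
  The sesquilinear pairing \<open>\<langle>\<A>u, v\<rangle>\<close>, for \<open>u\<close> in \<open>H\<^sup>1\<^sub>l\<^sub>o\<^sub>c(\<Omega>)\<close> and test functions \<open>v\<close>.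
\<close>

definition ell_op ::
    "(real^'n) set \<Rightarrow> ('n \<Rightarrow> 'n \<Rightarrow> real^'n \<Rightarrow> real) \<Rightarrow> ('n \<Rightarrow> real^'n \<Rightarrow> complex) \<Rightarrow>
     ('n \<Rightarrow> real^'n \<Rightarrow> real) \<Rightarrow> (real^'n \<Rightarrow> complex) \<Rightarrow>
     (real^'n \<Rightarrow> complex) \<Rightarrow> (real^'n \<Rightarrow> complex) \<Rightarrow> complex"
  where "ell_op \<Omega> a b c c0 u v =
      (\<Sum>k\<in>UNIV. \<Sum>l\<in>UNIV.
        LINT x|lebesgue_on \<Omega>. of_real (a k l x) * weak_partial \<Omega> l u x * cnj (partial k v x))
    + (\<Sum>k\<in>UNIV. LINT x|lebesgue_on \<Omega>. b k x * u x * cnj (partial k v x))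
    + (\<Sum>k\<in>UNIV. LINT x|lebesgue_on \<Omega>. of_real (c k x) * weak_partial \<Omega> k u x * cnj (v x))
    + (LINT x|lebesgue_on \<Omega>. c0 x * u x * cnj (v x))"

text \<open>\<open>\<A>u = 0\<close> in the antidual of \<open>C\<^sub>c\<^sup>\<infinity>(\<Omega>)\<close>.\<close>

definition ell_null ::
    "(real^'n) set \<Rightarrow> ('n \<Rightarrow> 'n \<Rightarrow> real^'n \<Rightarrow> real) \<Rightarrow> ('n \<Rightarrow> real^'n \<Rightarrow> complex) \<Rightarrow>
     ('n \<Rightarrow> real^'n \<Rightarrow> real) \<Rightarrow> (real^'n \<Rightarrow> complex) \<Rightarrow> (real^'n \<Rightarrow> complex) \<Rightarrow> bool"
  where "ell_null \<Omega> a b c c0 u \<longleftrightarrow> (\<forall>v\<in>test_functions \<Omega>. ell_op \<Omega> a b c c0 u v = 0)"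

definition H1_A ::
    "(real^'n) set \<Rightarrow> ('n \<Rightarrow> 'n \<Rightarrow> real^'n \<Rightarrow> real) \<Rightarrow> ('n \<Rightarrow> real^'n \<Rightarrow> complex) \<Rightarrow>
     ('n \<Rightarrow> real^'n \<Rightarrow> real) \<Rightarrow> (real^'n \<Rightarrow> complex) \<Rightarrow> (real^'n \<Rightarrow> complex) set"
  where "H1_A \<Omega> a b c c0 = {u \<in> H1 \<Omega>. ell_null \<Omega> a b c c0 u}"

text \<open>
  Covers consist of bounded sets because \<^const>\<open>diameter\<close> is not meaningful on unbounded ones.
  The factor \<^const>\<open>unit_ball_vol\<close> is the usual normalisation making the \<open>d\<close>-dimensional measure
  on \<open>\<real>\<^sup>d\<close> agree with Lebesgue measure.
\<close>

definition hausdorff_outer :: "nat \<Rightarrow> 'a::euclidean_space set \<Rightarrow> ennreal"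
  where "hausdorff_outer s A =
    (SUP \<delta>\<in>{0<..}. INF C\<in>{C :: nat \<Rightarrow> 'a set. A \<subseteq> (\<Union>i. C i) \<and>
        (\<forall>i. bounded (C i) \<and> diameter (C i) \<le> \<delta>)}.
      \<Sum>i. if C i = {} then 0 else ennreal (unit_ball_vol (real s) * (diameter (C i) / 2) ^ s))"

text \<open>
  Restricted to Borel sets the (metric) outer measure is a measure, so \<^const>\<open>measure_of\<close> does not
  fall back to the zero measure here.  Passing to its completion would not change the classes
  in \<open>L\<^sub>2\<close>.
\<close>

definition hausdorff_measure :: "nat \<Rightarrow> 'a::euclidean_space measure"
  where "hausdorff_measure s = measure_of UNIV (sets borel) (hausdorff_outer s)"

definition boundary_measure :: "(real^'n) set \<Rightarrow> (real^'n) measure"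
  where "boundary_measure \<Omega> = restrict_space (hausdorff_measure (CARD('n) - 1)) (frontier \<Omega>)"

text \<open>
  Membership of \<open>w n\<close> in \<open>L\<^sub>2(\<Gamma>)\<close> is needed because the Bochner integral of a non-integrable function
  is \<open>0\<close>; it is automatic if \<open>\<Gamma>\<close> has finite measure.
\<close>

definition has_trace :: "(real^'n) set \<Rightarrow> (real^'n \<Rightarrow> complex) \<Rightarrow> (real^'n \<Rightarrow> complex) \<Rightarrow> bool"
  where "has_trace \<Omega> u \<phi> \<longleftrightarrow> u \<in> H1 \<Omega> \<and> \<phi> \<in> L2 (boundary_measure \<Omega>) \<and>
    (\<exists>w. (\<forall>n. w n \<in> H1 \<Omega> \<and> continuous_on (closure \<Omega>) (w n) \<and> w n \<in> L2 (boundary_measure \<Omega>)) \<and>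
      (\<lambda>n. H1_norm \<Omega> (\<lambda>x. w n x - u x)) \<longlonglongrightarrow> 0 \<and>
      (\<lambda>n. L2_norm (boundary_measure \<Omega>) (\<lambda>x. w n x - \<phi> x)) \<longlonglongrightarrow> 0)"

definition Tr :: "(real^'n) set \<Rightarrow> (real^'n \<Rightarrow> complex) set"
  where "Tr \<Omega> = {\<phi> \<in> L2 (boundary_measure \<Omega>). \<exists>u\<in>H1 \<Omega>. has_trace \<Omega> u \<phi>}"

definition V :: "(real^'n) set \<Rightarrow> (real^'n \<Rightarrow> complex) set"
  where "V \<Omega> = {u \<in> H1 \<Omega>. has_trace \<Omega> u (\<lambda>x. 0)}"

definition variational_solution ::
    "(real^'n) set \<Rightarrow> ('n \<Rightarrow> 'n \<Rightarrow> real^'n \<Rightarrow> real) \<Rightarrow> ('n \<Rightarrow> real^'n \<Rightarrow> complex) \<Rightarrow>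
     ('n \<Rightarrow> real^'n \<Rightarrow> real) \<Rightarrow> (real^'n \<Rightarrow> complex) \<Rightarrow> (real^'n \<Rightarrow> complex) \<Rightarrow>
     (real^'n \<Rightarrow> complex) \<Rightarrow> bool"
  where "variational_solution \<Omega> a b c c0 \<phi> u \<longleftrightarrow> u \<in> H1_A \<Omega> a b c c0 \<and> has_trace \<Omega> u \<phi>"

end

theory Submission
  imports Defs
begin

text \<open>
  Everything rests on the decomposition \<open>H\<^sup>1(\<Omega>) = H\<^sup>1\<^sub>0(\<Omega>) + \<H>\<^sup>1\<^sub>\<A>(\<Omega>)\<close>: given \<open>u\<close>, one solves
  \<open>\<A>w = \<A>u\<close> with \<open>w \<in> H\<^sup>1\<^sub>0(\<Omega>)\<close>.  Since \<open>w\<close> has trace \<open>0\<close>, \<open>u - w\<close> has the same traces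
  as \<open>u\<close>, and the three equivalences follow by linearity.

  To solve \<open>\<A>w = \<A>u\<close> neither Rellich's theorem nor weak convergence is used.  The form of \<open>\<A>\<close> satisfies
  a Garding inequality, and a Poincare inequality on the cells of a fine grid bounds the \<open>L\<^sub>2\<close> norm on
  \<open>H\<^sup>1\<^sub>0(\<Omega>)\<close> by a small multiple of the gradient plus finitely many cell averages.  Hence the form becomes
  coercive after adding finitely many rank one terms; Lax-Milgram and linear algebra in a
  finite-dimensional space turn the injectivity given by the assumption on eigenvalues into solvability.
  All of this is done over the reals, with the real parts of the complex forms.
\<close>

section \<open>Injectivity and solvability modulo finite rank\<close>

text \<open>The obstacle is that \<open>H1\<close> is a set of representatives with a chosen weak
  gradient, not a Hilbert space type. Each u is therefore sent to the class of the pair (u, grad u),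
  extended by zero, in a fixed L2 space over the whole of R^n with values in C x C^n. This map is
  real linear and isometric for \<open>H1_norm\<close>, and its kernel consists of the functions
  that vanish almost everywhere. The coefficients act there as a pointwise matrix, a bounded
  operator, so that A becomes inner (T U) V on a closed subspace and the abstract results apply.

  Working with real parts loses nothing: test functions may be multiplied by the imaginary unit,
  which turns imaginary parts into real ones.

  The mesh of the grid is tied to the constant \<kappa> of the Garding inequality: it is so fine
  that the L2 term, multiplied by \<kappa> + 1, costs at most half of the available gradient term.
  The surplus 1 is what controls the L2 part of the norm.

  A function of H^1_0 has trace 0 because its approximating test functions vanish identically on the
  boundary.\<close>

lemma subspace_projection_exists:
  fixes S :: "'a::real_inner set"
  assumes S: "subspace S" "complete S"
  shows "\<exists>p\<in>S. \<forall>v\<in>S. inner (x - p) v = 0"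
proof -
  define F where "F = (\<lambda>s. (norm (x - s))\<^sup>2)"
  define d where "d = Inf (F ` S)"
  have ne: "F ` S \<noteq> {}" using subspace_0[OF S(1)] by auto
  have bdd: "bdd_below (F ` S)" by (rule bdd_belowI[of _ 0]) (auto simp: F_def)
  have d_le: "d \<le> F s" if "s \<in> S" for s
    unfolding d_def using that bdd by (auto intro: cInf_lower)
  have "\<exists>s\<in>S. F s < d + 1 / real (Suc n)" for n
    using cInf_lessD[OF ne, of "d + 1 / real (Suc n)"] by (auto simp: d_def)
  then obtain s where s: "\<And>n. s n \<in> S" "\<And>n. F (s n) < d + 1 / real (Suc n)" by metis
  \<comment> \<open>The parallelogram law with the midpoint m, which lies in S and so has squared
    distance at least d from x. It makes every minimising sequence Cauchy, and completeness is then
    asked of S only.\<close>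
  have close: "(norm (u - v))\<^sup>2 \<le> 2 * F u + 2 * F v - 4 * d" if "u \<in> S" "v \<in> S" for u v
  proof -
    define m where "m = (1/2) *\<^sub>R (u + v)"
    have "m \<in> S"
      unfolding m_def using that S(1) by (intro subspace_mul subspace_add)
    then have "d \<le> F m" by (rule d_le)
    moreover have "(norm (u - v))\<^sup>2 = 2 * F u + 2 * F v - 4 * F m"
      unfolding F_def m_def power2_norm_eq_inner
      by (simp add: inner_diff_left inner_diff_right inner_add_left inner_add_right algebra_simps inner_commute)
    ultimately show ?thesis by linarith
  qed
  have "Cauchy s"
  proof (rule metric_CauchyI)
    fix e :: real assume e: "e > 0"
    obtain N where N: "1 / real (Suc N) < e\<^sup>2 / 4"
      using reals_Archimedean[of "e\<^sup>2/4"] e by (auto simp: inverse_eq_divide)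
    have "dist (s m) (s n) < e" if "m \<ge> N" "n \<ge> N" for m n
    proof -
      have "1 / real (Suc m) \<le> 1 / real (Suc N)" "1 / real (Suc n) \<le> 1 / real (Suc N)"
        using that by (simp_all add: frac_le)
      then have "(norm (s m - s n))\<^sup>2 < e\<^sup>2"
        using close[OF s(1) s(1), of m n] s(2)[of m] s(2)[of n] N by linarith
      then show ?thesis using e by (simp add: dist_norm power2_less_imp_less)
    qed
    then show "\<exists>M. \<forall>m\<ge>M. \<forall>n\<ge>M. dist (s m) (s n) < e" by blast
  qed
  then obtain p where p: "p \<in> S" "s \<longlonglongrightarrow> p"
    using S(2) s(1) unfolding complete_def by blast
  have "(\<lambda>n. F (s n)) \<longlonglongrightarrow> F p" unfolding F_def by (intro tendsto_intros p)
  moreover have "(\<lambda>n. d + 1 / real (Suc n)) \<longlonglongrightarrow> d + 0"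
    by (intro tendsto_intros LIMSEQ_inverse_real_of_nat[unfolded inverse_eq_divide])
  ultimately have Fp: "F p \<le> d + 0"
    by (rule LIMSEQ_le) (use s(2) less_imp_le in blast)
  show ?thesis
  proof (intro bexI[OF _ p(1)] ballI)
    fix v assume v: "v \<in> S"
    define i where "i = inner (x - p) v"
    \<comment> \<open>The minimiser of the quadratic polynomial t -> F (p + t v). For v = 0 division
      by zero gives t = 0, which is harmless.\<close>
    define t where "t = i / (norm v)\<^sup>2"
    have "p + t *\<^sub>R v \<in> S" using v p(1) S(1) by (intro subspace_mul subspace_add)
    then have "F p \<le> F (p + t *\<^sub>R v)" using d_le Fp by fastforce
    also have "\<dots> = F p - 2 * t * i + t\<^sup>2 * (norm v)\<^sup>2"
      unfolding F_def i_def power2_norm_eq_inner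
      by (simp add: inner_diff_left inner_diff_right inner_add_left inner_add_right
          algebra_simps inner_commute power2_eq_square)
    finally have "2 * t * i \<le> t\<^sup>2 * (norm v)\<^sup>2" by simp
    moreover have "t * i = t\<^sup>2 * (norm v)\<^sup>2"
      by (cases "v = 0") (simp_all add: t_def i_def power2_eq_square)
    ultimately have "t\<^sup>2 * (norm v)\<^sup>2 \<le> 0" by linarith
    then have "t * norm v = 0" by (simp add: power_mult_distrib[symmetric])
    then show "inner (x - p) v = 0"
      by (auto simp: t_def i_def)
  qed
qed

text \<open>T need not be symmetric, so the solution is obtained as the fixed point of w -> P (w -
  \<rho> (T w - f)). The projection P returns to S, since T does not preserve it; P is nonexpansive,
  and for suitable \<rho> the affine map inside is a contraction on S.\<close>

lemma lax_milgram:
  fixes T :: "'a::real_inner \<Rightarrow> 'a"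
  assumes S: "subspace S" "complete S" and T: "bounded_linear T"
    and \<alpha>: "\<alpha> > 0" "\<And>v. v \<in> S \<Longrightarrow> \<alpha> * (norm v)\<^sup>2 \<le> inner (T v) v"
  shows "\<exists>w\<in>S. \<forall>v\<in>S. inner (T w) v = inner f v"
proof -
  interpret T: bounded_linear T by fact
  obtain C0 where C0: "\<And>x. norm (T x) \<le> norm x * C0" using T.bounded by blast
  \<comment> \<open>Enlarging the bound to at least \<alpha> ensures C > 0 and \<alpha> / C \<le> 1,
    so that the radicand in q below lies in [0, 1).\<close>
  define C where "C = max C0 \<alpha>"
  have C: "norm (T x) \<le> norm x * C" for x
    by (rule order_trans[OF C0]) (simp add: C_def mult_left_mono)
  have C_pos: "C > 0" "\<alpha> \<le> C" using \<alpha>(1) by (simp_all add: C_def)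
  define P where "P = (\<lambda>x. SOME p. p \<in> S \<and> (\<forall>v\<in>S. inner (x - p) v = 0))"
  have P: "P x \<in> S" "\<And>v. v \<in> S \<Longrightarrow> inner (x - P x) v = 0" for x
  proof -
    obtain p where "p \<in> S \<and> (\<forall>v\<in>S. inner (x - p) v = 0)"
      using subspace_projection_exists[OF S, of x] by blast
    then have "P x \<in> S \<and> (\<forall>v\<in>S. inner (x - P x) v = 0)" unfolding P_def by (rule someI)
    then show "P x \<in> S" "\<And>v. v \<in> S \<Longrightarrow> inner (x - P x) v = 0" by auto
  qed
  have P_le: "norm (P x - P y) \<le> norm (x - y)" for x y
  proof -
    have PS: "P x - P y \<in> S" using P S(1) by (intro subspace_diff)
    have "inner ((x - y) - (P x - P y)) (P x - P y) = 0"
      using P(2)[OF PS, of x] P(2)[OF PS, of y] by (simp add: inner_diff_left algebra_simps)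
    then have "(norm (P x - P y))\<^sup>2 = inner (x - y) (P x - P y)"
      by (simp add: inner_diff_left power2_norm_eq_inner)
    also have "\<dots> \<le> norm (x - y) * norm (P x - P y)" by (rule norm_cauchy_schwarz)
    finally show ?thesis
      by (cases "norm (P x - P y) = 0") (auto simp: power2_eq_square)
  qed
  \<comment> \<open>The minimiser of 1 - 2 \<rho> \<alpha> + (\<rho> C)^2; the minimum is
    q^2.\<close>
  define \<rho> where "\<rho> = \<alpha> / C\<^sup>2"
  define G where "G = (\<lambda>w. P (w - \<rho> *\<^sub>R (T w - f)))"
  define q where "q = sqrt (1 - \<alpha>\<^sup>2 / C\<^sup>2)"
  have \<alpha>C: "\<alpha>\<^sup>2 / C\<^sup>2 \<le> 1" "0 < \<alpha>\<^sup>2 / C\<^sup>2"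
    using \<alpha>(1) C_pos by (auto simp: power_mono)
  have contr: "dist (G x) (G y) \<le> q * dist x y" if "x \<in> S" "y \<in> S" for x y
  proof -
    define z where "z = x - y"
    have z: "z \<in> S" using that S(1) by (simp add: z_def subspace_diff)
    have "(norm (z - \<rho> *\<^sub>R T z))\<^sup>2 = (norm z)\<^sup>2 - 2 * \<rho> * inner (T z) z + \<rho>\<^sup>2 * (norm (T z))\<^sup>2"
      unfolding power2_norm_eq_inner
      by (simp add: inner_diff_left inner_diff_right inner_commute power2_eq_square algebra_simps)
    also have "\<dots> \<le> (norm z)\<^sup>2 - 2 * \<rho> * (\<alpha> * (norm z)\<^sup>2) + \<rho>\<^sup>2 * (norm z * C)\<^sup>2"
    proof -
      have "\<rho> * (\<alpha> * (norm z)\<^sup>2) \<le> \<rho> * inner (T z) z"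
        using \<alpha> z by (intro mult_left_mono) (auto simp: \<rho>_def)
      moreover have "(norm (T z))\<^sup>2 \<le> (norm z * C)\<^sup>2" by (intro power_mono C) auto
      then have "\<rho>\<^sup>2 * (norm (T z))\<^sup>2 \<le> \<rho>\<^sup>2 * (norm z * C)\<^sup>2" by (intro mult_left_mono) auto
      ultimately show ?thesis by linarith
    qed
    also have "\<dots> = (q * norm z)\<^sup>2"
      using \<alpha>C C_pos by (simp add: q_def \<rho>_def power_mult_distrib field_simps power2_eq_square)
    finally have "norm (z - \<rho> *\<^sub>R T z) \<le> q * norm z"
      using \<alpha>C by (auto intro!: power2_le_imp_le simp: q_def)
    moreover have "(x - \<rho> *\<^sub>R (T x - f)) - (y - \<rho> *\<^sub>R (T y - f)) = z - \<rho> *\<^sub>R T z"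
      by (simp add: z_def T.diff algebra_simps)
    ultimately show ?thesis
      using P_le[of "x - \<rho> *\<^sub>R (T x - f)" "y - \<rho> *\<^sub>R (T y - f)"]
      unfolding G_def dist_norm z_def by (metis order_trans)
  qed
  have "\<exists>!w\<in>S. G w = w"
  proof (rule Banach_fix[OF S(2) _ _ _ _ contr])
    show "S \<noteq> {}" using subspace_0[OF S(1)] by auto
    show "0 \<le> q" "q < 1" using \<alpha>C by (auto simp: q_def)
    show "G ` S \<subseteq> S" using P(1) by (auto simp: G_def)
  qed
  then obtain w where w: "w \<in> S" "G w = w" by blast
  show ?thesis
  proof (intro bexI[OF _ w(1)] ballI)
    fix v assume "v \<in> S"
    then have "inner ((w - \<rho> *\<^sub>R (T w - f)) - w) v = 0"
      using P(2)[of v "w - \<rho> *\<^sub>R (T w - f)"] w(2) by (simp add: G_def)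
    then have "\<rho> * inner (T w - f) v = 0" by simp
    then show "inner (T w) v = inner f v"
      using \<alpha>(1) C_pos by (simp add: \<rho>_def inner_diff_left)
  qed
qed

text \<open>A dimension count inside an infinite-dimensional type. Since L is linear on E only, it
  is replaced by a linear map L' on the whole space that agrees with it on a basis A of E, and hence
  on E.\<close>

lemma inj_linear_span_finite_surj:
  fixes L :: "'a::real_vector \<Rightarrow> 'a"
  assumes B: "finite B" and E: "span B = E"
    and add: "\<And>x y. x \<in> E \<Longrightarrow> y \<in> E \<Longrightarrow> L (x + y) = L x + L y"
    and scale: "\<And>r x. x \<in> E \<Longrightarrow> L (r *\<^sub>R x) = r *\<^sub>R L x"
    and into: "\<And>x. x \<in> E \<Longrightarrow> L x \<in> E"
    and inj: "\<And>x. x \<in> E \<Longrightarrow> L x = 0 \<Longrightarrow> x = 0"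
    and y: "y \<in> E"
  obtains x where "x \<in> E" "L x = y"
proof -
  have sub: "subspace E" using E by (metis subspace_span)
  obtain A where A: "A \<subseteq> B" "independent A" "B \<subseteq> span A"
    using maximal_independent_subset by blast
  have fA: "finite A" using A(1) B finite_subset by blast
  have spA: "span A = E"
    using A E by (metis span_mono span_minimal subspace_span order_antisym)
  have AE: "A \<subseteq> E" using spA span_superset[of A] by blast
  obtain L' where L': "linear L'" "\<forall>x\<in>A. L' x = L x"
    using linear_independent_extend[OF A(2)] by blast
  have L'L: "L' x = L x" if "x \<in> E" for x
  proof -
    have "x \<in> span A" using that spA by simp
    then have "x \<in> E \<and> L' x = L x"
    proof (induction rule: span_induct_alt)
      case base
      show ?case
        using scale[OF subspace_0[OF sub], of 0] linear_0[OF L'(1)] subspace_0[OF sub] by simp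
    next
      case (step r a z)
      then have "a \<in> E" "z \<in> E" using AE by auto
      then show ?case using step L' add[of "r *\<^sub>R a" z] scale[of a r] sub
        by (simp add: linear_add linear_scale subspace_mul subspace_add)
    qed
    then show ?thesis by simp
  qed
  have injL: "inj_on L' E"
    unfolding linear_injective_on_subspace_0[OF L'(1) sub] using L'L inj by simp
  have ind: "independent (L' ` A)"
    by (rule linear_independent_injective_image[OF L'(1) A(2)]) (simp add: spA injL)
  have card: "card (L' ` A) = card A"
    using inj_on_subset[OF injL AE] by (rule card_image)
  have "y \<in> span (L' ` A)"
  proof (rule ccontr)
    assume n: "y \<notin> span (L' ` A)"
    then have "independent (insert y (L' ` A))" using ind by (simp add: independent_insert)
    moreover have "insert y (L' ` A) \<subseteq> span A" using y spA into AE L'L by auto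
    ultimately have "card (insert y (L' ` A)) \<le> card A"
      using independent_span_bound[OF fA] by blast
    moreover have "y \<notin> L' ` A" using n span_base by metis
    ultimately show False using fA card by simp
  qed
  then have "y \<in> L' ` E" using linear_span_image[OF L'(1), of A] spA by simp
  then show thesis using that L'L by force
qed

text \<open>
  With \<open>Z\<close> the solution operator of the coercive form, the equation reduces to inverting
  \<open>1 - R \<circ> Z\<close> on the span of the vectors \<open>e i\<close>.
\<close>

lemma fredholm_finite_rank:
  fixes T :: "'a::real_inner \<Rightarrow> 'a" and e :: "'i \<Rightarrow> 'a"
  assumes S: "subspace S" "complete S" and T: "bounded_linear T" and I: "finite I"
    and \<alpha>: "\<alpha> > 0"
      "\<And>v. v \<in> S \<Longrightarrow> \<alpha> * (norm v)\<^sup>2 \<le> inner (T v) v + K * (\<Sum>i\<in>I. (inner v (e i))\<^sup>2)"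
    and inj: "\<And>u. u \<in> S \<Longrightarrow> (\<And>v. v \<in> S \<Longrightarrow> inner (T u) v = 0) \<Longrightarrow> u = 0"
  shows "\<exists>u\<in>S. \<forall>v\<in>S. inner (T u) v = inner f v"
proof -
  interpret T: bounded_linear T by fact
  \<comment> \<open>The operator of the finite rank correction: inner (R v) v is exactly the sum of
    squares in the coercivity assumption, so B = T + R is coercive on S.\<close>
  define R where "R = (\<lambda>u. K *\<^sub>R (\<Sum>i\<in>I. inner u (e i) *\<^sub>R e i))"
  define B where "B = (\<lambda>u. T u + R u)"
  have R: "bounded_linear R" unfolding R_def
    by (intro bounded_linear_const_scaleR bounded_linear_sum bounded_linear_compose[OF bounded_linear_scaleR_left] bounded_linear_inner_left)
  interpret R: bounded_linear R by fact
  have B: "bounded_linear B" unfolding B_def by (intro bounded_linear_add T R)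
  interpret B: bounded_linear B by fact
  have coerc: "\<alpha> * (norm v)\<^sup>2 \<le> inner (B v) v" if "v \<in> S" for v
  proof -
    have "inner (R v) v = K * (\<Sum>i\<in>I. (inner v (e i))\<^sup>2)"
      unfolding R_def inner_scaleR_left inner_sum_left
      by (simp add: power2_eq_square inner_commute)
    then show ?thesis using \<alpha>(2)[OF that] by (simp add: B_def inner_add_left)
  qed
  have uniq: "w = w'" if "w \<in> S" "w' \<in> S" "\<And>v. v \<in> S \<Longrightarrow> inner (B w) v = inner (B w') v" for w w'
  proof -
    have "w - w' \<in> S" using that S(1) by (simp add: subspace_diff)
    then have "\<alpha> * (norm (w - w'))\<^sup>2 \<le> 0"
      using coerc[of "w - w'"] that(3)[of "w - w'"] by (simp add: B.diff inner_diff_left)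
    then show ?thesis using \<alpha>(1) by (simp add: mult_le_0_iff)
  qed
  define Z where "Z = (\<lambda>x. SOME z. z \<in> S \<and> (\<forall>v\<in>S. inner (B z) v = inner x v))"
  have Z: "Z x \<in> S" "\<And>v. v \<in> S \<Longrightarrow> inner (B (Z x)) v = inner x v" for x
  proof -
    obtain z where "z \<in> S \<and> (\<forall>v\<in>S. inner (B z) v = inner x v)"
      using lax_milgram[OF S B \<alpha>(1) coerc, of x] by blast
    then have "Z x \<in> S \<and> (\<forall>v\<in>S. inner (B (Z x)) v = inner x v)" unfolding Z_def by (rule someI)
    then show "Z x \<in> S" "\<And>v. v \<in> S \<Longrightarrow> inner (B (Z x)) v = inner x v" by auto
  qed
  have Z_add: "Z (x + y) = Z x + Z y" for x y
    using Z S(1) by (intro uniq) (auto simp: B.add inner_add_left subspace_add)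
  have Z_scale: "Z (r *\<^sub>R x) = r *\<^sub>R Z x" for r x
    using Z S(1) by (intro uniq) (auto simp: B.scaleR subspace_mul)
  define E where "E = span (e ` I)"
  have RE: "R u \<in> E" for u unfolding R_def E_def
    by (intro span_mul span_sum) (auto intro: span_base)
  define L where "L = (\<lambda>x. x - R (Z x))"
  \<comment> \<open>The choice of right-hand side makes R (Z x + Z f) = x. Then B (Z x + Z f) = x +
    f, tested on S, loses its finite rank part and leaves T (Z x + Z f) = f.\<close>
  obtain x where x: "x \<in> E" "L x = R (Z f)"
  proof (rule inj_linear_span_finite_surj[of "e ` I" E L "R (Z f)"])
    show "finite (e ` I)" using I by simp
    show "L x \<in> E" if "x \<in> E" for x
      using that RE unfolding L_def E_def by (intro span_diff) auto
    fix x assume "x \<in> E" "L x = 0"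
    then have x: "x = R (Z x)" by (simp add: L_def)
    \<comment> \<open>With x = R (Z x), the equation B (Z x) = x on S cancels to T (Z x) = 0 on S,
      so injectivity of the original form is what makes L injective.\<close>
    have "inner (T (Z x)) v = 0" if "v \<in> S" for v
      using Z(2)[OF that, of x] x by (simp add: B_def inner_add_left)
    then have "Z x = 0" using inj Z(1) by blast
    then show "x = 0" using x by (simp add: R.zero)
  qed (auto simp: E_def L_def Z_add Z_scale R.add R.scaleR algebra_simps RE[unfolded E_def])
  show ?thesis
  proof (intro bexI[of _ "Z x + Z f"] ballI)
    show "Z x + Z f \<in> S" using Z S(1) by (simp add: subspace_add)
    fix v assume v: "v \<in> S"
    have "x - R (Z x) = R (Z f)" using x by (simp add: L_def)
    then have "R (Z x + Z f) = x" by (simp add: R.add algebra_simps)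
    moreover have "inner (B (Z x + Z f)) v = inner (x + f) v"
      using Z(2)[OF v] by (simp add: B.add inner_add_left)
    ultimately show "inner (T (Z x + Z f)) v = inner f v" by (simp add: B_def inner_add_left)
  qed
qed

section \<open>The Hilbert space of square integrable functions\<close>

text \<open>Same condition as \<open>L2\<close>, but for values in any Euclidean space, because
  functions are later bundled with their gradients.\<close>

definition sq_integrable :: "'a measure \<Rightarrow> ('a \<Rightarrow> 'b::euclidean_space) \<Rightarrow> bool"
  where "sq_integrable M f \<longleftrightarrow> f \<in> borel_measurable M \<and> integrable M (\<lambda>x. (norm (f x))\<^sup>2)"

lemma sq_integrable_norm: "sq_integrable M f \<Longrightarrow> integrable M (\<lambda>x. (norm (f x))\<^sup>2)"
  by (simp add: sq_integrable_def)

lemma norm_add_sq_le: "(norm (x + y))\<^sup>2 \<le> 2 * (norm x)\<^sup>2 + 2 * (norm (y::'a::real_inner))\<^sup>2"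
proof -
  have "0 \<le> (norm (x - y))\<^sup>2" by simp
  then show ?thesis
    by (simp add: power2_norm_eq_inner inner_add_left inner_add_right inner_diff_left inner_diff_right inner_commute)
qed

lemma norm_diff_sq_le: "(norm (x - y))\<^sup>2 \<le> 2 * (norm x)\<^sup>2 + 2 * (norm (y::'a::real_inner))\<^sup>2"
  using norm_add_sq_le[of x "- y"] by simp

lemma sq_integrable_zero [simp]: "sq_integrable M (\<lambda>x. 0)"
  by (simp add: sq_integrable_def)

lemma sq_integrable_bound:
  assumes "g \<in> borel_measurable M" "integrable M F" "AE x in M. (norm (g x))\<^sup>2 \<le> F x"
  shows "sq_integrable M g"
  unfolding sq_integrable_def
proof
  show "integrable M (\<lambda>x. (norm (g x))\<^sup>2)"
    by (rule Bochner_Integration.integrable_bound[OF assms(2)]) (use assms in \<open>auto\<close>)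
qed (rule assms)

lemma sq_integrable_add:
  assumes "sq_integrable M f" "sq_integrable M g"
  shows "sq_integrable M (\<lambda>x. f x + g x)"
proof (rule sq_integrable_bound)
  show "integrable M (\<lambda>x. 2 * (norm (f x))\<^sup>2 + 2 * (norm (g x))\<^sup>2)"
    using assms by (auto simp: sq_integrable_def)
  show "(\<lambda>x. f x + g x) \<in> borel_measurable M"
    using assms by (auto simp: sq_integrable_def)
qed (simp add: norm_add_sq_le)

lemma sq_integrable_scaleR:
  assumes "sq_integrable M f" shows "sq_integrable M (\<lambda>x. c *\<^sub>R f x)"
  using assms by (auto simp: sq_integrable_def power_mult_distrib)

lemma sq_integrable_uminus:
  assumes "sq_integrable M f" shows "sq_integrable M (\<lambda>x. - f x)"
  using assms by (auto simp: sq_integrable_def)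

lemma sq_integrable_diff:
  assumes "sq_integrable M f" "sq_integrable M g"
  shows "sq_integrable M (\<lambda>x. f x - g x)"
  using sq_integrable_add[OF assms(1) sq_integrable_uminus[OF assms(2)]] by simp

lemma abs_inner_le_sq: "\<bar>inner x y\<bar> \<le> (norm x)\<^sup>2 + (norm (y::'a::real_inner))\<^sup>2"
proof -
  have "\<bar>inner x y\<bar> \<le> norm x * norm y" by (rule Cauchy_Schwarz_ineq2)
  also have "\<dots> \<le> (norm x)\<^sup>2 + (norm y)\<^sup>2"
    using sum_squares_bound[of "norm x" "norm y"] mult_nonneg_nonneg[OF norm_ge_zero[of x] norm_ge_zero[of y]]
    by linarith
  finally show ?thesis .
qed

lemma sq_integrable_inner:
  assumes "sq_integrable M f" "sq_integrable M g"
  shows "integrable M (\<lambda>x. inner (f x) (g x))"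
proof (rule Bochner_Integration.integrable_bound)
  show "integrable M (\<lambda>x. (norm (f x))\<^sup>2 + (norm (g x))\<^sup>2)"
    using assms by (auto simp: sq_integrable_def)
  show "(\<lambda>x. inner (f x) (g x)) \<in> borel_measurable M"
    using assms by (auto simp: sq_integrable_def)
  show "AE x in M. norm (inner (f x) (g x)) \<le> norm ((norm (f x))\<^sup>2 + (norm (g x))\<^sup>2)"
    using abs_inner_le_sq[of "f _" "g _"] by simp
qed

section \<open>Square integrable functions modulo null sets as a complete inner product
  space\<close>

definition l2_rel :: "('a::euclidean_space \<Rightarrow> 'b::euclidean_space) \<Rightarrow> ('a \<Rightarrow> 'b) \<Rightarrow> bool"
  where "l2_rel f g \<longleftrightarrow> sq_integrable lebesgue f \<and> sq_integrable lebesgue g \<and> (AE x in lebesgue. f x = g x)"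

\<comment> \<open>A partial quotient: the relation is reflexive only on square integrable functions,
  so that passing to the subset and identifying functions that agree almost everywhere happen in one
  step.\<close>
quotient_type (overloaded) ('a, 'b) l2 = "'a::euclidean_space \<Rightarrow> 'b::euclidean_space" / partial: l2_rel
proof (rule part_equivpI)
  show "\<exists>x. l2_rel x x" by (rule exI[of _ "\<lambda>_. 0"]) (simp add: l2_rel_def)
  show "symp l2_rel" by (auto simp: symp_def l2_rel_def)
  show "transp l2_rel" by (auto simp: transp_def l2_rel_def)
qed

instantiation l2 :: (euclidean_space, euclidean_space) real_inner
begin

lift_definition zero_l2 :: "('a, 'b) l2" is "\<lambda>x. 0" by (simp add: l2_rel_def)

lift_definition plus_l2 :: "('a, 'b) l2 \<Rightarrow> ('a, 'b) l2 \<Rightarrow> ('a, 'b) l2" is "\<lambda>f g x. f x + g x"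
  by (auto simp: l2_rel_def intro: sq_integrable_add)

lift_definition minus_l2 :: "('a, 'b) l2 \<Rightarrow> ('a, 'b) l2 \<Rightarrow> ('a, 'b) l2" is "\<lambda>f g x. f x - g x"
  by (auto simp: l2_rel_def intro: sq_integrable_diff)

lift_definition uminus_l2 :: "('a, 'b) l2 \<Rightarrow> ('a, 'b) l2" is "\<lambda>f x. - f x"
  by (auto simp: l2_rel_def intro: sq_integrable_uminus)

lift_definition scaleR_l2 :: "real \<Rightarrow> ('a, 'b) l2 \<Rightarrow> ('a, 'b) l2" is "\<lambda>c f x. c *\<^sub>R f x"
  by (auto simp: l2_rel_def intro: sq_integrable_scaleR)

lift_definition inner_l2 :: "('a, 'b) l2 \<Rightarrow> ('a, 'b) l2 \<Rightarrow> real" is "\<lambda>f g. LINT x|lebesgue. inner (f x) (g x)"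
proof -
  fix f f' g g' :: "'a \<Rightarrow> 'b" assume "l2_rel f f'" "l2_rel g g'"
  then show "(LINT x|lebesgue. inner (f x) (g x)) = (LINT x|lebesgue. inner (f' x) (g' x))"
    by (intro integral_cong_AE borel_measurable_inner) (auto simp: l2_rel_def sq_integrable_def)
qed

definition norm_l2 :: "('a, 'b) l2 \<Rightarrow> real" where "norm_l2 f = sqrt (inner f f)"
definition sgn_l2 :: "('a, 'b) l2 \<Rightarrow> ('a, 'b) l2" where "sgn_l2 f = scaleR (inverse (norm f)) f"
definition dist_l2 :: "('a, 'b) l2 \<Rightarrow> ('a, 'b) l2 \<Rightarrow> real" where "dist_l2 f g = norm (f - g)"
definition uniformity_l2 :: "(('a, 'b) l2 \<times> ('a, 'b) l2) filter"
  where "uniformity_l2 = (INF e\<in>{0 <..}. principal {(x, y). dist x y < e})"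
definition open_l2 :: "('a, 'b) l2 set \<Rightarrow> bool"
  where "open_l2 U \<longleftrightarrow> (\<forall>x\<in>U. \<forall>\<^sub>F (x', y) in uniformity. x' = x \<longrightarrow> y \<in> U)"

instance
proof
  fix x y z :: "('a, 'b) l2" and r s :: real and U :: "('a, 'b) l2 set"
  show "x + y + z = x + (y + z)"
    by transfer (auto simp: l2_rel_def add_ac intro!: sq_integrable_add)
  show "x + y = y + x"
    by transfer (auto simp: l2_rel_def add_ac intro!: sq_integrable_add)
  show "0 + x = x" by transfer (auto simp: l2_rel_def)
  show "- x + x = 0" by transfer (auto simp: l2_rel_def)
  show "x - y = x + - y"
    by transfer (auto simp: l2_rel_def intro: sq_integrable_add sq_integrable_uminus sq_integrable_diff)
  show "r *\<^sub>R (x + y) = r *\<^sub>R x + r *\<^sub>R y"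
    by transfer (auto simp: l2_rel_def scaleR_add_right intro!: sq_integrable_add sq_integrable_scaleR)
  show "(r + s) *\<^sub>R x = r *\<^sub>R x + s *\<^sub>R x"
    by transfer (auto simp: l2_rel_def scaleR_add_left intro!: sq_integrable_add sq_integrable_scaleR)
  show "r *\<^sub>R s *\<^sub>R x = (r * s) *\<^sub>R x"
    by transfer (auto simp: l2_rel_def intro: sq_integrable_scaleR)
  show "1 *\<^sub>R x = x" by transfer (auto simp: l2_rel_def)
  show "inner x y = inner y x" by transfer (simp add: inner_commute)
  show "inner (x + y) z = inner x z + inner y z"
    by transfer (auto simp: l2_rel_def inner_add_left intro!: Bochner_Integration.integral_add sq_integrable_inner)
  show "inner (r *\<^sub>R x) y = r * inner x y" by transfer simp
  show "0 \<le> inner x x" by transfer simp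
  show "(inner x x = 0) = (x = 0)"
  proof transfer
    fix f :: "'a \<Rightarrow> 'b" assume "l2_rel f f"
    then have f: "sq_integrable lebesgue f" by (simp add: l2_rel_def)
    have "(LINT x|lebesgue. inner (f x) (f x)) = 0 \<longleftrightarrow> (AE x in lebesgue. inner (f x) (f x) = 0)"
      using f by (intro integral_nonneg_eq_0_iff_AE sq_integrable_inner) auto
    then show "((LINT x|lebesgue. inner (f x) (f x)) = 0) = l2_rel f (\<lambda>x. 0)"
      using f by (simp add: l2_rel_def)
  qed
qed (simp_all add: norm_l2_def sgn_l2_def dist_l2_def uniformity_l2_def open_l2_def)

end

definition l2_fun :: "('a::euclidean_space, 'b::euclidean_space) l2 \<Rightarrow> 'a \<Rightarrow> 'b"
  where "l2_fun = rep_l2"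

text \<open>\<open>l2_class f\<close> is unspecified unless \<open>f\<close> is square integrable.\<close>

definition l2_class :: "('a::euclidean_space \<Rightarrow> 'b::euclidean_space) \<Rightarrow> ('a, 'b) l2"
  where "l2_class f = abs_l2 f"

lemma l2_class_fun: "l2_class (l2_fun u) = u"
  unfolding l2_class_def l2_fun_def by (rule Quotient3_abs_rep[OF Quotient3_l2])

lemma sq_integrable_l2_fun: "sq_integrable lebesgue (l2_fun u)"
  using Quotient3_rep_reflp[OF Quotient3_l2, of u] by (simp add: l2_fun_def l2_rel_def)

lemma l2_class_eq_iff:
  assumes "sq_integrable lebesgue f" "sq_integrable lebesgue g"
  shows "l2_class f = l2_class g \<longleftrightarrow> (AE x in lebesgue. f x = g x)"
  using Quotient3_rel[OF Quotient3_l2, of f g] assms by (auto simp: l2_class_def l2_rel_def)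

lemma l2_fun_class:
  assumes "sq_integrable lebesgue f"
  shows "AE x in lebesgue. l2_fun (l2_class f) x = f x"
  using l2_class_fun[of "l2_class f"] l2_class_eq_iff[OF sq_integrable_l2_fun assms] by simp

lemma l2_class_add:
  assumes "sq_integrable lebesgue f" "sq_integrable lebesgue g"
  shows "l2_class f + l2_class g = l2_class (\<lambda>x. f x + g x)"
  unfolding l2_class_def using assms by (intro plus_l2.abs_eq) (auto simp: l2_rel_def)

lemma l2_class_diff:
  assumes "sq_integrable lebesgue f" "sq_integrable lebesgue g"
  shows "l2_class f - l2_class g = l2_class (\<lambda>x. f x - g x)"
  unfolding l2_class_def using assms by (intro minus_l2.abs_eq) (auto simp: l2_rel_def)

lemma l2_class_scaleR:
  assumes "sq_integrable lebesgue f"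
  shows "c *\<^sub>R l2_class f = l2_class (\<lambda>x. c *\<^sub>R f x)"
  unfolding l2_class_def using assms by (intro scaleR_l2.abs_eq) (auto simp: l2_rel_def)

lemma inner_l2_class:
  assumes "sq_integrable lebesgue f" "sq_integrable lebesgue g"
  shows "inner (l2_class f) (l2_class g) = (LINT x|lebesgue. inner (f x) (g x))"
  unfolding l2_class_def using assms by (intro inner_l2.abs_eq) (auto simp: l2_rel_def)

lemma norm_l2_class:
  assumes "sq_integrable lebesgue f"
  shows "(norm (l2_class f))\<^sup>2 = (LINT x|lebesgue. (norm (f x))\<^sup>2)"
  using assms by (simp add: power2_norm_eq_inner inner_l2_class)

text \<open>Either a k \<le> (1/2)^k, or 2^k a k \<ge> 1 and then a k \<le> 2^k (a k)^2. In both
  cases the sum of the two bounds dominates.\<close>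

lemma geometric_sq_summable_imp_summable:
  fixes a :: "nat \<Rightarrow> real"
  assumes a: "\<And>k. 0 \<le> a k" and s: "summable (\<lambda>k. 2 ^ k * (a k)\<^sup>2)"
  shows "summable a"
proof (rule summable_comparison_test')
  show "summable (\<lambda>k. 2 ^ k * (a k)\<^sup>2 + (1/2) ^ k)"
    by (intro summable_add s summable_geometric) simp
  show "norm (a k) \<le> 2 ^ k * (a k)\<^sup>2 + (1/2) ^ k" for k
  proof -
    have "a k \<le> 2 ^ k * (a k)\<^sup>2 + (1/2) ^ k"
    proof (cases "a k \<le> (1/2)^k")
      case False
      then have "1 \<le> 2 ^ k * a k" by (simp add: field_simps)
      then have "a k * 1 \<le> a k * (2 ^ k * a k)" using a by (intro mult_left_mono)
      then show ?thesis by (simp add: power2_eq_square algebra_simps) (simp add: add_increasing)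
    qed (simp add: add_increasing)
    then show ?thesis using a by simp
  qed
qed

text \<open>The weights 2^k still leave the integrated squared increments summable. Hence the
  weighted series of squares is finite almost everywhere, the increments are absolutely summable
  there, and the sequence telescopes. This avoids Minkowski's inequality for series.\<close>

lemma sq_integrable_fast_Cauchy_converges:
  fixes f :: "nat \<Rightarrow> 'a \<Rightarrow> 'b::euclidean_space"
  assumes f: "\<And>n. sq_integrable M (f n)"
    and fast: "\<And>n. (LINT x|M. (norm (f (Suc n) x - f n x))\<^sup>2) \<le> (1/4) ^ n"
  obtains g where "g \<in> borel_measurable M" "AE x in M. (\<lambda>n. f n x) \<longlonglongrightarrow> g x"
proof (rule that)
  have meas [measurable]: "f n \<in> borel_measurable M" for n using f by (simp add: sq_integrable_def)
  define a where "a = (\<lambda>k x. norm (f (Suc k) x - f k x))"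
  have [measurable]: "a k \<in> borel_measurable M" for k by (simp add: a_def)
  show "(\<lambda>x. lim (\<lambda>n. f n x)) \<in> borel_measurable M" by measurable
  have int: "integrable M (\<lambda>x. (a k x)\<^sup>2)" for k
    using sq_integrable_diff[OF f f] by (simp add: a_def sq_integrable_def)
  have "(\<integral>\<^sup>+x. (\<Sum>k. ennreal (2 ^ k * (a k x)\<^sup>2)) \<partial>M) = (\<Sum>k. \<integral>\<^sup>+x. ennreal (2 ^ k * (a k x)\<^sup>2) \<partial>M)"
    by (rule nn_integral_suminf) measurable
  also have "\<dots> = (\<Sum>k. ennreal (2 ^ k * (LINT x|M. (a k x)\<^sup>2)))"
    by (subst nn_integral_eq_integral) (auto intro!: int simp: Bochner_Integration.integral_mult_right[OF int])
  also have "\<dots> \<le> (\<Sum>k. ennreal ((1/2) ^ k))"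
  proof (intro suminf_le ennreal_leI summableI)
    fix k
    have "2 ^ k * (LINT x|M. (a k x)\<^sup>2) \<le> 2 ^ k * (1/4) ^ k"
      using fast by (intro mult_left_mono) (auto simp: a_def)
    then show "2 ^ k * (LINT x|M. (a k x)\<^sup>2) \<le> (1/2) ^ k"
      by (simp add: power_mult_distrib[symmetric])
  qed
  also have "\<dots> = ennreal (\<Sum>k. (1/2) ^ k)" by (rule suminf_ennreal2) (auto intro: summable_geometric)
  also have "\<dots> < \<infinity>" by simp
  finally have "AE x in M. (\<Sum>k. ennreal (2 ^ k * (a k x)\<^sup>2)) \<noteq> \<infinity>"
    by (intro nn_integral_noteq_infinite) auto
  then show "AE x in M. (\<lambda>n. f n x) \<longlonglongrightarrow> lim (\<lambda>n. f n x)"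
  proof eventually_elim
    case (elim x)
    have "summable (\<lambda>k. 2 ^ k * (a k x)\<^sup>2)"
    proof (rule summable_suminf_not_top)
      show "0 \<le> 2 ^ k * (a k x)\<^sup>2" for k by simp
      show "(\<Sum>k. ennreal (2 ^ k * (a k x)\<^sup>2)) \<noteq> top" using elim by simp
    qed
    then have "summable (\<lambda>k. a k x)"
      by (rule geometric_sq_summable_imp_summable[rotated]) (simp add: a_def)
    then have "summable (\<lambda>k. f (Suc k) x - f k x)"
      unfolding a_def by (rule summable_norm_cancel)
    then have "convergent (\<lambda>n. \<Sum>k<n. f (Suc k) x - f k x)"
      by (simp add: summable_iff_convergent)
    then have "convergent (\<lambda>n. f n x - f 0 x)" 
      using sum_lessThan_telescope[of "\<lambda>n. f n x"] by simp
    then obtain l where "(\<lambda>n. f n x - f 0 x) \<longlonglongrightarrow> l" by (auto simp: convergent_def)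
    then have "(\<lambda>n. f n x - f 0 x + f 0 x) \<longlonglongrightarrow> l + f 0 x" by (intro tendsto_intros)
    then have "convergent (\<lambda>n. f n x)" by (auto simp: convergent_def)
    then show ?case by (simp add: convergent_LIMSEQ_iff)
  qed
qed

text \<open>The pointwise limit g is upgraded to a limit in norm by Fatou's lemma applied to |f n -
  f m|^2 as m grows.\<close>

lemma l2_fast_Cauchy_convergent:
  fixes X :: "nat \<Rightarrow> ('a::euclidean_space, 'b::euclidean_space) l2"
  assumes X: "Cauchy X" "\<And>n. (dist (X (Suc n)) (X n))\<^sup>2 \<le> (1/4) ^ n"
  shows "convergent X"
proof -
  define f where "f = (\<lambda>n. l2_fun (X n))"
  have f: "sq_integrable lebesgue (f n)" and Xf: "X n = l2_class (f n)" for n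
    by (simp_all add: f_def sq_integrable_l2_fun l2_class_fun)
  have meas [measurable]: "f n \<in> borel_measurable lebesgue" for n using f by (simp add: sq_integrable_def)
  have dist: "(dist (X m) (X n))\<^sup>2 = (LINT x|lebesgue. (norm (f m x - f n x))\<^sup>2)" for m n
    using f by (simp add: Xf dist_norm l2_class_diff norm_l2_class sq_integrable_diff)
  have "(LINT x|lebesgue. (norm (f (Suc n) x - f n x))\<^sup>2) \<le> (1/4) ^ n" for n
    using X(2)[of n] dist by simp
  then obtain g where g [measurable]: "g \<in> borel_measurable lebesgue"
    and lim: "AE x in lebesgue. (\<lambda>n. f n x) \<longlonglongrightarrow> g x"
    using sq_integrable_fast_Cauchy_converges[of lebesgue f, OF f] by blast
  \<comment> \<open>Stated for the nonnegative integral because square integrability of g is not yet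
    known; it is deduced from this estimate.\<close>
  have bound: "(\<integral>\<^sup>+x. ennreal ((norm (f n x - g x))\<^sup>2) \<partial>lebesgue) \<le> ennreal (e\<^sup>2)"
    if N: "\<And>m. m \<ge> N \<Longrightarrow> dist (X n) (X m) < e" for N n e
  proof -
    have "(\<integral>\<^sup>+x. ennreal ((norm (f n x - g x))\<^sup>2) \<partial>lebesgue)
        = (\<integral>\<^sup>+x. liminf (\<lambda>m. ennreal ((norm (f n x - f m x))\<^sup>2)) \<partial>lebesgue)"
    proof (rule nn_integral_cong_AE, use lim in eventually_elim)
      fix x assume "(\<lambda>n. f n x) \<longlonglongrightarrow> g x"
      then have "(\<lambda>m. ennreal ((norm (f n x - f m x))\<^sup>2)) \<longlonglongrightarrow> ennreal ((norm (f n x - g x))\<^sup>2)"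
        by (intro tendsto_ennrealI tendsto_intros)
      then show "ennreal ((norm (f n x - g x))\<^sup>2) = liminf (\<lambda>m. ennreal ((norm (f n x - f m x))\<^sup>2))"
        using lim_imp_Liminf[OF sequentially_bot] by metis
    qed
    also have "\<dots> \<le> liminf (\<lambda>m. \<integral>\<^sup>+x. ennreal ((norm (f n x - f m x))\<^sup>2) \<partial>lebesgue)"
      by (rule nn_integral_liminf) measurable
    also have "\<dots> \<le> ennreal (e\<^sup>2)"
    proof (rule Liminf_le)
      show "\<forall>\<^sub>F m in sequentially. (\<integral>\<^sup>+x. ennreal ((norm (f n x - f m x))\<^sup>2) \<partial>lebesgue) \<le> ennreal (e\<^sup>2)"
        unfolding eventually_sequentially
      proof (intro exI allI impI)
        fix m assume "N \<le> m"
        then have "(dist (X n) (X m))\<^sup>2 \<le> e\<^sup>2" using N[of m] by (intro power_mono) auto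
        then show "(\<integral>\<^sup>+x. ennreal ((norm (f n x - f m x))\<^sup>2) \<partial>lebesgue) \<le> ennreal (e\<^sup>2)"
          using sq_integrable_diff[OF f f, of n m]
          by (subst nn_integral_eq_integral) (auto simp: dist sq_integrable_def intro: ennreal_leI)
      qed
    qed simp
    finally show ?thesis .
  qed
  have diff: "sq_integrable lebesgue (\<lambda>x. f n x - g x)" if "\<And>m. m \<ge> N \<Longrightarrow> dist (X n) (X m) < e" for N n e
    unfolding sq_integrable_def
  proof
    show "integrable lebesgue (\<lambda>x. (norm (f n x - g x))\<^sup>2)"
      using bound[OF that] by (intro integrableI_bounded) (auto simp: power2_eq_square top_unique less_top[symmetric])
  qed simp
  have Cau: "\<exists>N. \<forall>m\<ge>N. \<forall>n\<ge>N. dist (X n) (X m) < e" if "e > 0" for e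
    using metric_CauchyD[OF X(1) that] by blast
  obtain N where N: "\<And>m. m \<ge> N \<Longrightarrow> dist (X N) (X m) < 1" using Cau[of 1] by auto
  have sg: "sq_integrable lebesgue g"
    using sq_integrable_diff[OF f[of N] diff[OF N]] by simp
  have "X \<longlonglongrightarrow> l2_class g"
  proof (rule metric_LIMSEQ_I)
    fix e :: real assume e: "e > 0"
    then have "0 < e / 2" by simp
    then obtain N where "\<forall>m\<ge>N. \<forall>n\<ge>N. dist (X m) (X n) < e / 2" using Cau by blast
    then have N: "\<And>m n. m \<ge> N \<Longrightarrow> n \<ge> N \<Longrightarrow> dist (X n) (X m) < e / 2" by blast
    have "dist (X n) (l2_class g) < e" if n: "n \<ge> N" for n
    proof -
      have "(dist (X n) (l2_class g))\<^sup>2 = (LINT x|lebesgue. (norm (f n x - g x))\<^sup>2)"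
        using f sg by (simp add: Xf dist_norm l2_class_diff norm_l2_class sq_integrable_diff)
      moreover have "ennreal (LINT x|lebesgue. (norm (f n x - g x))\<^sup>2) \<le> ennreal ((e / 2)\<^sup>2)"
        using bound[OF N[OF _ n]] sq_integrable_diff[OF f[of n] sg]
        by (subst nn_integral_eq_integral[symmetric]) (auto simp: sq_integrable_def)
      ultimately have "(dist (X n) (l2_class g))\<^sup>2 \<le> (e / 2)\<^sup>2" by (simp add: ennreal_le_iff)
      then have "dist (X n) (l2_class g) \<le> e / 2"
        by (rule power2_le_imp_le) (use e in simp)
      then show ?thesis using e by simp
    qed
    then show "\<exists>N. \<forall>n\<ge>N. dist (X n) (l2_class g) < e" by blast
  qed
  then show ?thesis by (auto simp: convergent_def)
qed

instance l2 :: (euclidean_space, euclidean_space) complete_space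
proof
  fix X :: "nat \<Rightarrow> ('a, 'b) l2" assume X: "Cauchy X"
  have "\<exists>N. \<forall>m\<ge>N. \<forall>n\<ge>N. dist (X m) (X n) < (1/2) ^ k" for k
    using metric_CauchyD[OF X, of "(1/2) ^ k"] by auto
  then obtain N where N: "\<And>k m n. m \<ge> N k \<Longrightarrow> n \<ge> N k \<Longrightarrow> dist (X m) (X n) < (1/2) ^ k" by metis
  \<comment> \<open>Indices that increase strictly and satisfy r k \<ge> N k. Both r n and r (Suc n)
    are then beyond N n, so consecutive distances are below (1/2)^n and their squares below
    (1/4)^n.\<close>
  define r where "r = rec_nat (N 0) (\<lambda>k p. max (Suc p) (N (Suc k)))"
  have r_Suc: "r (Suc k) = max (Suc (r k)) (N (Suc k))" and r_0: "r 0 = N 0" for k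
    by (simp_all add: r_def)
  have mono: "strict_mono r" by (rule strict_monoI_Suc) (simp add: r_Suc)
  have rN: "r k \<ge> N k" for k by (cases k) (simp_all add: r_Suc r_0)
  have "convergent (X \<circ> r)"
  proof (rule l2_fast_Cauchy_convergent)
    show "Cauchy (X \<circ> r)" by (rule Cauchy_subseq_Cauchy[OF X mono])
    fix n
    have "r (Suc n) \<ge> N n" using rN[of n] by (simp add: r_Suc)
    then have "dist ((X \<circ> r) (Suc n)) ((X \<circ> r) n) < (1/2) ^ n" using rN by (auto intro: N)
    then have "(dist ((X \<circ> r) (Suc n)) ((X \<circ> r) n))\<^sup>2 \<le> ((1/2) ^ n)\<^sup>2" by (intro power_mono) auto
    also have "\<dots> = (1/4) ^ n" by (simp add: power2_eq_square power_mult_distrib[symmetric])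
    finally show "(dist ((X \<circ> r) (Suc n)) ((X \<circ> r) n))\<^sup>2 \<le> (1/4) ^ n" .
  qed
  then obtain l where "(X \<circ> r) \<longlonglongrightarrow> l" by (auto simp: convergent_def)
  then have "X \<longlonglongrightarrow> l" using Cauchy_converges_subseq[OF X mono] by blast
  then show "convergent X" by (auto simp: convergent_def)
qed

section \<open>Test functions\<close>

lemma partial_eqI: "(f has_derivative D) (at x) \<Longrightarrow> partial k f x = D (axis k 1)"
  by (simp add: partial_def frechet_derivative_at[symmetric])

text \<open>Recovers the total derivative from the partial derivatives by expanding the direction in
  the standard basis; it is what the chain rule along segments needs.\<close>

lemma has_derivative_partial:
  fixes f :: "real^'n \<Rightarrow> complex"
  assumes "f differentiable (at x)"
  shows "(f has_derivative (\<lambda>t. \<Sum>k\<in>UNIV. of_real (t $ k) * partial k f x)) (at x)"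
proof -
  have D: "(f has_derivative frechet_derivative f (at x)) (at x)"
    using assms frechet_derivative_works by blast
  then interpret bounded_linear "frechet_derivative f (at x)" by (rule has_derivative_bounded_linear)
  have "frechet_derivative f (at x) t = (\<Sum>k\<in>UNIV. of_real (t $ k) * partial k f x)" for t
  proof -
    have "frechet_derivative f (at x) t = frechet_derivative f (at x) (\<Sum>k\<in>UNIV. t $ k *\<^sub>R axis k 1)"
      by (subst basis_expansion[of t, symmetric]) (simp add: scalar_mult_eq_scaleR)
    also have "\<dots> = (\<Sum>k\<in>UNIV. t $ k *\<^sub>R frechet_derivative f (at x) (axis k 1))"
      by (simp only: sum scaleR)
    finally show ?thesis by (simp add: partial_def scaleR_conv_of_real)
  qed
  then show ?thesis using D by presburger
qed

lemma partial_add: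
  assumes "f differentiable (at x)" "g differentiable (at x)"
  shows "partial k (\<lambda>x. f x + g x) x = partial k f x + partial k g x"
proof -
  obtain D E where DE: "(f has_derivative D) (at x)" "(g has_derivative E) (at x)"
    using assms by (auto simp: differentiable_def)
  show ?thesis
    using partial_eqI[OF has_derivative_add[OF DE], of k] partial_eqI[OF DE(1), of k] partial_eqI[OF DE(2), of k]
    by simp
qed

lemma partial_cmult:
  assumes "f differentiable (at x)"
  shows "partial k (\<lambda>x. c * f x) x = c * partial k f x"
proof -
  obtain D where D: "(f has_derivative D) (at x)" using assms by (auto simp: differentiable_def)
  show ?thesis
    using partial_eqI[OF has_derivative_mult_right[OF D], of k] partial_eqI[OF D, of k] by simp
qed

lemma partial_mult:
  assumes "f differentiable (at x)" "g differentiable (at x)"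
  shows "partial k (\<lambda>x. f x * g x) x = f x * partial k g x + partial k f x * g x"
proof -
  obtain D E where DE: "(f has_derivative D) (at x)" "(g has_derivative E) (at x)"
    using assms by (auto simp: differentiable_def)
  show ?thesis
    using partial_eqI[OF has_derivative_mult[OF DE], of k] partial_eqI[OF DE(1), of k] partial_eqI[OF DE(2), of k]
    by simp
qed

lemma C_diff_imp_continuous: "C_diff m f \<Longrightarrow> continuous_on UNIV f"
  by (cases m) (auto simp: continuous_on_eq_continuous_at differentiable_imp_continuous_within)

lemma C_diff_add: "C_diff m f \<Longrightarrow> C_diff m g \<Longrightarrow> C_diff m (\<lambda>x. f x + g x)"
proof (induction m arbitrary: f g)
  case (Suc m)
  then have "partial k (\<lambda>x. f x + g x) = (\<lambda>x. partial k f x + partial k g x)" for k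
    by (auto simp: partial_add)
  then show ?case using Suc by (auto intro: differentiable_add)
qed (auto intro: continuous_on_add)

lemma C_diff_cmult: "C_diff m f \<Longrightarrow> C_diff m (\<lambda>x. c * f x)"
proof (induction m arbitrary: f)
  case (Suc m)
  then have "partial k (\<lambda>x. c * f x) = (\<lambda>x. c * partial k f x)" for k
    by (auto simp: partial_cmult)
  then show ?case using Suc by (auto intro: differentiable_mult)
qed (auto intro: continuous_on_mult)

definition supp :: "('a::topological_space \<Rightarrow> 'b::zero) \<Rightarrow> 'a set"
  where "supp f = closure {x. f x \<noteq> 0}"

lemma supp_subset: "closed A \<Longrightarrow> (\<And>x. x \<notin> A \<Longrightarrow> f x = 0) \<Longrightarrow> supp f \<subseteq> A"
  unfolding supp_def by (intro closure_minimal) auto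

lemma not_in_supp: "x \<notin> supp f \<Longrightarrow> f x = 0"
  unfolding supp_def using closure_subset[of "{x. f x \<noteq> 0}"] by blast

lemma closed_supp [simp]: "closed (supp f)" by (simp add: supp_def)

lemma compact_supp_subset: "compact A \<Longrightarrow> supp f \<subseteq> A \<Longrightarrow> compact (supp f)"
proof -
  assume A: "compact A" "supp f \<subseteq> A"
  then have "A \<inter> supp f = supp f" by blast
  then show "compact (supp f)" using compact_Int_closed[OF A(1) closed_supp[of f]] by metis
qed

lemma test_functions_iff:
  "v \<in> test_functions \<Omega> \<longleftrightarrow> (\<forall>m. C_diff m v) \<and> compact (supp v) \<and> supp v \<subseteq> \<Omega>"
  by (simp add: test_functions_def supp_def)

lemma supp_partial: "supp (partial k v) \<subseteq> supp v"
proof (rule supp_subset)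
  fix x assume x: "x \<notin> supp v"
  have "(v has_derivative (\<lambda>_. 0)) (at x)"
    by (rule has_derivative_transform_within_open[of "\<lambda>_. 0" _ _ _ "- supp v"])
       (use x in \<open>auto simp: not_in_supp open_Compl\<close>)
  then show "partial k v x = 0" using partial_eqI by fastforce
qed simp

lemma test_partial:
  assumes "v \<in> test_functions \<Omega>"
  shows "partial k v \<in> test_functions \<Omega>"
  unfolding test_functions_iff
proof (intro conjI allI)
  have v: "C_diff (Suc m) v" for m using assms unfolding test_functions_iff by blast
  show "C_diff m (partial k v)" for m using v[of m] by simp
  show "compact (supp (partial k v))"
    using assms compact_supp_subset[OF _ supp_partial[of k v]] by (simp add: test_functions_iff)
  show "supp (partial k v) \<subseteq> \<Omega>"
    using assms supp_partial[of k v] by (auto simp: test_functions_iff)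
qed

lemma test_differentiable: "v \<in> test_functions \<Omega> \<Longrightarrow> v differentiable (at x)"
  unfolding test_functions_iff by (metis C_diff.simps(2))

lemma test_continuous: "v \<in> test_functions \<Omega> \<Longrightarrow> continuous_on UNIV v"
  unfolding test_functions_iff using C_diff_imp_continuous by blast

lemma test_zero_outside: "v \<in> test_functions \<Omega> \<Longrightarrow> x \<notin> \<Omega> \<Longrightarrow> v x = 0"
  unfolding test_functions_iff using not_in_supp by blast

lemma test_add:
  assumes "u \<in> test_functions \<Omega>" "v \<in> test_functions \<Omega>"
  shows "(\<lambda>x. u x + v x) \<in> test_functions \<Omega>"
proof -
  have "supp (\<lambda>x. u x + v x) \<subseteq> supp u \<union> supp v"
    by (rule supp_subset) (auto simp: not_in_supp)
  then show ?thesis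
    using assms compact_supp_subset[of "supp u \<union> supp v"]
    by (auto simp: test_functions_iff C_diff_add)
qed

lemma test_cmult:
  assumes "v \<in> test_functions \<Omega>"
  shows "(\<lambda>x. c * v x) \<in> test_functions \<Omega>"
proof -
  have "supp (\<lambda>x. c * v x) \<subseteq> supp v"
    by (rule supp_subset) (auto simp: not_in_supp)
  then show ?thesis
    using assms compact_supp_subset[of "supp v"] by (auto simp: test_functions_iff C_diff_cmult)
qed

lemma test_zero: "(\<lambda>x. 0) \<in> test_functions \<Omega>"
proof -
  have "C_diff m (\<lambda>x::real^'n. 0)" for m
  proof (induction m)
    case (Suc m)
    moreover have "partial k (\<lambda>x::real^'n. 0) = (\<lambda>x. 0)" for k
      using partial_eqI[OF has_derivative_const, of k] by (intro ext) simp
    ultimately show ?case by simp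
  qed simp
  then show ?thesis by (auto simp: test_functions_iff supp_def)
qed

section \<open>Smooth functions of one variable that are flat at the origin\<close>

primrec smooth_real :: "nat \<Rightarrow> (real \<Rightarrow> real) \<Rightarrow> bool"
  where
    "smooth_real 0 f \<longleftrightarrow> continuous_on UNIV f"
  | "smooth_real (Suc m) f \<longleftrightarrow> (\<forall>t. (f has_real_derivative deriv f t) (at t)) \<and> smooth_real m (deriv f)"

lemma smooth_real_SucI:
  assumes "\<And>t. (f has_real_derivative f' t) (at t)" "smooth_real m f'"
  shows "smooth_real (Suc m) f"
proof -
  have "deriv f = f'" using assms(1) DERIV_imp_deriv by blast
  then show ?thesis using assms by simp
qed

lemma smooth_real_SucD: "smooth_real (Suc m) f \<Longrightarrow> smooth_real m f"
proof (induction m arbitrary: f)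
  case 0
  then show ?case using DERIV_isCont by (auto simp: continuous_on_eq_continuous_at)
qed auto

lemma smooth_real_add: "smooth_real m f \<Longrightarrow> smooth_real m g \<Longrightarrow> smooth_real m (\<lambda>t. f t + g t)"
proof (induction m arbitrary: f g)
  case (Suc m)
  show ?case
    by (rule smooth_real_SucI[of _ "\<lambda>t. deriv f t + deriv g t"])
       (use Suc in \<open>auto intro!: DERIV_add\<close>)
qed (auto intro: continuous_on_add)

lemma smooth_real_mult: "smooth_real m f \<Longrightarrow> smooth_real m g \<Longrightarrow> smooth_real m (\<lambda>t. f t * g t)"
proof (induction m arbitrary: f g)
  case (Suc m)
  show ?case
  proof (rule smooth_real_SucI)
    show "((\<lambda>t. f t * g t) has_real_derivative deriv f t * g t + deriv g t * f t) (at t)" for t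
      using Suc.prems by (auto intro!: DERIV_mult)
    show "smooth_real m (\<lambda>t. deriv f t * g t + deriv g t * f t)"
      using Suc smooth_real_SucD[of m] by (intro smooth_real_add Suc.IH) auto
  qed
qed (auto intro: continuous_on_mult)

lemma smooth_real_const: "smooth_real m (\<lambda>t. c)"
proof (induction m arbitrary: c)
  case (Suc m)
  show ?case by (rule smooth_real_SucI[of _ "\<lambda>t. 0"]) (auto simp: Suc)
qed simp

lemma smooth_real_affine: "smooth_real m f \<Longrightarrow> smooth_real m (\<lambda>t. f (r * t + s))"
proof (induction m arbitrary: f)
  case 0
  then show ?case by (auto intro!: continuous_intros continuous_on_compose2[of UNIV f])
next
  case (Suc m)
  show ?case
  proof (rule smooth_real_SucI)
    show "((\<lambda>t. f (r * t + s)) has_real_derivative deriv f (r * t + s) * r) (at t)" for t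
      using Suc.prems by (auto intro!: DERIV_chain2[of f] derivative_eq_intros)
    show "smooth_real m (\<lambda>t. deriv f (r * t + s) * r)"
      using Suc by (intro smooth_real_mult smooth_real_const) auto
  qed
qed

text \<open>For p = 1 this is the classical exp (-1/t), continued by 0. The polynomial factor makes
  the family closed under differentiation, so smoothness of all members follows by one
  induction.\<close>

definition flat :: "real poly \<Rightarrow> real \<Rightarrow> real"
  where "flat p t = (if t \<le> 0 then 0 else poly p (1 / t) * exp (- (1 / t)))"

lemma tendsto_poly_exp_minus: "((\<lambda>s::real. poly p s * exp (- s)) \<longlongrightarrow> 0) at_top"
proof -
  have "((\<lambda>s::real. \<Sum>i\<le>degree p. coeff p i * (s ^ i / exp s)) \<longlongrightarrow> (\<Sum>i\<le>degree p. coeff p i * 0)) at_top"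
    by (intro tendsto_intros tendsto_power_div_exp_0)
  moreover have "(\<Sum>i\<le>degree p. coeff p i * (s ^ i / exp s)) = poly p s * exp (- s)" for s
    by (simp add: poly_altdef sum_divide_distrib exp_minus inverse_eq_divide)
  ultimately show ?thesis by simp
qed

lemma tendsto_flat_0: "(flat p \<longlongrightarrow> 0) (at 0)"
proof -
  have "((\<lambda>t. poly p (inverse t) * exp (- inverse t)) \<longlongrightarrow> 0) (at_right (0::real))"
    by (rule filterlim_compose[OF tendsto_poly_exp_minus filterlim_inverse_at_top_right])
  then have "(flat p \<longlongrightarrow> 0) (at_right 0)"
    by (rule Lim_transform_eventually)
       (auto simp: flat_def inverse_eq_divide eventually_at_right_field intro: exI[of _ 1])
  moreover have "(flat p \<longlongrightarrow> 0) (at_left 0)"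
    by (rule Lim_transform_eventually[OF tendsto_const])
       (auto simp: flat_def eventually_at_left_field intro: exI[of _ "-1"])
  ultimately show ?thesis by (simp add: filterlim_split_at)
qed

text \<open>With s = 1/t, hence ds/dt = -s^2, the derivative of p(s) exp (-s) is s^2 (p(s) - p'(s))
  exp (-s); the factor \<open>[:0, 0, 1:]\<close> is s^2.\<close>

lemma flat_has_derivative:
  "(flat p has_real_derivative flat ([:0, 0, 1:] * (p - pderiv p)) t) (at t)"
proof -
  consider "t < 0" | "t = 0" | "t > 0" by linarith
  then show ?thesis
  proof cases
    case 1
    have "((\<lambda>_. 0) has_real_derivative 0) (at t)" by simp
    then have "(flat p has_real_derivative 0) (at t)"
      by (rule has_field_derivative_transform_within_open[of _ _ _ "{..<0}"]) (use 1 in \<open>auto simp: flat_def\<close>)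
    then show ?thesis using 1 by (simp add: flat_def)
  next
    case 2
    \<comment> \<open>Dividing by h multiplies the polynomial in 1/h by its variable, which is
      \<open>pCons 0\<close>. The difference quotient at 0 is therefore again a member of the family
      and tends to 0.\<close>
    have "((\<lambda>h. (flat p (0 + h) - flat p 0) / h) \<longlongrightarrow> 0) (at 0)"
    proof (rule Lim_transform_eventually[OF tendsto_flat_0[of "pCons 0 p"]])
      show "\<forall>\<^sub>F h in at 0. flat (pCons 0 p) h = (flat p (0 + h) - flat p 0) / h"
        by (auto simp: flat_def eventually_at_filter)
    qed
    then show ?thesis using 2 by (simp add: DERIV_def flat_def)
  next
    case 3
    have inv: "((\<lambda>t. 1 / t) has_real_derivative - (1 / t * (1 / t))) (at t)"
      using DERIV_inverse[of t UNIV] 3 by (simp add: inverse_eq_divide power2_eq_square)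
    have "((\<lambda>t. poly p (1 / t) * exp (- (1 / t))) has_real_derivative
        poly (pderiv p) (1 / t) * - (1 / t * (1 / t)) * exp (- (1 / t))
        + exp (- (1 / t)) * - (- (1 / t * (1 / t))) * poly p (1 / t)) (at t)"
      by (intro DERIV_mult DERIV_chain2[OF poly_DERIV inv] DERIV_chain2[OF DERIV_exp DERIV_minus[OF inv]])
    moreover have "poly (pderiv p) (1 / t) * - (1 / t * (1 / t)) * exp (- (1 / t))
        + exp (- (1 / t)) * - (- (1 / t * (1 / t))) * poly p (1 / t) = flat ([:0, 0, 1:] * (p - pderiv p)) t"
      using 3 by (simp add: flat_def algebra_simps)
    ultimately have "((\<lambda>t. poly p (1 / t) * exp (- (1 / t))) has_real_derivative
        flat ([:0, 0, 1:] * (p - pderiv p)) t) (at t)"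
      by simp
    then show ?thesis
      by (rule has_field_derivative_transform_within_open[of _ _ _ "{0<..}"]) (use 3 in \<open>auto simp: flat_def\<close>)
  qed
qed

lemma smooth_real_flat: "smooth_real m (flat p)"
proof (induction m arbitrary: p)
  case 0
  show ?case using DERIV_isCont[OF flat_has_derivative] by (simp add: continuous_on_eq_continuous_at)
next
  case (Suc m)
  show ?case by (rule smooth_real_SucI[OF flat_has_derivative Suc])
qed

section \<open>Smooth test functions approximating indicators of boxes\<close>

lemma C_diff_prod:
  fixes f :: "'n::finite \<Rightarrow> real \<Rightarrow> real"
  assumes "\<And>k m. smooth_real m (f k)"
  shows "C_diff m (\<lambda>x::real^'n. of_real (\<Prod>k\<in>UNIV. f k (x $ k)))"
  using assms
proof (induction m arbitrary: f)
  case 0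
  have f: "continuous_on UNIV (f k)" for k using 0[of 0 k] by simp
  have "continuous_on UNIV (\<lambda>x::real^'n. f k (x $ k))" for k
    by (rule continuous_on_compose2[OF f]) (auto intro: continuous_intros)
  then show ?case unfolding C_diff.simps by (intro continuous_on_of_real continuous_on_prod)
next
  case (Suc m)
  have f: "(f k has_real_derivative deriv (f k) t) (at t)" "smooth_real m (deriv (f k))" for k t m
    using Suc.prems[of "Suc m" k] by auto
  have D: "((\<lambda>x::real^'n. complex_of_real (\<Prod>k\<in>UNIV. f k (x $ k))) has_derivative
     (\<lambda>y. complex_of_real (\<Sum>k\<in>UNIV. (y $ k) * deriv (f k) (x $ k) * (\<Prod>j\<in>UNIV - {k}. f j (x $ j))))) (at x)" for x
    by (intro has_derivative_of_real has_derivative_prod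
        DERIV_compose_FDERIV[OF f(1)] bounded_linear_imp_has_derivative[OF bounded_linear_vec_nth])
  \<comment> \<open>A partial derivative of a product of one-variable functions is a product of the
    same shape with one factor differentiated, so the induction runs over arbitrary families
    f.\<close>
  have part: "partial j (\<lambda>x::real^'n. complex_of_real (\<Prod>k\<in>UNIV. f k (x $ k))) =
     (\<lambda>x. complex_of_real (\<Prod>k\<in>UNIV. (f(j := deriv (f j))) k (x $ k)))" for j
  proof
    fix x :: "real^'n"
    have "partial j (\<lambda>x::real^'n. complex_of_real (\<Prod>k\<in>UNIV. f k (x $ k))) x =
      complex_of_real (\<Sum>k\<in>UNIV. (axis j 1 $ k) * deriv (f k) (x $ k) * (\<Prod>j\<in>UNIV - {k}. f j (x $ j)))"
      by (rule partial_eqI[OF D])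
    also have "(\<Sum>k\<in>UNIV. (axis j 1 $ k) * deriv (f k) (x $ k) * (\<Prod>j\<in>UNIV - {k}. f j (x $ j)))
      = (\<Sum>k\<in>UNIV. if k = j then deriv (f j) (x $ j) * (\<Prod>k\<in>UNIV - {j}. f k (x $ k)) else 0)"
      by (intro sum.cong) (auto simp: axis_def)
    also have "\<dots> = (\<Prod>k\<in>UNIV. (f(j := deriv (f j))) k (x $ k))"
      by (simp add: prod.remove[of UNIV j])
    finally show "partial j (\<lambda>x::real^'n. complex_of_real (\<Prod>k\<in>UNIV. f k (x $ k))) x =
      complex_of_real (\<Prod>k\<in>UNIV. (f(j := deriv (f j))) k (x $ k))" .
  qed
  have "C_diff m (\<lambda>x. complex_of_real (\<Prod>k\<in>UNIV. (f(j := deriv (f j))) k (x $ k)))" for j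
    by (rule Suc.IH) (use Suc.prems f in auto)
  then show ?case using D part by (auto simp: differentiable_def simp del: of_real_prod)
qed

text \<open>Inside the box both arguments of \<open>flat 1\<close> are positive and grow with n, so
  every factor exp (-1/s) tends to 1; outside some factor vanishes. The limit is the indicator of
  the open box, with values in [0, 1] throughout.\<close>

definition bump :: "real^'n \<Rightarrow> real^'n \<Rightarrow> nat \<Rightarrow> real^'n \<Rightarrow> real"
  where "bump a b n x =
    (\<Prod>k\<in>UNIV. flat 1 (real (Suc n) * (x $ k - a $ k)) * flat 1 (real (Suc n) * (b $ k - x $ k)))"

lemma flat_1_bounds: "0 \<le> flat 1 t" "flat 1 t \<le> 1"
  by (auto simp: flat_def)

lemma flat_1_eq_0: "t \<le> 0 \<Longrightarrow> flat 1 t = 0"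
  by (simp add: flat_def)

lemma bump_bounds: "0 \<le> bump a b n x" "bump a b n x \<le> 1"
  unfolding bump_def
  by (auto intro!: prod_nonneg prod_le_1 mult_nonneg_nonneg mult_le_one flat_1_bounds)

lemma bump_outside:
  assumes "x \<notin> box a b" shows "bump a b n x = 0"
proof -
  obtain k where "x $ k \<le> a $ k \<or> b $ k \<le> x $ k" using assms by (auto simp: mem_box_cart not_less)
  then have "flat 1 (real (Suc n) * (x $ k - a $ k)) * flat 1 (real (Suc n) * (b $ k - x $ k)) = 0"
    by (auto intro!: flat_1_eq_0 simp: mult_le_0_iff)
  then show ?thesis unfolding bump_def by (intro prod_zero) auto
qed

lemma bump_tendsto: "(\<lambda>n. bump a b n x) \<longlonglongrightarrow> indicator (box a b) x"
proof (cases "x \<in> box a b")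
  case False
  then show ?thesis by (simp add: bump_outside)
next
  case True
  have 1: "(\<lambda>n. flat 1 (real (Suc n) * t)) \<longlonglongrightarrow> 1" if "t > 0" for t
  proof -
    have "(\<lambda>n. exp (- (1 / real (Suc n) * (1 / t)))) \<longlonglongrightarrow> exp (- (0 * (1 / t)))"
      by (intro tendsto_intros LIMSEQ_inverse_real_of_nat[unfolded inverse_eq_divide])
    moreover have "flat 1 (real (Suc n) * t) = exp (- (1 / real (Suc n) * (1 / t)))" for n
      using that by (simp add: flat_def not_le mult_le_0_iff)
    ultimately show ?thesis by simp
  qed
  have "(\<lambda>n. bump a b n x) \<longlonglongrightarrow> (\<Prod>k\<in>(UNIV::'a set). 1 * 1)"
    unfolding bump_def using True by (intro tendsto_intros 1) (auto simp: mem_box_cart)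
  then show ?thesis using True by simp
qed

lemma test_bump:
  assumes "cbox a b \<subseteq> \<Omega>"
  shows "(\<lambda>x. of_real (bump a b n x)) \<in> test_functions \<Omega>"
proof -
  have "supp (\<lambda>x. complex_of_real (bump a b n x)) \<subseteq> cbox a b"
  proof (rule supp_subset[OF closed_cbox])
    fix x assume "x \<notin> cbox a b"
    then have "x \<notin> box a b" using box_subset_cbox by blast
    then show "complex_of_real (bump a b n x) = 0" by (simp add: bump_outside)
  qed
  moreover have "smooth_real m (\<lambda>t. flat 1 (real (Suc n) * (t - a $ k)) * flat 1 (real (Suc n) * (b $ k - t)))" for m k
    using smooth_real_affine[OF smooth_real_flat, of m 1 "real (Suc n)" "- real (Suc n) * a $ k"]
      smooth_real_affine[OF smooth_real_flat, of m 1 "- real (Suc n)" "real (Suc n) * b $ k"]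
    by (intro smooth_real_mult) (simp_all add: algebra_simps)
  then have "C_diff m (\<lambda>x. complex_of_real (bump a b n x))" for m
    unfolding bump_def by (rule C_diff_prod)
  ultimately show ?thesis
    using assms compact_supp_subset[OF compact_cbox] by (auto simp: test_functions_iff)
qed

section \<open>Integration by parts and the fundamental lemma\<close>

lemma integrable_compact_supp:
  fixes f :: "'a::euclidean_space \<Rightarrow> 'b::{banach, second_countable_topology}"
  assumes "continuous_on UNIV f" "compact (supp f)"
  shows "integrable lborel f"
proof -
  have "integrable lborel (\<lambda>x. indicator (supp f) x *\<^sub>R f x)"
    using assms by (intro borel_integrable_compact) (auto intro: continuous_on_subset)
  moreover have "indicator (supp f) x *\<^sub>R f x = f x" for x
    by (simp add: indicator_def not_in_supp)
  ultimately show ?thesis by simp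
qed

lemma borel_measurable_continuous [intro]:
  "continuous_on UNIV f \<Longrightarrow> f \<in> borel_measurable borel"
  by (rule borel_measurable_continuous_onI)

lemma nn_integral_translate:
  fixes c :: "'a::euclidean_space"
  assumes "f \<in> borel_measurable borel"
  shows "(\<integral>\<^sup>+x. f (c + x) \<partial>lborel) = (\<integral>\<^sup>+x. f x \<partial>lborel)"
  using nn_integral_distr[of "(+) c" lborel borel f] assms by (simp add: lborel_distr_plus)

lemma integral_translate:
  fixes c :: "'a::euclidean_space" and f :: "'a \<Rightarrow> 'b::{banach, second_countable_topology}"
  assumes "f \<in> borel_measurable borel"
  shows "(LINT x|lborel. f (c + x)) = (LINT x|lborel. f x)"
  using integral_distr[of "(+) c" lborel borel f] assms by (simp add: lborel_distr_plus)

lemma integral_lebesgue_on_zero_outside: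
  fixes f :: "'a::euclidean_space \<Rightarrow> 'b::euclidean_space"
  assumes "\<Omega> \<in> sets lebesgue" "\<And>x. x \<notin> \<Omega> \<Longrightarrow> f x = 0"
  shows "(LINT x|lebesgue_on \<Omega>. f x) = (LINT x|lebesgue. f x)"
proof -
  have "(\<lambda>x. if x \<in> \<Omega> then f x else 0) = f" using assms(2) by auto
  then show ?thesis using Lebesgue_Measure.integral_restrict_UNIV[OF assms(1), of f] by simp
qed

lemma has_vector_derivative_along:
  fixes u :: "real^'n \<Rightarrow> complex"
  assumes "\<And>x. u differentiable (at x)"
  shows "((\<lambda>s. u (y + s *\<^sub>R t)) has_vector_derivative
    (\<Sum>k\<in>UNIV. of_real (t $ k) * partial k u (y + s *\<^sub>R t))) (at s within A)"
proof -
  have "((\<lambda>s. y + s *\<^sub>R t) has_derivative (\<lambda>r. r *\<^sub>R t)) (at s within A)"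
    by (auto intro!: derivative_eq_intros)
  from has_derivative_compose[OF this has_derivative_partial[OF assms]]
  show ?thesis
    unfolding has_vector_derivative_def
    by (rule has_derivative_eq_rhs) (simp add: fun_eq_iff scaleR_sum_right sum_distrib_left scaleR_conv_of_real[where 'a=complex] mult.assoc)
qed

text \<open>Difference quotients have integral 0 by translation invariance of Lebesgue measure, and
  they converge dominatedly to the partial derivative. No iterated integration is involved.\<close>

lemma integral_partial_eq_0:
  fixes w :: "real^'n \<Rightarrow> complex"
  assumes w: "\<And>x. w differentiable (at x)" "continuous_on UNIV (partial k w)" "compact (supp w)"
  shows "(LINT x|lborel. partial k w x) = 0"
proof -
  define e where "e = (axis k 1 :: real^'n)"
  have cw: "continuous_on UNIV w"
    using w(1) by (auto simp: continuous_on_eq_continuous_at differentiable_imp_continuous_within)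
  have cp: "compact (supp (partial k w))" by (rule compact_supp_subset[OF w(3) supp_partial])
  have wk: "(\<Sum>j\<in>UNIV. of_real (e $ j) * partial j w x) = partial k w x" for x
  proof -
    have "(\<Sum>j\<in>UNIV. of_real (e $ j) * partial j w x) = (\<Sum>j\<in>UNIV. if j = k then partial k w x else 0)"
      by (intro sum.cong) (auto simp: e_def axis_def)
    then show ?thesis by simp
  qed
  have vd: "((\<lambda>s. w (y + s *\<^sub>R e)) has_vector_derivative partial k w (y + s *\<^sub>R e)) (at s within A)" for y s A
    using has_vector_derivative_along[of w y e s A] w(1) by (simp add: wk)
  have "bounded (partial k w ` supp (partial k w))"
    by (intro compact_imp_bounded compact_continuous_image continuous_on_subset[OF w(2)] cp) auto
  then obtain B where B0: "\<And>x. x \<in> supp (partial k w) \<Longrightarrow> norm (partial k w x) \<le> B" and Bpos: "B > 0"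
    unfolding bounded_pos by auto
  have B: "norm (partial k w x) \<le> B" for x
    using B0[of x] Bpos by (cases "x \<in> supp (partial k w)") (auto simp: not_in_supp)
  \<comment> \<open>The support enlarged by 1: since the step h n is at most 1 and e is a unit
    vector, all difference quotients vanish outside this compact set. On it the mean value
    inequality bounds them by B, which gives the dominating function.\<close>
  define K where "K = {x + y |x y. x \<in> supp w \<and> y \<in> cball (0::real^'n) 1}"
  have K: "compact K" unfolding K_def by (intro compact_sums w compact_cball)
  define h where "h = (\<lambda>n. 1 / real (Suc n))"
  have h: "0 < h n" "h n \<le> 1" for n by (simp_all add: h_def)
  define q where "q = (\<lambda>n x. (w (x + h n *\<^sub>R e) - w x) /\<^sub>R h n)"
  have ne: "norm e = 1" by (simp add: e_def)
  have q_bound: "norm (q n x) \<le> B * indicator K x" for n x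
  proof (cases "x \<in> K")
    case True
    have "norm (w (x + h n *\<^sub>R e) - w (x + 0 *\<^sub>R e)) \<le> norm (h n - 0) * B"
    proof -
      have "norm (w (x + h n *\<^sub>R e) - w (x + 0 *\<^sub>R e)) \<le> B * norm (h n - 0)"
      proof (rule differentiable_bound[where f = "\<lambda>s. w (x + s *\<^sub>R e)" and S = UNIV])
        fix s :: real
        show "((\<lambda>s. w (x + s *\<^sub>R e)) has_derivative (\<lambda>r. r *\<^sub>R partial k w (x + s *\<^sub>R e))) (at s within UNIV)"
          using vd[of x s UNIV] by (simp add: has_vector_derivative_def)
        show "onorm (\<lambda>r. r *\<^sub>R partial k w (x + s *\<^sub>R e)) \<le> B"
          using B by (intro onorm_le) (auto simp: mult.commute[of B] intro!: mult_left_mono)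
      qed auto
      then show ?thesis by (simp add: mult.commute)
    qed
    moreover have "norm (q n x) = norm (w (x + h n *\<^sub>R e) - w (x + 0 *\<^sub>R e)) / h n"
      using h[of n] by (simp add: q_def divide_inverse_commute)
    ultimately show ?thesis using True h[of n] by (simp add: divide_le_eq mult.commute)
  next
    case False
    have "x \<notin> supp w" using False unfolding K_def by (auto intro!: exI[of _ x] exI[of _ 0])
    moreover have "x + h n *\<^sub>R e \<notin> supp w"
    proof
      assume "x + h n *\<^sub>R e \<in> supp w"
      then have "(x + h n *\<^sub>R e) + (- h n *\<^sub>R e) \<in> K"
        unfolding K_def using h[of n] ne 
          by (intro CollectI exI[of _ "x + h n *\<^sub>R e"] exI[of _ "- h n *\<^sub>R e"]) (simp add: \<open>x + h n *\<^sub>R e \<in> supp w\<close>)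
      then show False using False by simp
    qed
    ultimately show ?thesis using False by (simp add: q_def not_in_supp)
  qed
  have q_lim: "(\<lambda>n. q n x) \<longlonglongrightarrow> partial k w x" for x
  proof -
    define p where "p = partial k w x"
    have "((\<lambda>s. (w (x + s *\<^sub>R e) - w x - s *\<^sub>R p) /\<^sub>R norm s) \<longlongrightarrow> 0) (at 0)"
      using vd[of x 0 UNIV] unfolding has_vector_derivative_def has_derivative_at_within p_def by simp
    then have "((\<lambda>s. norm ((w (x + s *\<^sub>R e) - w x - s *\<^sub>R p) /\<^sub>R norm s)) \<longlongrightarrow> 0) (at 0)"
      by (rule tendsto_norm_zero)
    moreover have "norm ((w (x + s *\<^sub>R e) - w x - s *\<^sub>R p) /\<^sub>R norm s)
        = norm ((w (x + s *\<^sub>R e) - w x) /\<^sub>R s - p)" if "s \<noteq> 0" for s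
    proof -
      have "(w (x + s *\<^sub>R e) - w x - s *\<^sub>R p) /\<^sub>R s = (w (x + s *\<^sub>R e) - w x) /\<^sub>R s - p"
        using that by (simp add: scaleR_diff_right)
      moreover have "norm (z /\<^sub>R norm s) = norm (z /\<^sub>R s)" for z :: complex by simp
      ultimately show ?thesis by presburger
    qed
    then have "\<forall>\<^sub>F s in at 0. norm ((w (x + s *\<^sub>R e) - w x - s *\<^sub>R p) /\<^sub>R norm s)
        = norm ((w (x + s *\<^sub>R e) - w x) /\<^sub>R s - p)"
      by (auto simp: eventually_at_filter)
    ultimately have "((\<lambda>s. norm ((w (x + s *\<^sub>R e) - w x) /\<^sub>R s - p)) \<longlongrightarrow> 0) (at 0)"
      by (rule Lim_transform_eventually)
    then have "((\<lambda>s. (w (x + s *\<^sub>R e) - w x) /\<^sub>R s) \<longlongrightarrow> p) (at 0)"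
      by (rule LIM_zero_cancel[OF tendsto_norm_zero_cancel])
    moreover have "filterlim h (at 0) sequentially"
      unfolding filterlim_at h_def
      using LIMSEQ_inverse_real_of_nat by (auto simp: inverse_eq_divide)
    ultimately show ?thesis unfolding q_def p_def by (rule filterlim_compose)
  qed
  have [measurable]: "w \<in> borel_measurable borel" "partial k w \<in> borel_measurable borel"
    using cw w(2) by auto
  have "(\<lambda>n. LINT x|lborel. q n x) \<longlonglongrightarrow> (LINT x|lborel. partial k w x)"
  proof (rule integral_dominated_convergence)
    show "integrable lborel (\<lambda>x. B * indicator K x)"
      using compact_imp_closed[OF K] emeasure_compact_finite[OF K] by simp
    show "AE x in lborel. (\<lambda>n. q n x) \<longlonglongrightarrow> partial k w x" using q_lim by simp
    show "AE x in lborel. norm (q n x) \<le> B * indicator K x" for n using q_bound by simp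
  qed (simp_all add: q_def)
  moreover have "(LINT x|lborel. q n x) = 0" for n
  proof -
    have int: "integrable lborel w" by (rule integrable_compact_supp[OF cw w(3)])
    have "integrable lborel (\<lambda>x. w (h n *\<^sub>R e + x))"
      using integrable_distr_eq[of "(+) (h n *\<^sub>R e)" lborel borel w] int by (simp add: lborel_distr_plus)
    then have "(LINT x|lborel. w (x + h n *\<^sub>R e) - w x) = (LINT x|lborel. w (h n *\<^sub>R e + x)) - (LINT x|lborel. w x)"
      using int by (subst Bochner_Integration.integral_diff[symmetric]) (auto simp: add.commute)
    also have "\<dots> = 0" by (simp add: integral_translate)
    finally show ?thesis by (simp add: q_def)
  qed
  ultimately show ?thesis by (simp add: LIMSEQ_const_iff)
qed

lemma integration_by_parts_test:
  assumes u: "u \<in> test_functions \<Omega>" and v: "v \<in> test_functions \<Omega>" and \<Omega>: "\<Omega> \<in> sets lebesgue"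
  shows "(LINT x|lebesgue_on \<Omega>. u x * partial k v x) = - (LINT x|lebesgue_on \<Omega>. partial k u x * v x)"
proof -
  note uv = test_differentiable[OF u] test_differentiable[OF v]
  have c: "continuous_on UNIV u" "continuous_on UNIV v" "continuous_on UNIV (partial k u)" "continuous_on UNIV (partial k v)"
    using u v by (auto intro: test_continuous test_partial)
  have part: "partial k (\<lambda>x. u x * v x) x = u x * partial k v x + partial k u x * v x" for x
    by (rule partial_mult[OF uv])
  have cs: "compact (supp v)" using v by (simp add: test_functions_iff)
  have int: "integrable lborel (\<lambda>x. u x * partial k v x)" "integrable lborel (\<lambda>x. partial k u x * v x)"
  proof -
    have "x \<notin> supp v \<Longrightarrow> partial k v x = 0" for x
      using supp_partial[of k v] not_in_supp by blast
    then have "supp (\<lambda>x. u x * partial k v x) \<subseteq> supp v" "supp (\<lambda>x. partial k u x * v x) \<subseteq> supp v"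
      by (auto intro!: supp_subset[OF closed_supp] simp: not_in_supp)
    then show "integrable lborel (\<lambda>x. u x * partial k v x)" "integrable lborel (\<lambda>x. partial k u x * v x)"
      using c by (auto intro!: integrable_compact_supp continuous_intros compact_supp_subset[OF cs])
  qed
  have "(LINT x|lborel. partial k (\<lambda>x. u x * v x) x) = 0"
  proof (rule integral_partial_eq_0)
    show "(\<lambda>x. u x * v x) differentiable at x" for x using uv by (rule differentiable_mult)
    show "continuous_on UNIV (partial k (\<lambda>x. u x * v x))"
      using c by (auto simp: part intro!: continuous_intros)
    show "compact (supp (\<lambda>x. u x * v x))"
      by (rule compact_supp_subset[OF cs]) (auto intro!: supp_subset[OF closed_supp] simp: not_in_supp)
  qed
  then have "(LINT x|lborel. u x * partial k v x) = - (LINT x|lborel. partial k u x * v x)"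
    using int by (simp add: part add_eq_0_iff2)
  moreover have "(LINT x|lebesgue_on \<Omega>. u x * partial k v x) = (LINT x|lborel. u x * partial k v x)"
    using c \<Omega> test_zero_outside[OF u]
    by (subst integral_lebesgue_on_zero_outside) (auto intro!: integral_completion borel_measurable_times)
  moreover have "(LINT x|lebesgue_on \<Omega>. partial k u x * v x) = (LINT x|lborel. partial k u x * v x)"
    using c \<Omega> test_zero_outside[OF v]
    by (subst integral_lebesgue_on_zero_outside) (auto intro!: integral_completion borel_measurable_times)
  ultimately show ?thesis by simp
qed

text \<open>Tests with the functions \<open>bump\<close>, which converge to the indicator of the
  open box and are bounded by 1, so that |g| on the closed box dominates. The open and the closed
  box differ by a null set.\<close>

lemma fundamental_lemma_box:
  fixes g :: "real^'n \<Rightarrow> complex"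
  assumes g: "locally_integrable \<Omega> g" and \<Omega>: "\<Omega> \<in> sets lebesgue" and ab: "cbox a b \<subseteq> \<Omega>"
    and zero: "\<And>v. v \<in> test_functions \<Omega> \<Longrightarrow> (LINT x|lebesgue_on \<Omega>. g x * v x) = 0"
  shows "integral (cbox a b) g = 0"
proof -
  have "g absolutely_integrable_on cbox a b" using g ab by (auto simp: locally_integrable_def)
  then have int: "integrable lebesgue (\<lambda>x. indicator (cbox a b) x *\<^sub>R g x)"
    by (simp add: set_integrable_def)
  define F where "F = (\<lambda>x. indicator (cbox a b) x *\<^sub>R g x)"
  have [measurable]: "F \<in> borel_measurable lebesgue" using int by (auto simp: F_def)
  have bm: "(\<lambda>x. complex_of_real (bump a b n x)) \<in> borel_measurable lebesgue" for n
    using test_continuous[OF test_bump[OF ab]] by (intro measurable_completion) auto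
  have ind: "(\<lambda>x. complex_of_real (indicator (box a b) x)) \<in> borel_measurable lebesgue"
    by (intro measurable_completion) simp
  have gF: "g x * of_real (bump a b n x) = F x * of_real (bump a b n x)" for x n
    using bump_outside[of x a b n] box_subset_cbox[of a b] by (auto simp: F_def indicator_def)
  have "(\<lambda>n. LINT x|lebesgue. F x * of_real (bump a b n x)) \<longlonglongrightarrow> (LINT x|lebesgue. F x * of_real (indicator (box a b) x))"
  proof (rule integral_dominated_convergence)
    show "integrable lebesgue (\<lambda>x. norm (F x))" unfolding F_def by (rule integrable_norm[OF int])
    show "AE x in lebesgue. (\<lambda>n. F x * of_real (bump a b n x)) \<longlonglongrightarrow> F x * of_real (indicator (box a b) x)"
      by (intro AE_I2 tendsto_intros bump_tendsto)
    show "AE x in lebesgue. norm (F x * of_real (bump a b n x)) \<le> norm (F x)" for n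
      using bump_bounds[of a b n] by (auto simp: norm_mult mult_left_le)
  qed (use bm ind in \<open>auto intro!: borel_measurable_times\<close>)
  moreover have "(LINT x|lebesgue. F x * of_real (bump a b n x)) = 0" for n
  proof -
    have "(LINT x|lebesgue_on \<Omega>. g x * of_real (bump a b n x)) = 0" by (rule zero[OF test_bump[OF ab]])
    then show ?thesis
      using test_zero_outside[OF test_bump[OF ab]]
      by (subst (asm) integral_lebesgue_on_zero_outside[OF \<Omega>]) (auto simp: gF)
  qed
  ultimately have "(LINT x|lebesgue. F x * of_real (indicator (box a b) x)) = 0"
    by (simp add: LIMSEQ_const_iff)
  moreover have "(LINT x|lebesgue. F x * of_real (indicator (box a b) x)) = (LINT x|lebesgue. F x)"
  proof (rule integral_cong_AE)
    have "negligible (cbox a b - box a b)" by (rule negligible_frontier_interval)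
    then have "AE x in lebesgue. x \<notin> cbox a b - box a b"
      unfolding negligible_iff_null_sets by (rule AE_not_in)
    then show "AE x in lebesgue. F x * of_real (indicator (box a b) x) = F x"
      by eventually_elim (auto simp: F_def indicator_def)
  qed (use ind in \<open>auto intro!: borel_measurable_times\<close>)
  ultimately have "(LINT x|lebesgue. F x) = 0" by simp
  moreover have "integral (cbox a b) g = (LINT x|lebesgue. F x)"
    using set_lebesgue_integral_eq_integral(2)[OF \<open>g absolutely_integrable_on cbox a b\<close>]
    by (simp add: F_def set_lebesgue_integral_def)
  ultimately show ?thesis by simp
qed

text \<open>All averages of g over small cubes inside the domain vanish, and by Lebesgue
  differentiation they converge to g almost everywhere. A countable cover by closed boxes reduces
  the domain to one box at a time.\<close>

lemma fundamental_lemma: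
  fixes g :: "real^'n \<Rightarrow> complex"
  assumes g: "locally_integrable \<Omega> g" and \<Omega>: "open \<Omega>"
    and zero: "\<And>v. v \<in> test_functions \<Omega> \<Longrightarrow> (LINT x|lebesgue_on \<Omega>. g x * v x) = 0"
  shows "AE x in lebesgue_on \<Omega>. g x = 0"
proof -
  have m\<Omega>: "\<Omega> \<in> sets lebesgue" using \<Omega> by (simp add: borel_open)
  have box: "negligible {x \<in> cbox c d. g x \<noteq> 0}" if cd: "cbox c d \<subseteq> \<Omega>" for c d
  proof -
    \<comment> \<open>Cutting off at the box gives a function integrable over every box, as the
      differentiation theorem requires of a function on the whole space.\<close>
    define f where "f = (\<lambda>x. if x \<in> cbox c d then g x else 0)"
    have "g absolutely_integrable_on cbox c d" using g cd by (auto simp: locally_integrable_def)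
    then have gi: "g integrable_on cbox c d" by (simp add: set_lebesgue_integral_eq_integral(1))
    have "f integrable_on cbox a b" for a b
    proof -
      obtain p q where pq: "cbox c d \<inter> cbox a b = cbox p q" using Int_interval by blast
      then have "g integrable_on (cbox c d \<inter> cbox a b)"
        using integrable_on_subcbox[OF gi, of p q] by (metis Int_lower1)
      then show ?thesis unfolding f_def by (simp add: integrable_restrict_Int Int_commute)
    qed
    then obtain N where N: "negligible N"
      "\<And>x e. \<lbrakk>x \<notin> N; 0 < e\<rbrakk> \<Longrightarrow> \<exists>r>0. \<forall>h. 0 < h \<and> h < r \<longrightarrow>
          norm (integral (cbox x (x + h *\<^sub>R One)) f /\<^sub>R h ^ DIM(real^'n) - f x) < e"
      using integrable_ccontinuous_explicit[of f] by metis
    \<comment> \<open>For small h the cube with lower corner x stays inside the box, where f equals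
      g and has integral 0. Approximation with tolerance |f x| is then contradictory.\<close>
    have "f x = 0" if x: "x \<in> box c d" "x \<notin> N" for x
    proof (rule ccontr)
      assume "f x \<noteq> 0"
      then obtain r where r: "r > 0" "\<forall>h. 0 < h \<and> h < r \<longrightarrow>
          norm (integral (cbox x (x + h *\<^sub>R One)) f /\<^sub>R h ^ DIM(real^'n) - f x) < norm (f x)"
        using N(2)[OF x(2), of "norm (f x)"] by auto
      have "\<forall>\<^sub>F h in at_right (0::real). x + h *\<^sub>R One \<in> box c d"
      proof (rule topological_tendstoD)
        have "((\<lambda>h. x + h *\<^sub>R One) \<longlongrightarrow> x + 0 *\<^sub>R One) (at_right (0::real))"
          by (intro tendsto_intros)
        then show "((\<lambda>h. x + h *\<^sub>R One) \<longlongrightarrow> x) (at_right (0::real))" by simp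
      qed (use x in auto)
      moreover have "\<forall>\<^sub>F h in at_right (0::real). 0 < h \<and> h < r"
        using r(1) by (auto simp: eventually_at_right_field)
      ultimately have "\<forall>\<^sub>F h in at_right (0::real). x + h *\<^sub>R One \<in> box c d \<and> 0 < h \<and> h < r"
        by eventually_elim simp
      then obtain h where h: "x + h *\<^sub>R One \<in> box c d" "0 < h" "h < r"
        using eventually_happens'[OF trivial_limit_at_right_real] by blast
      have sub: "cbox x (x + h *\<^sub>R One) \<subseteq> cbox c d"
        using h(1) x(1) by (intro subset_box_imp) (auto simp: subset_box mem_box less_imp_le)
      have "integral (cbox x (x + h *\<^sub>R One)) f = integral (cbox x (x + h *\<^sub>R One)) g"
        using sub by (intro Henstock_Kurzweil_Integration.integral_cong) (auto simp: f_def)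
      also have "\<dots> = 0"
        using sub cd by (intro fundamental_lemma_box[OF g m\<Omega> _ zero]) auto
      finally show False using r(2) h by auto
    qed
    then have "{x \<in> cbox c d. g x \<noteq> 0} \<subseteq> N \<union> (cbox c d - box c d)"
      by (fastforce simp: f_def)
    then show ?thesis
      using N(1) negligible_frontier_interval negligible_Un negligible_subset by blast
  qed
  obtain \<D> where \<D>: "countable \<D>" "\<D> \<subseteq> Pow \<Omega>" "\<And>X. X \<in> \<D> \<Longrightarrow> \<exists>a b. X = cbox a b" "\<Union>\<D> = \<Omega>"
    using open_countable_Union_open_cbox[OF \<Omega>] by metis
  have "negligible (\<Union>X\<in>\<D>. {x \<in> X. g x \<noteq> 0})"
  proof (rule negligible_countable_Union)
    show "countable ((\<lambda>X. {x \<in> X. g x \<noteq> 0}) ` \<D>)" using \<D>(1) by simp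
    fix T assume "T \<in> (\<lambda>X. {x \<in> X. g x \<noteq> 0}) ` \<D>"
    then obtain X where X: "X \<in> \<D>" "T = {x \<in> X. g x \<noteq> 0}" by blast
    then show "negligible T" using \<D>(2) \<D>(3)[OF X(1)] box by blast
  qed
  moreover have "(\<Union>X\<in>\<D>. {x \<in> X. g x \<noteq> 0}) = {x \<in> \<Omega>. g x \<noteq> 0}" using \<D>(4) by auto
  ultimately have "{x \<in> \<Omega>. g x \<noteq> 0} \<in> null_sets lebesgue"
    by (simp add: negligible_iff_null_sets)
  then have "AE x in lebesgue. x \<notin> {x \<in> \<Omega>. g x \<noteq> 0}" by (rule AE_not_in)
  then show ?thesis using m\<Omega> by (auto simp: AE_restrict_space_iff elim: eventually_mono)
qed

section \<open>A Poincare inequality on grid cells\<close>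

text \<open>Jensen's inequality for the square under a probability measure, read off from the
  nonnegative variance.\<close>

lemma norm_integral_sq_le:
  fixes f :: "'a \<Rightarrow> 'b::euclidean_space"
  assumes M: "finite_measure M" "measure M (space M) = 1"
    and f: "f \<in> borel_measurable M" "integrable M (\<lambda>x. (norm (f x))\<^sup>2)"
  shows "(norm (LINT x|M. f x))\<^sup>2 \<le> (LINT x|M. (norm (f x))\<^sup>2)"
proof -
  interpret finite_measure M by fact
  have fi: "integrable M f"
  proof (rule Bochner_Integration.integrable_bound)
    show "integrable M (\<lambda>x. 1 + (norm (f x))\<^sup>2)" using f(2) by simp
    have "norm (f x) \<le> 1 + (norm (f x))\<^sup>2" for x
      using sum_squares_bound[of "norm (f x)" 1] zero_le_power2[of "norm (f x)"] norm_ge_zero[of "f x"]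
      by (simp only: power_one mult_1_right)
    then show "AE x in M. norm (f x) \<le> norm (1 + (norm (f x))\<^sup>2)" by simp
  qed fact
  define m where "m = (LINT x|M. f x)"
  have "0 \<le> (LINT x|M. (norm (f x - m))\<^sup>2)" by simp
  also have "\<dots> = (LINT x|M. (norm (f x))\<^sup>2 - 2 * inner (f x) m + (norm m)\<^sup>2)"
    by (intro Bochner_Integration.integral_cong)
       (simp_all add: power2_norm_eq_inner inner_diff_left inner_diff_right inner_commute)
  also have "\<dots> = (LINT x|M. (norm (f x))\<^sup>2) - 2 * inner m m + (norm m)\<^sup>2"
    using f fi M(2) by (simp add: m_def)
  finally show ?thesis by (simp add: m_def power2_norm_eq_inner)
qed

text \<open>Expanding the square expresses the oscillation of f through its L2 norm and its mean.
  The second claim is recorded because \<open>ennreal\<close> sends negative numbers to 0, so the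
  first equation alone would not determine the real number.\<close>

lemma double_integral_diff_sq:
  fixes f :: "'a \<Rightarrow> 'b::euclidean_space"
  assumes M: "finite_measure M" and f: "integrable M f" "integrable M (\<lambda>x. (norm (f x))\<^sup>2)"
  shows "(\<integral>\<^sup>+y. (\<integral>\<^sup>+x. ennreal ((norm (f x - f y))\<^sup>2) \<partial>M) \<partial>M)
    = ennreal (2 * measure M (space M) * (LINT x|M. (norm (f x))\<^sup>2) - 2 * (norm (LINT x|M. f x))\<^sup>2)"
    and "0 \<le> 2 * measure M (space M) * (LINT x|M. (norm (f x))\<^sup>2) - 2 * (norm (LINT x|M. f x))\<^sup>2"
proof -
  interpret finite_measure M by fact
  define m where "m = (LINT x|M. f x)"
  define s where "s = (LINT x|M. (norm (f x))\<^sup>2)"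
  define c where "c = measure M (space M)"
  have eq: "(norm (x - y))\<^sup>2 = (norm x)\<^sup>2 - 2 * inner x y + (norm y)\<^sup>2" for x y :: 'b
    by (simp add: power2_norm_eq_inner inner_diff_left inner_diff_right inner_commute)
  have int: "integrable M (\<lambda>x. (norm (f x - f y))\<^sup>2)" for y
    unfolding eq using f by auto
  have inner: "(LINT x|M. (norm (f x - f y))\<^sup>2) = s - 2 * inner m (f y) + c * (norm (f y))\<^sup>2" for y
    unfolding eq using f by (simp add: m_def s_def c_def)
  have int2: "integrable M (\<lambda>y. s - 2 * inner m (f y) + c * (norm (f y))\<^sup>2)"
    using f by auto
  have nonneg: "0 \<le> s - 2 * inner m (f y) + c * (norm (f y))\<^sup>2" for y
  proof -
    have "0 \<le> (LINT x|M. (norm (f x - f y))\<^sup>2)" by simp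
    then show ?thesis by (simp only: inner)
  qed
  have val: "(LINT y|M. s - 2 * inner m (f y) + c * (norm (f y))\<^sup>2) = 2 * c * s - 2 * (norm m)\<^sup>2"
    using f by (simp add: m_def s_def c_def power2_norm_eq_inner)
  have "(\<integral>\<^sup>+y. (\<integral>\<^sup>+x. ennreal ((norm (f x - f y))\<^sup>2) \<partial>M) \<partial>M)
    = (\<integral>\<^sup>+y. ennreal (s - 2 * inner m (f y) + c * (norm (f y))\<^sup>2) \<partial>M)"
    using int by (simp add: nn_integral_eq_integral inner)
  also have "\<dots> = ennreal (LINT y|M. s - 2 * inner m (f y) + c * (norm (f y))\<^sup>2)"
    by (rule nn_integral_eq_integral[OF int2]) (simp add: nonneg)
  finally show "(\<integral>\<^sup>+y. (\<integral>\<^sup>+x. ennreal ((norm (f x - f y))\<^sup>2) \<partial>M) \<partial>M)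
    = ennreal (2 * measure M (space M) * (LINT x|M. (norm (f x))\<^sup>2) - 2 * (norm (LINT x|M. f x))\<^sup>2)"
    by (simp only: val) (simp add: m_def s_def c_def)
  have "0 \<le> (LINT y|M. s - 2 * inner m (f y) + c * (norm (f y))\<^sup>2)"
    by (simp add: nonneg)
  then show "0 \<le> 2 * measure M (space M) * (LINT x|M. (norm (f x))\<^sup>2) - 2 * (norm (LINT x|M. f x))\<^sup>2"
    by (simp only: val) (simp add: m_def s_def c_def)
qed

definition grad_sq :: "(real^'n \<Rightarrow> complex) \<Rightarrow> real^'n \<Rightarrow> real"
  where "grad_sq u x = (\<Sum>k\<in>UNIV. (norm (partial k u x))\<^sup>2)"

lemma directional_sq_le: "(norm (\<Sum>k\<in>UNIV. of_real (t $ k) * partial k u x))\<^sup>2 \<le> (norm t)\<^sup>2 * grad_sq u x"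
proof -
  have "norm (\<Sum>k\<in>UNIV. of_real (t $ k) * partial k u x) \<le> (\<Sum>k\<in>UNIV. \<bar>t $ k\<bar> * \<bar>norm (partial k u x)\<bar>)"
    by (rule order_trans[OF norm_sum]) (simp add: norm_mult)
  also have "\<dots> \<le> L2_set (\<lambda>k. t $ k) UNIV * L2_set (\<lambda>k. norm (partial k u x)) UNIV"
    by (rule L2_set_mult_ineq)
  finally have "(norm (\<Sum>k\<in>UNIV. of_real (t $ k) * partial k u x))\<^sup>2
      \<le> (L2_set (\<lambda>k. t $ k) UNIV * L2_set (\<lambda>k. norm (partial k u x)) UNIV)\<^sup>2"
    by (rule power_mono) simp
  also have "\<dots> = (norm t)\<^sup>2 * grad_sq u x"
    by (simp add: power_mult_distrib L2_set_def norm_vec_def grad_sq_def sum_nonneg)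
  finally show ?thesis .
qed

text \<open>The fundamental theorem of calculus on the segment from y to y + t, then Jensen on
  [0, 1] and Cauchy-Schwarz for the directional derivative.\<close>

lemma diff_sq_le_nn_integral_grad:
  fixes u :: "real^'n \<Rightarrow> complex"
  assumes u: "\<And>x. u differentiable (at x)" "\<And>k. continuous_on UNIV (partial k u)"
  shows "ennreal ((norm (u (y + t) - u y))\<^sup>2)
    \<le> (\<integral>\<^sup>+s. ennreal ((norm t)\<^sup>2 * grad_sq u (y + s *\<^sub>R t)) * indicator {0..1} s \<partial>lborel)"
proof -
  define D where "D = (\<lambda>s. \<Sum>k\<in>UNIV. of_real (t $ k) * partial k u (y + s *\<^sub>R t))"
  have line: "continuous_on UNIV (\<lambda>s. partial k u (y + s *\<^sub>R t))" for k
    by (rule continuous_on_compose2[OF u(2)]) (auto intro!: continuous_intros)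
  have D: "continuous_on UNIV D" unfolding D_def by (intro continuous_intros line)
  define N where "N = restrict_space lborel {0..1::real}"
  have N: "finite_measure N" "measure N (space N) = 1"
    by (auto intro!: finite_measureI simp: N_def emeasure_restrict_space measure_restrict_space space_restrict_space)
  have [measurable]: "D \<in> borel_measurable borel" using D by auto
  have "(LINT s|lborel. indicator {0..1} s *\<^sub>R D s) = u (y + 1 *\<^sub>R t) - u (y + 0 *\<^sub>R t)"
    unfolding D_def
    by (rule integral_FTC_Icc)
       (auto intro!: has_vector_derivative_along u continuous_intros continuous_on_subset[OF line])
  then have "(LINT s|N. D s) = u (y + t) - u y"
    by (simp add: N_def integral_restrict_space)
  moreover have Di: "integrable N (\<lambda>s. (norm (D s))\<^sup>2)"
  proof -
    have "integrable lborel (\<lambda>s. indicator {0..1} s *\<^sub>R (norm (D s))\<^sup>2)"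
      by (rule borel_integrable_compact) (auto intro!: continuous_intros continuous_on_subset[OF D])
    then show ?thesis by (simp add: N_def integrable_restrict_space)
  qed
  moreover have "D \<in> borel_measurable N" by (simp add: N_def measurable_restrict_space1)
  ultimately have "(norm (u (y + t) - u y))\<^sup>2 \<le> (LINT s|N. (norm (D s))\<^sup>2)"
    using norm_integral_sq_le[OF N] by metis
  then have "ennreal ((norm (u (y + t) - u y))\<^sup>2) \<le> ennreal (LINT s|N. (norm (D s))\<^sup>2)"
    by (rule ennreal_leI)
  also have "\<dots> = (\<integral>\<^sup>+s. ennreal ((norm (D s))\<^sup>2) \<partial>N)"
    using Di by (simp add: nn_integral_eq_integral)
  also have "\<dots> \<le> (\<integral>\<^sup>+s. ennreal ((norm t)\<^sup>2 * grad_sq u (y + s *\<^sub>R t)) \<partial>N)"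
    unfolding D_def by (intro nn_integral_mono ennreal_leI directional_sq_le)
  also have "\<dots> = (\<integral>\<^sup>+s. ennreal ((norm t)\<^sup>2 * grad_sq u (y + s *\<^sub>R t)) * indicator {0..1} s \<partial>lborel)"
    by (simp add: N_def nn_integral_restrict_space)
  finally show ?thesis .
qed

text \<open>After the order of integration is exchanged, translation invariance makes the inner
  integral independent of the position s on the segment.\<close>

lemma translation_estimate:
  fixes u :: "real^'n \<Rightarrow> complex"
  assumes u: "\<And>x. u differentiable (at x)" "\<And>k. continuous_on UNIV (partial k u)"
  shows "(\<integral>\<^sup>+y. ennreal ((norm (u (y + t) - u y))\<^sup>2) \<partial>lborel)
    \<le> ennreal ((norm t)\<^sup>2) * (\<integral>\<^sup>+y. ennreal (grad_sq u y) \<partial>lborel)"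
proof -
  have [measurable]: "grad_sq u \<in> borel_measurable borel"
    unfolding grad_sq_def using u(2) by (auto intro!: borel_measurable_continuous continuous_intros)
  have g0: "0 \<le> grad_sq u x" for x by (simp add: grad_sq_def sum_nonneg)
  have "(\<integral>\<^sup>+y. ennreal ((norm (u (y + t) - u y))\<^sup>2) \<partial>lborel)
    \<le> (\<integral>\<^sup>+y. (\<integral>\<^sup>+s. ennreal ((norm t)\<^sup>2 * grad_sq u (y + s *\<^sub>R t)) * indicator {0..1} s \<partial>lborel) \<partial>lborel)"
    by (intro nn_integral_mono diff_sq_le_nn_integral_grad u)
  also have "\<dots> = (\<integral>\<^sup>+s. (\<integral>\<^sup>+y. ennreal ((norm t)\<^sup>2 * grad_sq u (y + s *\<^sub>R t)) * indicator {0..1} s \<partial>lborel) \<partial>lborel)"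
    by (rule lborel_pair.Fubini') measurable
  also have "\<dots> = (\<integral>\<^sup>+s. ennreal ((norm t)\<^sup>2) * (\<integral>\<^sup>+y. ennreal (grad_sq u y) \<partial>lborel) * indicator {0..1} (s::real) \<partial>lborel)"
  proof (rule nn_integral_cong)
    fix s :: real
    have "(\<integral>\<^sup>+y. ennreal ((norm t)\<^sup>2 * grad_sq u (y + s *\<^sub>R t)) * indicator {0..1} s \<partial>lborel)
      = ennreal ((norm t)\<^sup>2) * (\<integral>\<^sup>+y. ennreal (grad_sq u (s *\<^sub>R t + y)) \<partial>lborel) * indicator {0..1} s"
      by (simp add: ennreal_mult g0 nn_integral_multc nn_integral_cmult add.commute)
    then show "(\<integral>\<^sup>+y. ennreal ((norm t)\<^sup>2 * grad_sq u (y + s *\<^sub>R t)) * indicator {0..1} s \<partial>lborel)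
      = ennreal ((norm t)\<^sup>2) * (\<integral>\<^sup>+y. ennreal (grad_sq u y) \<partial>lborel) * indicator {0..1} s"
      using nn_integral_translate[of "\<lambda>y. ennreal (grad_sq u y)" "s *\<^sub>R t"] by simp
  qed
  also have "\<dots> = ennreal ((norm t)\<^sup>2) * (\<integral>\<^sup>+y. ennreal (grad_sq u y) \<partial>lborel)"
    by (subst nn_integral_cmult_indicator) auto
  finally show ?thesis .
qed

section \<open>Partition of the space into half-open cubes\<close>

definition grid_index :: "real \<Rightarrow> real^'n \<Rightarrow> 'n \<Rightarrow> int"
  where "grid_index h x = (\<lambda>k. \<lfloor>x $ k / h\<rfloor>)"

text \<open>As fibres of the floor map the cells are pairwise disjoint and cover everything. A sum
  over cells containing a given point thus has at most one nonzero term.\<close>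

definition grid_cell :: "real \<Rightarrow> ('n \<Rightarrow> int) \<Rightarrow> (real^'n) set"
  where "grid_cell h j = {x. grid_index h x = j}"

lemma grid_cell_alt: "grid_cell h j = {x. \<forall>k. \<lfloor>x $ k / h\<rfloor> = j k}"
  by (auto simp: grid_cell_def grid_index_def fun_eq_iff)

lemma grid_cell_measurable [measurable]:
  fixes j :: "'n::finite \<Rightarrow> int"
  shows "grid_cell h j \<in> sets borel"
proof -
  have "{x::real^'n. \<forall>k. \<lfloor>x $ k / h\<rfloor> = j k} \<in> sets borel"
    by measurable
  then show ?thesis by (simp add: grid_cell_alt)
qed

lemma grid_cell_between:
  assumes "h > 0"
  shows "box (\<chi> k. of_int (j k) * h) (\<chi> k. of_int (j k) * h + h) \<subseteq> grid_cell h j"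
    and "grid_cell h j \<subseteq> cbox (\<chi> k. of_int (j k) * h) (\<chi> k. of_int (j k) * h + h)"
  using assms by (auto simp: grid_cell_alt mem_box_cart floor_eq_iff field_simps less_imp_le)

lemma emeasure_grid_cell:
  fixes j :: "'n::finite \<Rightarrow> int"
  assumes h: "h > 0"
  shows "emeasure lborel (grid_cell h j) = ennreal (h ^ CARD('n))"
proof -
  let ?a = "(\<chi> k. of_int (j k) * h) :: real^'n" and ?b = "(\<chi> k. of_int (j k) * h + h) :: real^'n"
  have le: "\<And>b. b \<in> Basis \<Longrightarrow> ?a \<bullet> b \<le> ?b \<bullet> b"
    using h by (auto simp: Basis_vec_def inner_axis)
  have prod: "(\<Prod>b\<in>Basis. (?b - ?a) \<bullet> b) = h ^ CARD('n)"
  proof -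
    have "(\<Prod>b\<in>Basis. (?b - ?a) \<bullet> b) = (\<Prod>b\<in>(Basis :: (real^'n) set). h)"
      by (intro prod.cong) (auto simp: Basis_vec_def inner_axis)
    then show ?thesis by simp
  qed
  have "emeasure lborel (grid_cell h j) \<le> emeasure lborel (cbox ?a ?b)"
    by (intro emeasure_mono grid_cell_between h) simp
  moreover have "emeasure lborel (box ?a ?b) \<le> emeasure lborel (grid_cell h j)"
    by (intro emeasure_mono grid_cell_between h) simp
  ultimately show ?thesis
    using emeasure_lborel_cbox[OF le] emeasure_lborel_box[OF le] by (simp add: prod)
qed

text \<open>Two points of one cell differ by some t in the cube [-h, h]^d with d = CARD('n). The
  left side is thus at most the integral over this cube of the translation differences. There |t|^2
  \<le> d h^2, and the cube has volume (2h)^d, whence the constant.\<close>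

lemma grid_diff_sq_sum_le:
  fixes u :: "real^'n \<Rightarrow> complex"
  assumes h: "h > 0" and J: "finite J"
    and u: "\<And>x. u differentiable (at x)" "\<And>k. continuous_on UNIV (partial k u)"
  shows "(\<Sum>j\<in>J. \<integral>\<^sup>+y. (\<integral>\<^sup>+x. ennreal ((norm (u x - u y))\<^sup>2) * indicator (grid_cell h j) x \<partial>lborel)
      * indicator (grid_cell h j) y \<partial>lborel)
    \<le> ennreal (2 ^ CARD('n) * real CARD('n) * h ^ CARD('n) * h\<^sup>2) * (\<integral>\<^sup>+y. ennreal (grad_sq u y) \<partial>lborel)"
proof -
  have cu: "continuous_on UNIV u"
    using u(1) by (auto simp: continuous_on_eq_continuous_at differentiable_imp_continuous_within)
  have [measurable]: "u \<in> borel_measurable borel" using cu by auto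
  let ?B = "cbox (\<chi> k. - h) (\<chi> k. h) :: (real^'n) set"
  have "(\<Sum>j\<in>J. \<integral>\<^sup>+y. (\<integral>\<^sup>+x. ennreal ((norm (u x - u y))\<^sup>2) * indicator (grid_cell h j) x \<partial>lborel)
      * indicator (grid_cell h j) y \<partial>lborel)
    = (\<integral>\<^sup>+y. (\<Sum>j\<in>J. (\<integral>\<^sup>+x. ennreal ((norm (u x - u y))\<^sup>2) * indicator (grid_cell h j) x \<partial>lborel)
      * indicator (grid_cell h j) y) \<partial>lborel)"
    by (subst nn_integral_sum) auto
  also have "\<dots> \<le> (\<integral>\<^sup>+y. (\<integral>\<^sup>+t. ennreal ((norm (u (y + t) - u y))\<^sup>2) * indicator ?B t \<partial>lborel) \<partial>lborel)"
  proof (rule nn_integral_mono)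
    fix y :: "real^'n"
    define T where "T = (\<lambda>j. (\<integral>\<^sup>+x. ennreal ((norm (u x - u y))\<^sup>2) * indicator (grid_cell h j) x \<partial>lborel))"
    define i where "i = grid_index h y"
    \<comment> \<open>Only the cell with the index of y contributes, and only if that index belongs
      to J.\<close>
    have "(\<Sum>j\<in>J. T j * indicator (grid_cell h j) y) = (\<Sum>j\<in>J. if j = i then T i else 0)"
      by (intro sum.cong) (auto simp: grid_cell_def i_def)
    also have "\<dots> \<le> T i" using J by simp
    also have "\<dots> \<le> (\<integral>\<^sup>+x. ennreal ((norm (u x - u y))\<^sup>2) * indicator ?B (x - y) \<partial>lborel)"
      unfolding T_def
    proof (intro nn_integral_mono mult_left_mono)
      fix x
      have "x - y \<in> ?B" if "x \<in> grid_cell h i"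
        unfolding mem_box_cart
      proof (intro allI)
        fix k
        have "\<lfloor>x $ k / h\<rfloor> = \<lfloor>y $ k / h\<rfloor>" using that by (simp add: grid_cell_alt i_def grid_index_def)
        then have "\<bar>x $ k / h - y $ k / h\<bar> < 1" by linarith
        then have "\<bar>x $ k - y $ k\<bar> < h" using h by (simp add: diff_divide_distrib[symmetric])
        then show "(\<chi> k. - h) $ k \<le> (x - y) $ k \<and> (x - y) $ k \<le> (\<chi> k. h) $ k" by auto
      qed
      then show "indicator (grid_cell h i) x \<le> (indicator ?B (x - y) :: ennreal)"
        by (auto simp: indicator_def)
    qed simp
    also have "\<dots> = (\<integral>\<^sup>+t. ennreal ((norm (u (y + t) - u y))\<^sup>2) * indicator ?B (y + t - y) \<partial>lborel)"
      by (rule nn_integral_translate[symmetric]) measurable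
    finally show "(\<Sum>j\<in>J. T j * indicator (grid_cell h j) y)
        \<le> (\<integral>\<^sup>+t. ennreal ((norm (u (y + t) - u y))\<^sup>2) * indicator ?B t \<partial>lborel)" by simp
  qed
  also have "\<dots> = (\<integral>\<^sup>+t. (\<integral>\<^sup>+y. ennreal ((norm (u (y + t) - u y))\<^sup>2) * indicator ?B t \<partial>lborel) \<partial>lborel)"
    by (rule lborel_pair.Fubini') measurable
  also have "\<dots> \<le> (\<integral>\<^sup>+t. ennreal (real CARD('n) * h\<^sup>2) * (\<integral>\<^sup>+y. ennreal (grad_sq u y) \<partial>lborel) * indicator ?B t \<partial>lborel)"
  proof (rule nn_integral_mono)
    fix t :: "real^'n"
    show "(\<integral>\<^sup>+y. ennreal ((norm (u (y + t) - u y))\<^sup>2) * indicator ?B t \<partial>lborel)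
      \<le> ennreal (real CARD('n) * h\<^sup>2) * (\<integral>\<^sup>+y. ennreal (grad_sq u y) \<partial>lborel) * indicator ?B t"
    proof (cases "t \<in> ?B")
      case True
      have "(norm t)\<^sup>2 = (\<Sum>k\<in>UNIV. (t $ k)\<^sup>2)"
        by (simp add: norm_vec_def L2_set_def sum_nonneg)
      also have "\<dots> \<le> (\<Sum>k\<in>(UNIV::'n set). h\<^sup>2)"
      proof (rule sum_mono)
        fix k
        have "\<bar>t $ k\<bar> \<le> \<bar>h\<bar>" using True h by (auto simp: mem_box_cart abs_le_iff) (metis minus_le_iff)
        then show "(t $ k)\<^sup>2 \<le> h\<^sup>2" by (rule abs_le_square_iff[THEN iffD1])
      qed
      finally have "ennreal ((norm t)\<^sup>2) \<le> ennreal (real CARD('n) * h\<^sup>2)" by (simp add: ennreal_leI)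
      then have "ennreal ((norm t)\<^sup>2) * (\<integral>\<^sup>+y. ennreal (grad_sq u y) \<partial>lborel)
        \<le> ennreal (real CARD('n) * h\<^sup>2) * (\<integral>\<^sup>+y. ennreal (grad_sq u y) \<partial>lborel)"
        by (intro mult_right_mono) auto
      then show ?thesis using True order_trans[OF translation_estimate[OF u]] by simp
    qed simp
  qed
  also have "\<dots> = ennreal (real CARD('n) * h\<^sup>2) * (\<integral>\<^sup>+y. ennreal (grad_sq u y) \<partial>lborel) * emeasure lborel ?B"
    by (subst nn_integral_cmult_indicator) auto
  also have "emeasure lborel ?B = ennreal ((2 * h) ^ CARD('n))"
  proof -
    have "emeasure lborel ?B = ennreal (\<Prod>b\<in>Basis. ((\<chi> k. h) - (\<chi> k. - h)) \<bullet> (b :: real^'n))"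
      using h by (intro emeasure_lborel_cbox) (auto simp: Basis_vec_def inner_axis)
    also have "(\<Prod>b\<in>Basis. ((\<chi> k. h) - (\<chi> k. - h)) \<bullet> (b :: real^'n)) = (\<Prod>b\<in>(Basis :: (real^'n) set). 2 * h)"
      by (intro prod.cong) (auto simp: Basis_vec_def inner_axis)
    finally show ?thesis by simp
  qed
  also have "ennreal (real CARD('n) * h\<^sup>2) * (\<integral>\<^sup>+y. ennreal (grad_sq u y) \<partial>lborel) * ennreal ((2 * h) ^ CARD('n))
    = ennreal (real CARD('n) * h\<^sup>2) * ennreal ((2 * h) ^ CARD('n)) * (\<integral>\<^sup>+y. ennreal (grad_sq u y) \<partial>lborel)"
    by (simp add: mult_ac)
  also have "ennreal (real CARD('n) * h\<^sup>2) * ennreal ((2 * h) ^ CARD('n))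
    = ennreal (2 ^ CARD('n) * real CARD('n) * h ^ CARD('n) * h\<^sup>2)"
    using h by (subst ennreal_mult[symmetric]) (simp_all add: power_mult_distrib mult_ac)
  finally show ?thesis .
qed

text \<open>
  A quantitative form of the compactness of the embedding of \<open>H\<^sup>1\<^sub>0(\<Omega>)\<close> into \<open>L\<^sub>2(\<Omega>)\<close>:
  up to a small multiple of the gradient, the \<open>L\<^sub>2\<close> norm is controlled by finitely many averages.
\<close>

lemma poincare_grid:
  fixes \<Omega> :: "(real^'n) set"
  assumes \<Omega>: "bounded \<Omega>" and \<epsilon>: "\<epsilon> > 0"
  shows "\<exists>\<Q> K. finite \<Q> \<and> (\<forall>Q\<in>\<Q>. Q \<in> sets borel \<and> bounded Q) \<and> 0 \<le> K \<and>
    (\<forall>u\<in>test_functions \<Omega>. (LINT x|lborel. (norm (u x))\<^sup>2)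
      \<le> \<epsilon> * (LINT x|lborel. grad_sq u x) + K * (\<Sum>Q\<in>\<Q>. (norm (LINT x|lborel. indicator Q x *\<^sub>R u x))\<^sup>2))"
proof -
  define d where "d = CARD('n)"
  \<comment> \<open>Chosen so that the grid constant 2^d d h^d h^2 becomes h^d \<epsilon>. Division
    by 2 h^d leaves \<epsilon>/2 in front of the gradient and 1 / h^d in front of the
    averages.\<close>
  define h where "h = sqrt (\<epsilon> / (2 ^ d * real d))"
  have d: "d > 0" by (simp add: d_def)
  have h: "h > 0" using \<epsilon> d by (simp add: h_def)
  have h2: "2 ^ d * real d * h\<^sup>2 = \<epsilon>" using \<epsilon> d by (simp add: h_def)
  obtain R where R: "\<And>x. x \<in> \<Omega> \<Longrightarrow> norm x \<le> R" using \<Omega> by (auto simp: bounded_iff)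
  \<comment> \<open>Finitely many indices that include every cell meeting the bounded domain, which
    lies in the ball of radius R.\<close>
  define J where "J = {j :: 'n \<Rightarrow> int. \<forall>k. j k \<in> {\<lfloor>- R / h\<rfloor>..\<lfloor>R / h\<rfloor>}}"
  have J: "finite J"
    using finite_PiE[of "UNIV :: 'n set" "\<lambda>_. {\<lfloor>- R / h\<rfloor>..\<lfloor>R / h\<rfloor>}"] by (simp add: J_def PiE_UNIV_domain Pi_def)
  have \<Omega>J: "grid_index h x \<in> J" if "x \<in> \<Omega>" for x
  proof -
    have "\<bar>x $ k\<bar> \<le> R" for k using component_le_norm_cart[of x k] R[OF that] by linarith
    then have "- R \<le> x $ k" "x $ k \<le> R" for k by (auto simp: abs_le_iff minus_le_iff)
    then have "- R / h \<le> x $ k / h" "x $ k / h \<le> R / h" for k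
      using h by (intro divide_right_mono; simp)+
    then show ?thesis unfolding J_def grid_index_def by (simp add: floor_mono)
  qed
  define \<Q> where "\<Q> = grid_cell h ` J"
  \<comment> \<open>The result speaks of a set of cells, the estimates of indices. Cells are told
    apart by the corner h i, which the half-open cell contains.\<close>
  have inj: "inj_on (grid_cell h) J"
  proof (rule inj_onI)
    fix i j assume "grid_cell h i = (grid_cell h j :: (real^'n) set)"
    moreover have "(\<chi> k. of_int (i k) * h) \<in> grid_cell h i" using h by (simp add: grid_cell_alt)
    ultimately have "(\<chi> k. of_int (i k) * h) \<in> grid_cell h j" by simp
    then show "i = j" using h by (simp add: grid_cell_alt fun_eq_iff)
  qed
  have est: "(LINT x|lborel. (norm (u x))\<^sup>2)
      \<le> \<epsilon> * (LINT x|lborel. grad_sq u x) + (1 / h ^ d) * (\<Sum>Q\<in>\<Q>. (norm (LINT x|lborel. indicator Q x *\<^sub>R u x))\<^sup>2)"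
    if u: "u \<in> test_functions \<Omega>" for u
  proof -
    have cu: "continuous_on UNIV u" "\<And>k. continuous_on UNIV (partial k u)"
      using u by (auto intro: test_continuous test_partial)
    have cs: "compact (supp u)" using u by (simp add: test_functions_iff)
    have ui: "integrable lborel u" by (rule integrable_compact_supp[OF cu(1) cs])
    have u2: "integrable lborel (\<lambda>x. (norm (u x))\<^sup>2)"
      by (rule integrable_compact_supp)
         (auto intro!: continuous_intros cu compact_supp_subset[OF cs] supp_subset[OF closed_supp] simp: not_in_supp)
    have pz: "x \<notin> supp u \<Longrightarrow> partial k u x = 0" for k x
      using supp_partial[of k u] not_in_supp by blast
    have g2: "integrable lborel (grad_sq u)"
      unfolding grad_sq_def
      by (rule integrable_compact_supp)
         (auto intro!: continuous_intros cu compact_supp_subset[OF cs] supp_subset[OF closed_supp] simp: pz)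
    define \<Gamma> where "\<Gamma> = (LINT x|lborel. grad_sq u x)"
    have g0: "0 \<le> grad_sq u x" for x by (simp add: grad_sq_def sum_nonneg)
    have \<Gamma>: "(\<integral>\<^sup>+y. ennreal (grad_sq u y) \<partial>lborel) = ennreal \<Gamma>" "0 \<le> \<Gamma>"
      unfolding \<Gamma>_def using g2 g0 by (simp_all add: nn_integral_eq_integral)
    define s where "s = (\<lambda>j. LINT x|lborel. indicator (grid_cell h j) x *\<^sub>R (norm (u x))\<^sup>2)"
    define m where "m = (\<lambda>j. norm (LINT x|lborel. indicator (grid_cell h j) x *\<^sub>R u x))"
    \<comment> \<open>Nonnegativity of each term is proved alongside, so that the sum over J can be
      moved inside \<open>ennreal\<close>.\<close>
    have cell: "(\<integral>\<^sup>+y. (\<integral>\<^sup>+x. ennreal ((norm (u x - u y))\<^sup>2) * indicator (grid_cell h j) x \<partial>lborel)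
        * indicator (grid_cell h j) y \<partial>lborel) = ennreal (2 * h ^ d * s j - 2 * (m j)\<^sup>2)"
      and cell0: "0 \<le> 2 * h ^ d * s j - 2 * (m j)\<^sup>2" for j
    proof -
      define M where "M = restrict_space lborel (grid_cell h j :: (real^'n) set)"
      have M: "finite_measure M" "measure M (space M) = h ^ d"
        using h by (auto intro!: finite_measureI
            simp: M_def emeasure_restrict_space space_restrict_space emeasure_grid_cell d_def measure_restrict_space measure_def)
      have int: "integrable M u" "integrable M (\<lambda>x. (norm (u x))\<^sup>2)"
        unfolding M_def
        using integrable_mult_indicator[of "grid_cell h j" lborel, OF _ ui]
          integrable_mult_indicator[of "grid_cell h j" lborel, OF _ u2]
        by (simp_all add: integrable_restrict_space)
      have eq: "(LINT x|M. (norm (u x))\<^sup>2) = s j" "norm (LINT x|M. u x) = m j"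
        unfolding M_def s_def m_def by (simp_all add: integral_restrict_space)
      show "(\<integral>\<^sup>+y. (\<integral>\<^sup>+x. ennreal ((norm (u x - u y))\<^sup>2) * indicator (grid_cell h j) x \<partial>lborel)
        * indicator (grid_cell h j) y \<partial>lborel) = ennreal (2 * h ^ d * s j - 2 * (m j)\<^sup>2)"
        using double_integral_diff_sq(1)[OF M(1) int] unfolding M(2) eq
        by (simp add: M_def nn_integral_restrict_space)
      show "0 \<le> 2 * h ^ d * s j - 2 * (m j)\<^sup>2"
        using double_integral_diff_sq(2)[OF M(1) int] unfolding M(2) eq .
    qed
    have "ennreal (\<Sum>j\<in>J. 2 * h ^ d * s j - 2 * (m j)\<^sup>2)
      \<le> ennreal (2 ^ d * real d * h ^ d * h\<^sup>2) * ennreal \<Gamma>"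
      using grid_diff_sq_sum_le[OF h J test_differentiable[OF u] cu(2)] cell0
      by (simp add: cell \<Gamma> d_def[symmetric] sum_ennreal)
    also have "\<dots> = ennreal (h ^ d * \<epsilon> * \<Gamma>)"
      using h \<epsilon> \<Gamma>(2) by (subst ennreal_mult[symmetric]) (simp_all add: h2[symmetric] mult_ac)
    finally have "(\<Sum>j\<in>J. 2 * h ^ d * s j - 2 * (m j)\<^sup>2) \<le> h ^ d * \<epsilon> * \<Gamma>"
      using h \<epsilon> \<Gamma>(2) by (simp add: ennreal_le_iff)
    then have "2 * h ^ d * (\<Sum>j\<in>J. s j) \<le> h ^ d * \<epsilon> * \<Gamma> + 2 * (\<Sum>j\<in>J. (m j)\<^sup>2)"
      by (simp add: sum_subtractf sum_distrib_left)
    then have "(\<Sum>j\<in>J. s j) \<le> \<epsilon> * \<Gamma> / 2 + (1 / h ^ d) * (\<Sum>j\<in>J. (m j)\<^sup>2)"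
      using h by (simp add: field_simps)
    moreover have "(\<Sum>j\<in>J. s j) = (LINT x|lborel. (norm (u x))\<^sup>2)"
    proof -
      have "(\<Sum>j\<in>J. s j) = (LINT x|lborel. (\<Sum>j\<in>J. indicator (grid_cell h j) x *\<^sub>R (norm (u x))\<^sup>2))"
        unfolding s_def using u2
        by (intro Bochner_Integration.integral_sum[symmetric] integrable_mult_indicator) auto
      also have "\<dots> = (LINT x|lborel. (norm (u x))\<^sup>2)"
      proof (rule Bochner_Integration.integral_cong)
        fix x
        have "(\<Sum>j\<in>J. indicator (grid_cell h j) x *\<^sub>R (norm (u x))\<^sup>2)
          = (\<Sum>j\<in>J. if j = grid_index h x then (norm (u x))\<^sup>2 else 0)"
          by (intro sum.cong) (auto simp: grid_cell_def indicator_def)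
        then show "(\<Sum>j\<in>J. indicator (grid_cell h j) x *\<^sub>R (norm (u x))\<^sup>2) = (norm (u x))\<^sup>2"
          using J \<Omega>J[of x] test_zero_outside[OF u, of x] by auto
      qed simp
      finally show ?thesis .
    qed
    moreover have "(\<Sum>j\<in>J. (m j)\<^sup>2) = (\<Sum>Q\<in>\<Q>. (norm (LINT x|lborel. indicator Q x *\<^sub>R u x))\<^sup>2)"
      unfolding \<Q>_def m_def by (simp add: sum.reindex[OF inj])
    moreover have "\<epsilon> * \<Gamma> / 2 \<le> \<epsilon> * \<Gamma>" using \<epsilon> \<Gamma>(2) by simp
    ultimately show ?thesis unfolding \<Gamma>_def by (metis (no_types, lifting) add_right_mono order_trans)
  qed
  show ?thesis
  proof (intro exI conjI ballI)
    show "finite \<Q>" using J by (simp add: \<Q>_def)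
    show "Q \<in> sets borel" if "Q \<in> \<Q>" for Q using that by (auto simp: \<Q>_def)
    show "bounded Q" if "Q \<in> \<Q>" for Q
      using that bounded_subset[OF bounded_cbox grid_cell_between(2)[OF h]] by (auto simp: \<Q>_def)
    show "0 \<le> 1 / h ^ d" using h by simp
  qed (use est in blast)
qed

section \<open>Sobolev functions\<close>

lemma L2_iff: "f \<in> L2 M \<longleftrightarrow> sq_integrable M f"
  by (simp add: L2_def sq_integrable_def)

lemma sq_integrable_lincomb:
  fixes f g :: "'a \<Rightarrow> complex"
  assumes "sq_integrable M f" "sq_integrable M g"
  shows "sq_integrable M (\<lambda>x. c * f x + d * g x)"
proof (rule sq_integrable_add)
  show "sq_integrable M (\<lambda>x. c * f x)" "sq_integrable M (\<lambda>x. d * g x)"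
    using assms by (auto simp: sq_integrable_def norm_mult power_mult_distrib)
qed

lemma borel_measurable_vecI:
  fixes f :: "'a \<Rightarrow> complex^'n"
  assumes "\<And>k. (\<lambda>x. f x $ k) \<in> borel_measurable M"
  shows "f \<in> borel_measurable M"
  unfolding borel_measurable_euclidean_space[of f]
  using assms by (auto simp: Basis_vec_def inner_axis intro!: borel_measurable_inner)

lemma sq_integrable_continuous_compact_supp:
  fixes f :: "'a::euclidean_space \<Rightarrow> 'b::euclidean_space"
  assumes "continuous_on UNIV f" "compact (supp f)"
  shows "sq_integrable lebesgue f"
  unfolding sq_integrable_def
proof
  show "f \<in> borel_measurable lebesgue" using assms(1) by (intro measurable_completion) auto
  have "integrable lborel (\<lambda>x. (norm (f x))\<^sup>2)"
    by (rule integrable_compact_supp)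
       (auto intro!: continuous_intros assms compact_supp_subset[OF assms(2)] supp_subset[OF closed_supp] simp: not_in_supp)
  then show "integrable lebesgue (\<lambda>x. (norm (f x))\<^sup>2)"
    using integrable_completion[of "\<lambda>x. (norm (f x))\<^sup>2" lborel] by auto
qed

lemma AE_lebesgue_on_iff:
  "S \<in> sets lebesgue \<Longrightarrow> (AE x in lebesgue_on S. P x) \<longleftrightarrow> (AE x in lebesgue. x \<in> S \<longrightarrow> P x)"
  by (intro AE_restrict_space_iff) simp

lemma sq_integrable_restrict_UNIV:
  fixes f :: "'a::euclidean_space \<Rightarrow> 'b::euclidean_space"
  assumes "S \<in> sets lebesgue"
  shows "sq_integrable lebesgue (\<lambda>x. if x \<in> S then f x else 0) \<longleftrightarrow> sq_integrable (lebesgue_on S) f"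
proof -
  have "(\<lambda>x. (norm (if x \<in> S then f x else 0))\<^sup>2) = (\<lambda>x. if x \<in> S then (norm (f x))\<^sup>2 else 0)"
    by auto
  then show ?thesis
    unfolding sq_integrable_def borel_measurable_if[OF assms]
    using Lebesgue_Measure.integrable_restrict_UNIV[OF assms, of "\<lambda>x. (norm (f x))\<^sup>2"] by simp
qed

lemma sq_integrable_lebesgue_on_AE:
  fixes f :: "'a::euclidean_space \<Rightarrow> 'b::euclidean_space"
  assumes S: "S \<in> sets lebesgue" and f: "sq_integrable (lebesgue_on S) f"
    and fg: "AE x in lebesgue_on S. f x = g x"
  shows "sq_integrable (lebesgue_on S) g"
proof -
  let ?f = "\<lambda>x. if x \<in> S then f x else 0" and ?g = "\<lambda>x. if x \<in> S then g x else 0"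
  have f': "sq_integrable lebesgue ?f" using f S by (simp add: sq_integrable_restrict_UNIV)
  have ae: "AE x in lebesgue. ?f x = ?g x"
    using fg unfolding AE_lebesgue_on_iff[OF S] by eventually_elim simp
  have "?f \<in> borel_measurable lebesgue" using f' by (simp add: sq_integrable_def)
  then have m: "?g \<in> borel_measurable lebesgue" using ae by (rule borel_measurable_AE)
  have "sq_integrable lebesgue ?g"
  proof (rule sq_integrable_bound[OF m])
    show "integrable lebesgue (\<lambda>x. (norm (?f x))\<^sup>2)" using f' by (simp add: sq_integrable_def)
    show "AE x in lebesgue. (norm (?g x))\<^sup>2 \<le> (norm (?f x))\<^sup>2" using ae by eventually_elim simp
  qed
  then show ?thesis using S by (simp add: sq_integrable_restrict_UNIV)
qed

lemma locally_integrable_lincomb: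
  assumes "locally_integrable \<Omega> f" "locally_integrable \<Omega> g"
  shows "locally_integrable \<Omega> (\<lambda>x. c * f x + d * g x)"
proof -
  have "integrable lebesgue (\<lambda>x. indicator K x *\<^sub>R (c * f x + d * g x))" if "compact K" "K \<subseteq> \<Omega>" for K
  proof -
    have "integrable lebesgue (\<lambda>x. c * (indicator K x *\<^sub>R f x) + d * (indicator K x *\<^sub>R g x))"
      using assms that unfolding locally_integrable_def set_integrable_def
      by (intro Bochner_Integration.integrable_add integrable_mult_right) auto
    then show ?thesis by (simp add: scaleR_add_right)
  qed
  then show ?thesis by (simp add: locally_integrable_def set_integrable_def)
qed

lemma integrable_locally_integrable_test:
  fixes g :: "real^'n \<Rightarrow> complex"
  assumes g: "locally_integrable \<Omega> g" and v: "v \<in> test_functions \<Omega>" and \<Omega>: "\<Omega> \<in> sets lebesgue"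
  shows "integrable (lebesgue_on \<Omega>) (\<lambda>x. g x * v x)"
proof -
  have K: "compact (supp v)" "supp v \<subseteq> \<Omega>" using v by (auto simp: test_functions_iff)
  have gK: "integrable lebesgue (\<lambda>x. indicator (supp v) x *\<^sub>R g x)"
    using g K by (auto simp: locally_integrable_def set_integrable_def)
  have cv: "continuous_on UNIV v" by (rule test_continuous[OF v])
  have "bounded (v ` supp v)"
    by (intro compact_imp_bounded compact_continuous_image continuous_on_subset[OF cv] K) auto
  then obtain B where B: "\<And>x. x \<in> supp v \<Longrightarrow> norm (v x) \<le> B" unfolding bounded_iff by auto
  have "integrable lebesgue (\<lambda>x. (indicator (supp v) x *\<^sub>R g x) * v x)"
  proof (rule Bochner_Integration.integrable_bound)
    show "integrable lebesgue (\<lambda>x. B * norm (indicator (supp v) x *\<^sub>R g x))"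
      using integrable_norm[OF gK] by (rule integrable_mult_right)
    have "v \<in> borel_measurable lebesgue" using cv by (intro measurable_completion) auto
    then show "(\<lambda>x. (indicator (supp v) x *\<^sub>R g x) * v x) \<in> borel_measurable lebesgue"
      using gK by (intro borel_measurable_times) auto
    have "norm ((indicator (supp v) x *\<^sub>R g x) * v x) \<le> B * norm (indicator (supp v) x *\<^sub>R g x)" for x
      using B[of x] by (auto simp: indicator_def norm_mult mult.commute[of B] intro!: mult_left_mono)
    then show "AE x in lebesgue. norm ((indicator (supp v) x *\<^sub>R g x) * v x)
        \<le> norm (B * norm (indicator (supp v) x *\<^sub>R g x))"
      by (intro AE_I2) (metis abs_ge_self order_trans real_norm_def)
  qed
  moreover have "(\<lambda>x. (indicator (supp v) x *\<^sub>R g x) * v x) = (\<lambda>x. if x \<in> \<Omega> then g x * v x else 0)"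
    using K(2) by (auto simp: indicator_def not_in_supp fun_eq_iff)
  ultimately show ?thesis using Lebesgue_Measure.integrable_restrict_UNIV[OF \<Omega>, of "\<lambda>x. g x * v x"] by simp
qed

text \<open>
  Being the weak derivative means being orthogonal to these fields, so it is preserved under
  \<open>L\<^sub>2\<close> limits.
\<close>

definition test_field :: "'n \<Rightarrow> (real^'n \<Rightarrow> complex) \<Rightarrow> real^'n \<Rightarrow> complex \<times> (complex^'n)"
  where "test_field k v x = (cnj (partial k v x), axis k (cnj (v x)))"

lemma sq_integrable_test_field:
  assumes v: "v \<in> test_functions \<Omega>"
  shows "sq_integrable lebesgue (test_field k v)"
proof (rule sq_integrable_continuous_compact_supp)
  have eq: "axis k (cnj (v x)) = (\<chi> j. if j = k then cnj (v x) else 0)" for x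
    by (simp add: axis_def vec_eq_iff)
  have "continuous_on UNIV (\<lambda>x. \<chi> j. if j = k then cnj (v x) else 0)"
  proof (rule continuous_on_vec_lambda)
    fix j show "continuous_on UNIV (\<lambda>x. if j = k then cnj (v x) else 0)"
      by (cases "j = k") (auto intro!: continuous_intros test_continuous[OF v])
  qed
  then have "continuous_on UNIV (\<lambda>x. axis k (cnj (v x)))" by (simp only: eq)
  then show "continuous_on UNIV (test_field k v)"
    unfolding test_field_def by (intro continuous_intros test_continuous[OF test_partial[OF v]])
  have "supp (test_field k v) \<subseteq> supp v"
  proof (rule supp_subset[OF closed_supp])
    fix x assume "x \<notin> supp v"
    then have "v x = 0" "partial k v x = 0" using supp_partial[of k v] not_in_supp by blast+
    then show "test_field k v x = 0" by (simp add: test_field_def axis_def zero_prod_def vec_eq_iff)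
  qed
  then show "compact (supp (test_field k v))"
    using v compact_supp_subset by (auto simp: test_functions_iff)
qed

lemma subspace_closure:
  fixes S :: "'a::real_normed_vector set"
  assumes S: "subspace S"
  shows "subspace (closure S)"
  unfolding subspace_def
proof (intro conjI ballI allI)
  show "0 \<in> closure S" using subspace_0[OF S] closure_subset by blast
  fix x assume "x \<in> closure S"
  then obtain X where X: "\<forall>n. X n \<in> S" "X \<longlonglongrightarrow> x" unfolding closure_sequential by blast
  show "c *\<^sub>R x \<in> closure S" for c
    unfolding closure_sequential using X S
    by (intro exI[of _ "\<lambda>n. c *\<^sub>R X n"]) (auto intro!: tendsto_intros subspace_mul)
  fix y assume "y \<in> closure S"
  then obtain Y where Y: "\<forall>n. Y n \<in> S" "Y \<longlonglongrightarrow> y" unfolding closure_sequential by blast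
  show "x + y \<in> closure S"
    unfolding closure_sequential using X Y S
    by (intro exI[of _ "\<lambda>n. X n + Y n"]) (auto intro!: tendsto_intros subspace_add)
qed

text \<open>The link between the real inner product of the L2 space and the sesquilinear
  integrands.\<close>

lemma inner_complex_Re: "inner a b = Re (a * cnj b)"
  by (simp add: inner_complex_def)

section \<open>Weak derivatives and Sobolev spaces on an open set\<close>

locale open_domain =
  fixes \<Omega> :: "(real^'n) set"
  assumes \<Omega>: "open \<Omega>"
begin

lemma lebesgue_\<Omega>: "\<Omega> \<in> sets lebesgue"
  using \<Omega> by (simp add: borel_open)

lemma sq_integrable_imp_locally_integrable:
  assumes f: "sq_integrable (lebesgue_on \<Omega>) f"
  shows "locally_integrable \<Omega> f"
  unfolding locally_integrable_def set_integrable_def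
proof (intro allI impI)
  fix K assume K: "compact K \<and> K \<subseteq> \<Omega>"
  let ?F = "\<lambda>x. if x \<in> \<Omega> then f x else 0"
  have F: "?F \<in> borel_measurable lebesgue" "integrable lebesgue (\<lambda>x. (norm (?F x))\<^sup>2)"
    using f sq_integrable_restrict_UNIV[OF lebesgue_\<Omega>, of f] by (auto simp: sq_integrable_def)
  have KL: "K \<in> lmeasurable" using K by (simp add: lmeasurable_compact)
  have eq: "indicator K x *\<^sub>R f x = indicator K x *\<^sub>R ?F x" for x
    using K by (auto simp: indicator_def)
  have "integrable lebesgue (\<lambda>x. indicator K x *\<^sub>R ?F x)"
  proof (rule Bochner_Integration.integrable_bound)
    show "integrable lebesgue (\<lambda>x. indicator K x + (norm (?F x))\<^sup>2)"
      using KL F(2) by (intro Bochner_Integration.integrable_add integrable_real_indicator)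
        (auto simp: fmeasurable_def)
    show "(\<lambda>x. indicator K x *\<^sub>R ?F x) \<in> borel_measurable lebesgue"
      using F(1) fmeasurableD[OF KL] by (intro borel_measurable_scaleR borel_measurable_indicator)
    have "norm (indicator K x *\<^sub>R ?F x) \<le> indicator K x + (norm (?F x))\<^sup>2" for x
      using sum_squares_bound[of "norm (f x)" 1] norm_ge_zero[of "f x"]
      by (auto simp: indicator_def) (smt (verit) zero_le_power2)+
    then show "AE x in lebesgue. norm (indicator K x *\<^sub>R ?F x) \<le> norm (indicator K x + (norm (?F x))\<^sup>2)"
      by (intro AE_I2) (auto intro: order_trans)
  qed
  then show "integrable lebesgue (\<lambda>x. indicator K x *\<^sub>R f x)" by (simp only: eq)
qed

lemma has_weak_partial_lincomb:
  assumes "has_weak_partial \<Omega> k u g" "has_weak_partial \<Omega> k u' g'"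
  shows "has_weak_partial \<Omega> k (\<lambda>x. c * u x + d * u' x) (\<lambda>x. c * g x + d * g' x)"
  unfolding has_weak_partial_def
proof (intro conjI ballI)
  have li: "locally_integrable \<Omega> u" "locally_integrable \<Omega> g" "locally_integrable \<Omega> u'" "locally_integrable \<Omega> g'"
    using assms by (auto simp: has_weak_partial_def)
  show "locally_integrable \<Omega> (\<lambda>x. c * u x + d * u' x)" "locally_integrable \<Omega> (\<lambda>x. c * g x + d * g' x)"
    using li by (auto intro: locally_integrable_lincomb)
  fix v assume v: "v \<in> test_functions \<Omega>"
  note int = integrable_locally_integrable_test[OF _ v lebesgue_\<Omega>]
    integrable_locally_integrable_test[OF _ test_partial[OF v] lebesgue_\<Omega>]
  have "(LINT x|lebesgue_on \<Omega>. (c * u x + d * u' x) * partial k v x)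
    = c * (LINT x|lebesgue_on \<Omega>. u x * partial k v x) + d * (LINT x|lebesgue_on \<Omega>. u' x * partial k v x)"
    using int(2)[OF li(1), of k] int(2)[OF li(3), of k] by (simp add: distrib_right mult.assoc)
  moreover have "(LINT x|lebesgue_on \<Omega>. (c * g x + d * g' x) * v x)
    = c * (LINT x|lebesgue_on \<Omega>. g x * v x) + d * (LINT x|lebesgue_on \<Omega>. g' x * v x)"
    using int(1)[OF li(2)] int(1)[OF li(4)] by (simp add: distrib_right mult.assoc)
  ultimately show "(LINT x|lebesgue_on \<Omega>. (c * u x + d * u' x) * partial k v x)
    = - (LINT x|lebesgue_on \<Omega>. (c * g x + d * g' x) * v x)"
    using assms v by (simp add: has_weak_partial_def)
qed

text \<open>The difference of the two derivatives annihilates all test functions. Allowing u and u'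
  to differ on a null set is needed because derivatives are chosen separately for each
  representative.\<close>

lemma has_weak_partial_unique:
  assumes "has_weak_partial \<Omega> k u g" "has_weak_partial \<Omega> k u' g'"
    and "AE x in lebesgue_on \<Omega>. u x = u' x"
  shows "AE x in lebesgue_on \<Omega>. g x = g' x"
proof -
  have *: "has_weak_partial \<Omega> k (\<lambda>x. 1 * u x + (-1) * u' x) (\<lambda>x. 1 * g x + (-1) * g' x)"
    using assms(1,2) by (rule has_weak_partial_lincomb)
  have "AE x in lebesgue_on \<Omega>. 1 * g x + (-1) * g' x = 0"
  proof (rule fundamental_lemma[OF _ \<Omega>])
    show "locally_integrable \<Omega> (\<lambda>x. 1 * g x + (-1) * g' x)" using * by (simp add: has_weak_partial_def)
    fix v assume v: "v \<in> test_functions \<Omega>"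
    have "(LINT x|lebesgue_on \<Omega>. (1 * u x + (-1) * u' x) * partial k v x) = 0"
      using assms(3) by (intro integral_eq_zero_AE) (auto elim: eventually_mono)
    then show "(LINT x|lebesgue_on \<Omega>. (1 * g x + (-1) * g' x) * v x) = 0"
      using * v unfolding has_weak_partial_def by simp
  qed
  then show ?thesis by (auto elim: eventually_mono)
qed

text \<open>Removes the choice in \<open>weak_partial\<close>: any derivative that is known
  explicitly agrees with the chosen one almost everywhere.\<close>

lemma weak_partial_eqI:
  assumes "has_weak_partial \<Omega> k u g" "AE x in lebesgue_on \<Omega>. u x = u' x" "has_weak_partial \<Omega> k u' g'"
  shows "AE x in lebesgue_on \<Omega>. weak_partial \<Omega> k u x = g' x"
proof -
  have "has_weak_partial \<Omega> k u (weak_partial \<Omega> k u)"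
    unfolding weak_partial_def using assms(1) by (rule someI[of "has_weak_partial \<Omega> k u"])
  then show ?thesis using assms(3,2) by (rule has_weak_partial_unique)
qed

lemma H1_D:
  assumes "u \<in> H1 \<Omega>"
  shows "sq_integrable (lebesgue_on \<Omega>) u"
    and "has_weak_partial \<Omega> k u (weak_partial \<Omega> k u)"
    and "sq_integrable (lebesgue_on \<Omega>) (weak_partial \<Omega> k u)"
proof -
  show "sq_integrable (lebesgue_on \<Omega>) u" using assms by (simp add: H1_def L2_iff)
  obtain g where g: "sq_integrable (lebesgue_on \<Omega>) g" "has_weak_partial \<Omega> k u g"
    using assms by (auto simp: H1_def L2_iff Bex_def)
  show "has_weak_partial \<Omega> k u (weak_partial \<Omega> k u)"
    unfolding weak_partial_def using g(2) by (rule someI[of "has_weak_partial \<Omega> k u"])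
  have "AE x in lebesgue_on \<Omega>. weak_partial \<Omega> k u x = g x"
    by (rule weak_partial_eqI[OF g(2) _ g(2)]) simp
  then show "sq_integrable (lebesgue_on \<Omega>) (weak_partial \<Omega> k u)"
    by (intro sq_integrable_lebesgue_on_AE[OF lebesgue_\<Omega> g(1)]) (auto elim: eventually_mono)
qed

lemma H1_I:
  assumes "sq_integrable (lebesgue_on \<Omega>) u"
    "\<And>k. sq_integrable (lebesgue_on \<Omega>) (g k)" "\<And>k. has_weak_partial \<Omega> k u (g k)"
  shows "u \<in> H1 \<Omega>"
  using assms by (auto simp: H1_def L2_iff Bex_def)

lemma H1_lincomb:
  assumes "u \<in> H1 \<Omega>" "w \<in> H1 \<Omega>"
  shows "(\<lambda>x. c * u x + d * w x) \<in> H1 \<Omega>"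
proof (rule H1_I)
  show "sq_integrable (lebesgue_on \<Omega>) (\<lambda>x. c * u x + d * w x)"
    using assms by (intro sq_integrable_lincomb H1_D(1))
  show "sq_integrable (lebesgue_on \<Omega>) (\<lambda>x. c * weak_partial \<Omega> k u x + d * weak_partial \<Omega> k w x)" for k
    using assms by (intro sq_integrable_lincomb H1_D(3))
  show "has_weak_partial \<Omega> k (\<lambda>x. c * u x + d * w x)
      (\<lambda>x. c * weak_partial \<Omega> k u x + d * weak_partial \<Omega> k w x)" for k
    using assms by (intro has_weak_partial_lincomb H1_D(2))
qed

lemma H1_diff: "u \<in> H1 \<Omega> \<Longrightarrow> w \<in> H1 \<Omega> \<Longrightarrow> (\<lambda>x. u x - w x) \<in> H1 \<Omega>"
  using H1_lincomb[of u w 1 "-1"] by simp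

lemma test_sq_integrable:
  assumes "v \<in> test_functions \<Omega>"
  shows "sq_integrable (lebesgue_on \<Omega>) v"
proof -
  have "sq_integrable lebesgue v" using assms
    by (intro sq_integrable_continuous_compact_supp test_continuous) (auto simp: test_functions_iff)
  moreover have "(\<lambda>x. if x \<in> \<Omega> then v x else 0) = v" using test_zero_outside[OF assms] by auto
  ultimately show ?thesis using sq_integrable_restrict_UNIV[OF lebesgue_\<Omega>, of v] by simp
qed

lemma test_has_weak_partial:
  assumes "v \<in> test_functions \<Omega>"
  shows "has_weak_partial \<Omega> k v (partial k v)"
  unfolding has_weak_partial_def
  using assms test_sq_integrable sq_integrable_imp_locally_integrable
    integration_by_parts_test[OF assms _ lebesgue_\<Omega>]
  by (auto simp: test_partial)

lemma test_H1: "v \<in> test_functions \<Omega> \<Longrightarrow> v \<in> H1 \<Omega>"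
  by (intro H1_I[of _ "\<lambda>k. partial k v"] test_sq_integrable test_partial test_has_weak_partial)

text \<open>
  Extension by zero lets the functions on \<open>\<Omega>\<close> and their gradients live in a type that does
  not depend on \<open>\<Omega>\<close>.
\<close>

definition ext_pair :: "(real^'n \<Rightarrow> complex) \<Rightarrow> ('n \<Rightarrow> real^'n \<Rightarrow> complex) \<Rightarrow> real^'n \<Rightarrow> complex \<times> (complex^'n)"
  where "ext_pair w G x = (if x \<in> \<Omega> then (w x, \<chi> k. G k x) else 0)"

lemma sq_integrable_ext_pair:
  assumes "sq_integrable (lebesgue_on \<Omega>) w" "\<And>k. sq_integrable (lebesgue_on \<Omega>) (G k)"
  shows "sq_integrable lebesgue (ext_pair w G)"
proof -
  have "sq_integrable (lebesgue_on \<Omega>) (\<lambda>x. (w x, \<chi> k. G k x))"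
    unfolding sq_integrable_def
  proof
    show "(\<lambda>x. (w x, \<chi> k. G k x)) \<in> borel_measurable (lebesgue_on \<Omega>)"
      using assms by (intro borel_measurable_Pair borel_measurable_vecI) (auto simp: sq_integrable_def)
    have "integrable (lebesgue_on \<Omega>) (\<lambda>x. (norm (w x))\<^sup>2 + (\<Sum>k\<in>UNIV. (norm (G k x))\<^sup>2))"
      using assms by (auto simp: sq_integrable_def)
    then show "integrable (lebesgue_on \<Omega>) (\<lambda>x. (norm (w x, \<chi> k. G k x))\<^sup>2)"
      by (simp add: norm_Pair norm_vec_def L2_set_def sum_nonneg)
  qed
  then show ?thesis
    using sq_integrable_restrict_UNIV[OF lebesgue_\<Omega>, of "\<lambda>x. (w x, \<chi> k. G k x)"]
    by (simp add: ext_pair_def[abs_def])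
qed

lemma inner_ext_pair_test_field:
  assumes w: "sq_integrable (lebesgue_on \<Omega>) w" "\<And>k. sq_integrable (lebesgue_on \<Omega>) (G k)"
    and v: "v \<in> test_functions \<Omega>"
  shows "inner (l2_class (ext_pair w G)) (l2_class (test_field k v))
    = Re ((LINT x|lebesgue_on \<Omega>. w x * partial k v x) + (LINT x|lebesgue_on \<Omega>. G k x * v x))"
proof -
  have int: "integrable (lebesgue_on \<Omega>) (\<lambda>x. w x * partial k v x)" "integrable (lebesgue_on \<Omega>) (\<lambda>x. G k x * v x)"
    using integrable_locally_integrable_test[OF sq_integrable_imp_locally_integrable[OF w(1)] test_partial[OF v] lebesgue_\<Omega>]
      integrable_locally_integrable_test[OF sq_integrable_imp_locally_integrable[OF w(2)] v lebesgue_\<Omega>] by auto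
  have pt: "inner (ext_pair w G x) (test_field k v x)
      = (if x \<in> \<Omega> then Re (w x * partial k v x + G k x * v x) else 0)" for x
    by (simp add: ext_pair_def test_field_def inner_axis inner_complex_Re)
  have "inner (l2_class (ext_pair w G)) (l2_class (test_field k v))
    = (LINT x|lebesgue. inner (ext_pair w G x) (test_field k v x))"
    by (intro inner_l2_class sq_integrable_ext_pair w sq_integrable_test_field[OF v])
  also have "\<dots> = (LINT x|lebesgue_on \<Omega>. Re (w x * partial k v x + G k x * v x))"
    unfolding pt by (rule Lebesgue_Measure.integral_restrict_UNIV[OF lebesgue_\<Omega>])
  also have "\<dots> = Re (LINT x|lebesgue_on \<Omega>. w x * partial k v x + G k x * v x)"
    using int by (intro integral_Re Bochner_Integration.integrable_add)
  finally show ?thesis using int by simp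
qed

text \<open>Real parts suffice, because \<open>v\<close> may be multiplied by a complex constant.\<close>

lemma has_weak_partial_iff_orthogonal:
  assumes w: "sq_integrable (lebesgue_on \<Omega>) w" "\<And>k. sq_integrable (lebesgue_on \<Omega>) (G k)"
  shows "has_weak_partial \<Omega> k w (G k) \<longleftrightarrow>
    (\<forall>v\<in>test_functions \<Omega>. inner (l2_class (ext_pair w G)) (l2_class (test_field k v)) = 0)"
    (is "_ \<longleftrightarrow> ?orth")
proof
  assume "has_weak_partial \<Omega> k w (G k)"
  then show ?orth
    using inner_ext_pair_test_field[OF w] by (auto simp: has_weak_partial_def)
next
  assume orth: ?orth
  have "(LINT x|lebesgue_on \<Omega>. w x * partial k v x) = - (LINT x|lebesgue_on \<Omega>. G k x * v x)"
    if v: "v \<in> test_functions \<Omega>" for v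
  proof -
    define z where "z = (LINT x|lebesgue_on \<Omega>. w x * partial k v x) + (LINT x|lebesgue_on \<Omega>. G k x * v x)"
    have iv: "(\<lambda>x. - \<i> * v x) \<in> test_functions \<Omega>" by (rule test_cmult[OF v])
    have "partial k (\<lambda>x. - \<i> * v x) = (\<lambda>x. - \<i> * partial k v x)"
      using partial_cmult[OF test_differentiable[OF v]] by blast
    then have "(LINT x|lebesgue_on \<Omega>. w x * partial k (\<lambda>x. - \<i> * v x) x) + (LINT x|lebesgue_on \<Omega>. G k x * (- \<i> * v x)) = - \<i> * z"
      by (simp add: z_def mult.left_commute[of _ \<i>] distrib_left)
    then have "Re (- \<i> * z) = 0" using orth iv inner_ext_pair_test_field[of w G _ k, OF w iv] by simp
    moreover have "Re z = 0" using orth v inner_ext_pair_test_field[of w G _ k, OF w v] by (simp add: z_def)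
    ultimately have "z = 0" by (simp add: complex_eq_iff)
    then show ?thesis by (simp add: z_def add_eq_0_iff2)
  qed
  then show "has_weak_partial \<Omega> k w (G k)"
    using w by (auto simp: has_weak_partial_def intro: sq_integrable_imp_locally_integrable)
qed

text \<open>The isometric model of H^1. Carrying the gradient along makes the L2 norm of a jet the
  H^1 norm of the function.\<close>

definition jet :: "(real^'n \<Rightarrow> complex) \<Rightarrow> (real^'n, complex \<times> (complex^'n)) l2"
  where "jet u = l2_class (ext_pair u (\<lambda>k. weak_partial \<Omega> k u))"

lemma sq_integrable_jet:
  "u \<in> H1 \<Omega> \<Longrightarrow> sq_integrable lebesgue (ext_pair u (\<lambda>k. weak_partial \<Omega> k u))"
  by (intro sq_integrable_ext_pair H1_D)

lemma jet_eqI: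
  assumes u: "u \<in> H1 \<Omega>" and f: "sq_integrable lebesgue f"
    and "AE x in lebesgue_on \<Omega>. fst (f x) = u x" "\<And>k. AE x in lebesgue_on \<Omega>. weak_partial \<Omega> k u x = snd (f x) $ k"
    and "AE x in lebesgue. x \<notin> \<Omega> \<longrightarrow> f x = 0"
  shows "jet u = l2_class f"
  unfolding jet_def
proof (subst l2_class_eq_iff[OF sq_integrable_jet[OF u] f])
  have "AE x in lebesgue_on \<Omega>. \<forall>k\<in>UNIV. weak_partial \<Omega> k u x = snd (f x) $ k"
    using assms(4) by (intro AE_finite_allI) auto
  then have "AE x in lebesgue. x \<in> \<Omega> \<longrightarrow> (\<forall>k\<in>UNIV. weak_partial \<Omega> k u x = snd (f x) $ k)"
    using lebesgue_\<Omega> by (simp add: AE_lebesgue_on_iff)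
  moreover have "AE x in lebesgue. x \<in> \<Omega> \<longrightarrow> fst (f x) = u x"
    using assms(3) lebesgue_\<Omega> by (simp add: AE_lebesgue_on_iff)
  ultimately show "AE x in lebesgue. ext_pair u (\<lambda>k. weak_partial \<Omega> k u) x = f x"
    using assms(5) by eventually_elim (auto simp: ext_pair_def prod_eq_iff vec_eq_iff)
qed

lemma jet_eq_ext_pair:
  assumes u: "u \<in> H1 \<Omega>" and g: "\<And>k. has_weak_partial \<Omega> k u (g k)" "\<And>k. sq_integrable (lebesgue_on \<Omega>) (g k)"
  shows "jet u = l2_class (ext_pair u g)"
proof (rule jet_eqI[OF u])
  show "sq_integrable lebesgue (ext_pair u g)" by (intro sq_integrable_ext_pair g H1_D u)
  have space: "AE x in lebesgue_on \<Omega>. x \<in> \<Omega>" using lebesgue_\<Omega> by (simp add: AE_lebesgue_on_iff)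
  then show "AE x in lebesgue_on \<Omega>. fst (ext_pair u g x) = u x"
    by eventually_elim (simp add: ext_pair_def)
  show "AE x in lebesgue_on \<Omega>. weak_partial \<Omega> k u x = snd (ext_pair u g x) $ k" for k
    using weak_partial_eqI[OF g(1) _ g(1), of k] space by (auto simp: ext_pair_def elim: eventually_elim2)
qed (simp add: ext_pair_def)

lemma jet_lincomb:
  assumes u: "u \<in> H1 \<Omega>" "w \<in> H1 \<Omega>"
  shows "jet (\<lambda>x. of_real c * u x + of_real d * w x) = c *\<^sub>R jet u + d *\<^sub>R jet w"
proof -
  let ?U = "ext_pair u (\<lambda>k. weak_partial \<Omega> k u)" and ?W = "ext_pair w (\<lambda>k. weak_partial \<Omega> k w)"
  have "jet (\<lambda>x. of_real c * u x + of_real d * w x) =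
      l2_class (ext_pair (\<lambda>x. of_real c * u x + of_real d * w x)
        (\<lambda>k x. of_real c * weak_partial \<Omega> k u x + of_real d * weak_partial \<Omega> k w x))"
    using u by (intro jet_eq_ext_pair H1_lincomb has_weak_partial_lincomb sq_integrable_lincomb H1_D)
  also have "ext_pair (\<lambda>x. of_real c * u x + of_real d * w x)
        (\<lambda>k x. of_real c * weak_partial \<Omega> k u x + of_real d * weak_partial \<Omega> k w x) = (\<lambda>x. c *\<^sub>R ?U x + d *\<^sub>R ?W x)"
    by (auto simp: ext_pair_def fun_eq_iff vec_eq_iff scaleR_conv_of_real[where 'a=complex])
  also have "l2_class \<dots> = c *\<^sub>R jet u + d *\<^sub>R jet w"
    using sq_integrable_jet[OF u(1)] sq_integrable_jet[OF u(2)]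
    by (simp add: jet_def l2_class_scaleR l2_class_add sq_integrable_scaleR)
  finally show ?thesis .
qed

lemma jet_diff: "u \<in> H1 \<Omega> \<Longrightarrow> w \<in> H1 \<Omega> \<Longrightarrow> jet (\<lambda>x. u x - w x) = jet u - jet w"
  using jet_lincomb[of u w 1 "-1"] by simp

lemma jet_test:
  assumes "v \<in> test_functions \<Omega>"
  shows "jet v = l2_class (\<lambda>x. (v x, \<chi> k. partial k v x))"
proof -
  have "jet v = l2_class (ext_pair v (\<lambda>k. partial k v))"
    using assms by (intro jet_eq_ext_pair test_H1 test_has_weak_partial test_sq_integrable test_partial)
  also have "ext_pair v (\<lambda>k. partial k v) = (\<lambda>x. (v x, \<chi> k. partial k v x))"
    using test_zero_outside[OF assms] test_zero_outside[OF test_partial[OF assms]]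
    by (auto simp: ext_pair_def fun_eq_iff zero_prod_def vec_eq_iff)
  finally show ?thesis .
qed

lemma norm_jet:
  assumes u: "u \<in> H1 \<Omega>"
  shows "norm (jet u) = H1_norm \<Omega> u"
proof -
  have int: "integrable (lebesgue_on \<Omega>) (\<lambda>x. (norm (u x))\<^sup>2)"
    "\<And>k. integrable (lebesgue_on \<Omega>) (\<lambda>x. (norm (weak_partial \<Omega> k u x))\<^sup>2)"
    using H1_D[OF u] by (auto simp: sq_integrable_def)
  have "(norm (jet u))\<^sup>2 = (LINT x|lebesgue. (norm (ext_pair u (\<lambda>k. weak_partial \<Omega> k u) x))\<^sup>2)"
    unfolding jet_def by (rule norm_l2_class[OF sq_integrable_jet[OF u]])
  also have "\<dots> = (LINT x|lebesgue. (if x \<in> \<Omega> then (norm (u x))\<^sup>2 + (\<Sum>k\<in>UNIV. (norm (weak_partial \<Omega> k u x))\<^sup>2) else 0))"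
    by (intro Bochner_Integration.integral_cong)
       (auto simp: ext_pair_def norm_Pair norm_vec_def L2_set_def sum_nonneg)
  also have "\<dots> = (LINT x|lebesgue_on \<Omega>. (norm (u x))\<^sup>2 + (\<Sum>k\<in>UNIV. (norm (weak_partial \<Omega> k u x))\<^sup>2))"
    by (rule Lebesgue_Measure.integral_restrict_UNIV[OF lebesgue_\<Omega>])
  also have "\<dots> = (LINT x|lebesgue_on \<Omega>. (norm (u x))\<^sup>2) + (\<Sum>k\<in>UNIV. LINT x|lebesgue_on \<Omega>. (norm (weak_partial \<Omega> k u x))\<^sup>2)"
    using int by (subst Bochner_Integration.integral_add) auto
  also have "\<dots> = (L2_norm (lebesgue_on \<Omega>) u)\<^sup>2 + (\<Sum>k\<in>UNIV. (L2_norm (lebesgue_on \<Omega>) (weak_partial \<Omega> k u))\<^sup>2)"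
    by (simp add: L2_norm_def)
  finally show ?thesis unfolding H1_norm_def by (metis norm_ge_zero real_sqrt_unique)
qed

text \<open>Translates between vanishing almost everywhere and being zero in the Hilbert space. The
  converse direction also needs the chosen gradient of such a function to vanish, which is
  uniqueness of weak derivatives.\<close>

lemma jet_eq_0_iff:
  assumes u: "u \<in> H1 \<Omega>"
  shows "jet u = 0 \<longleftrightarrow> ae_eq (lebesgue_on \<Omega>) u (\<lambda>x. 0)"
proof
  assume "jet u = 0"
  moreover have "(0 :: (real^'n, complex \<times> (complex^'n)) l2) = l2_class (\<lambda>x. 0)"
    using l2_class_scaleR[of "\<lambda>x::real^'n. 0 :: complex \<times> (complex^'n)" 0] by simp
  ultimately have "AE x in lebesgue. ext_pair u (\<lambda>k. weak_partial \<Omega> k u) x = 0"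
    using l2_class_eq_iff[OF sq_integrable_jet[OF u] sq_integrable_zero] by (simp add: jet_def)
  then have "AE x in lebesgue. x \<in> \<Omega> \<longrightarrow> u x = 0"
    by eventually_elim (auto simp: ext_pair_def zero_prod_def)
  then show "ae_eq (lebesgue_on \<Omega>) u (\<lambda>x. 0)" using lebesgue_\<Omega> by (simp add: ae_eq_def AE_lebesgue_on_iff)
next
  assume ae: "ae_eq (lebesgue_on \<Omega>) u (\<lambda>x. 0)"
  have z: "(\<lambda>x. 0) \<in> test_functions \<Omega>" by (rule test_zero)
  have "partial k (\<lambda>x::real^'n. 0) = (\<lambda>x. 0)" for k
    using partial_eqI[OF has_derivative_const, of k] by (intro ext) simp
  then have "has_weak_partial \<Omega> k (\<lambda>x. 0) (\<lambda>x. 0)" for k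
    using test_has_weak_partial[OF z, of k] by simp
  then have "AE x in lebesgue_on \<Omega>. weak_partial \<Omega> k u x = 0" for k
    using weak_partial_eqI[OF H1_D(2)[OF u]] ae by (auto simp: ae_eq_def)
  then have "jet u = l2_class (\<lambda>x. 0)"
    using ae by (intro jet_eqI u) (auto simp: ae_eq_def elim: eventually_mono)
  also have "\<dots> = 0"
    using l2_class_scaleR[of "\<lambda>x::real^'n. 0 :: complex \<times> (complex^'n)" 0] by simp
  finally show "jet u = 0" .
qed

lemma ae_zero_H1:
  assumes "ae_eq (lebesgue_on \<Omega>) u (\<lambda>x. 0)"
  shows "u \<in> H1 \<Omega>"
proof -
  have "AE x in lebesgue_on \<Omega>. 0 = u x" using assms by (auto simp: ae_eq_def elim: eventually_mono)
  then have su: "sq_integrable (lebesgue_on \<Omega>) u"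
    by (rule sq_integrable_lebesgue_on_AE[OF lebesgue_\<Omega> sq_integrable_zero])
  have "has_weak_partial \<Omega> k u (\<lambda>x. 0)" for k
    unfolding has_weak_partial_def
  proof (intro conjI ballI sq_integrable_imp_locally_integrable su sq_integrable_zero)
    fix v
    have "(LINT x|lebesgue_on \<Omega>. u x * partial k v x) = 0"
      using assms by (intro integral_eq_zero_AE) (auto simp: ae_eq_def elim: eventually_mono)
    then show "(LINT x|lebesgue_on \<Omega>. u x * partial k v x) = - (LINT x|lebesgue_on \<Omega>. 0 * v x)" by simp
  qed
  then show ?thesis by (intro H1_I[of _ "\<lambda>k x. 0"] su sq_integrable_zero)
qed

text \<open>The model of H^1_0. As a closure in a complete space it is complete by construction;
  that no element is lost, each being the jet of an actual function, is
  \<open>jet0_representative\<close>.\<close>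

definition jet0 :: "(real^'n, complex \<times> (complex^'n)) l2 set"
  where "jet0 = closure (jet ` test_functions \<Omega>)"

lemma complete_jet0: "complete jet0"
  by (simp add: jet0_def complete_eq_closed)

lemma subspace_jet0: "subspace jet0"
  unfolding jet0_def
proof (rule subspace_closure)
  show "subspace (jet ` test_functions \<Omega>)"
    unfolding subspace_def
  proof (intro conjI ballI allI)
    have "jet (\<lambda>x. 0) = 0" using jet_eq_0_iff[OF test_H1[OF test_zero]] by (simp add: ae_eq_def)
    then show "0 \<in> jet ` test_functions \<Omega>" using test_zero by (metis image_eqI)
    fix x assume "x \<in> jet ` test_functions \<Omega>"
    then obtain u where u: "u \<in> test_functions \<Omega>" "x = jet u" by blast
    show "c *\<^sub>R x \<in> jet ` test_functions \<Omega>" for c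
      using jet_lincomb[OF test_H1[OF u(1)] test_H1[OF u(1)], of c 0] test_cmult[OF u(1), of "of_real c"] u(2)
      by (auto intro: rev_image_eqI)
    fix y assume "y \<in> jet ` test_functions \<Omega>"
    then obtain v where v: "v \<in> test_functions \<Omega>" "y = jet v" by blast
    show "x + y \<in> jet ` test_functions \<Omega>"
      using jet_lincomb[OF test_H1[OF u(1)] test_H1[OF v(1)], of 1 1] test_add[OF u(1) v(1)] u(2) v(2)
      by (auto intro: rev_image_eqI)
  qed
qed

lemma H1_0_iff: "u \<in> H1_0 \<Omega> \<longleftrightarrow> u \<in> H1 \<Omega> \<and> jet u \<in> jet0"
proof -
  have "(\<exists>v. (\<forall>n. v n \<in> test_functions \<Omega>) \<and> (\<lambda>n. H1_norm \<Omega> (\<lambda>x. v n x - u x)) \<longlonglongrightarrow> 0) \<longleftrightarrow> jet u \<in> jet0"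
    if u: "u \<in> H1 \<Omega>"
  proof -
    have eq: "H1_norm \<Omega> (\<lambda>x. v x - u x) = dist (jet v) (jet u)" if "v \<in> test_functions \<Omega>" for v
      using norm_jet[OF H1_diff[OF test_H1[OF that] u]] jet_diff[OF test_H1[OF that] u] by (simp add: dist_norm)
    show ?thesis
    proof
      assume "\<exists>v. (\<forall>n. v n \<in> test_functions \<Omega>) \<and> (\<lambda>n. H1_norm \<Omega> (\<lambda>x. v n x - u x)) \<longlonglongrightarrow> 0"
      then obtain v where v: "\<And>n. v n \<in> test_functions \<Omega>" "(\<lambda>n. H1_norm \<Omega> (\<lambda>x. v n x - u x)) \<longlonglongrightarrow> 0" by blast
      then have "(\<lambda>n. dist (jet (v n)) (jet u)) \<longlonglongrightarrow> 0" by (simp add: eq)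
      then have "(\<lambda>n. jet (v n)) \<longlonglongrightarrow> jet u" by (rule tendsto_dist_iff[THEN iffD2])
      moreover have "jet (v n) \<in> jet ` test_functions \<Omega>" for n using v(1) by blast
      ultimately show "jet u \<in> jet0"
        unfolding jet0_def closure_sequential by (intro exI[of _ "\<lambda>n. jet (v n)"]) simp
    next
      assume "jet u \<in> jet0"
      then obtain X where X: "\<And>n. X n \<in> jet ` test_functions \<Omega>" "X \<longlonglongrightarrow> jet u"
        unfolding jet0_def closure_sequential by blast
      have "\<forall>n. \<exists>v. v \<in> test_functions \<Omega> \<and> X n = jet v" using X(1) by blast
      then obtain v where "\<forall>n. v n \<in> test_functions \<Omega> \<and> X n = jet (v n)" by (rule choice[THEN exE])
      then have v: "\<And>n. v n \<in> test_functions \<Omega>" "\<And>n. X n = jet (v n)" by auto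
      have "(\<lambda>n. dist (X n) (jet u)) \<longlonglongrightarrow> 0" using X(2) tendsto_dist_iff by blast
      then have "(\<lambda>n. H1_norm \<Omega> (\<lambda>x. v n x - u x)) \<longlonglongrightarrow> 0" using v by (simp add: eq)
      then show "\<exists>v. (\<forall>n. v n \<in> test_functions \<Omega>) \<and> (\<lambda>n. H1_norm \<Omega> (\<lambda>x. v n x - u x)) \<longlonglongrightarrow> 0"
        using v(1) by blast
    qed
  qed
  then show ?thesis by (auto simp: H1_0_def)
qed

lemma jet_orthogonal_test_field:
  assumes "u \<in> H1 \<Omega>" "v \<in> test_functions \<Omega>"
  shows "inner (jet u) (l2_class (test_field k v)) = 0"
  using has_weak_partial_iff_orthogonal[of u "\<lambda>k. weak_partial \<Omega> k u" k] H1_D[OF assms(1)] assms(2)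
  by (simp add: jet_def)

text \<open>Density argument: closed conditions and inequalities need to be verified for test
  functions only.\<close>

lemma jet0_induct_closed:
  assumes W: "W \<in> jet0" and P: "closed {U. P U}" "\<And>v. v \<in> test_functions \<Omega> \<Longrightarrow> P (jet v)"
  shows "P W"
  using closure_minimal[OF _ P(1), of "jet ` test_functions \<Omega>"] W P(2) by (auto simp: jet0_def)

text \<open>Being a jet consists of two conditions on a pair: it vanishes outside the domain, and
  its second part is the weak gradient of the first. Both are orthogonality relations, hence survive
  in the closure.\<close>

lemma jet0_representative:
  assumes W: "W \<in> jet0"
  obtains w where "w \<in> H1_0 \<Omega>" "jet w = W"
proof -
  define f where "f = l2_fun W"
  have f: "sq_integrable lebesgue f" "W = l2_class f"
    by (simp_all add: f_def sq_integrable_l2_fun l2_class_fun)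
  have fb: "f \<in> borel_measurable lebesgue" using f(1) by (simp add: sq_integrable_def)
  \<comment> \<open>The part of f outside the domain. It is orthogonal to every jet, hence to W,
    while its inner product with W is its own squared norm.\<close>
  define Z where "Z = (\<lambda>x. if x \<in> \<Omega> then 0 else f x)"
  have Z: "sq_integrable lebesgue Z"
  proof (rule sq_integrable_bound)
    show "integrable lebesgue (\<lambda>x. (norm (f x))\<^sup>2)" using f(1) by (simp add: sq_integrable_def)
    show "Z \<in> borel_measurable lebesgue"
      unfolding Z_def using fb lebesgue_\<Omega> by (intro measurable_If_set) auto
  qed (simp add: Z_def)
  have "inner W (l2_class Z) = 0"
  proof (rule jet0_induct_closed[OF W])
    show "closed {U. inner U (l2_class Z) = 0}" by (intro closed_Collect_eq continuous_intros)
    fix v assume v: "v \<in> test_functions \<Omega>"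
    have "inner (jet v) (l2_class Z) = (LINT x|lebesgue. inner (ext_pair v (\<lambda>k. weak_partial \<Omega> k v) x) (Z x))"
      unfolding jet_def by (intro inner_l2_class sq_integrable_jet test_H1 v Z)
    moreover have "inner (ext_pair v (\<lambda>k. weak_partial \<Omega> k v) x) (Z x) = 0" for x
      by (simp add: ext_pair_def Z_def)
    ultimately show "inner (jet v) (l2_class Z) = 0" by simp
  qed
  then have "(LINT x|lebesgue. inner (f x) (Z x)) = 0" using f Z by (simp add: inner_l2_class)
  moreover have "inner (f x) (Z x) = (norm (Z x))\<^sup>2" for x by (simp add: Z_def power2_norm_eq_inner)
  ultimately have "(norm (l2_class Z))\<^sup>2 = 0" by (simp add: norm_l2_class[OF Z])
  then have "AE x in lebesgue. Z x = 0"
    using integral_nonneg_eq_0_iff_AE[OF sq_integrable_norm[OF Z]] norm_l2_class[OF Z] by simp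
  then have out: "AE x in lebesgue. x \<notin> \<Omega> \<longrightarrow> f x = 0"
    by eventually_elim (auto simp: Z_def)
  define w where "w = (\<lambda>x. fst (f x))"
  define G where "G = (\<lambda>k x. snd (f x) $ k)"
  have f_on: "f \<in> borel_measurable (lebesgue_on \<Omega>)" using fb by (rule measurable_restrict_space1)
  have fi: "integrable (lebesgue_on \<Omega>) (\<lambda>x. (norm (f x))\<^sup>2)"
    using integrable_mult_indicator[OF lebesgue_\<Omega> sq_integrable_norm[OF f(1)]] lebesgue_\<Omega>
    by (simp add: integrable_restrict_space)
  have nle: "norm (fst p) \<le> norm p" "norm (snd p $ k) \<le> norm p" for p :: "complex \<times> (complex^'n)" and k
    using norm_fst_le[of "fst p" "snd p"] norm_snd_le[of "snd p" "fst p"] Finite_Cartesian_Product.norm_nth_le[of "snd p" k]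
    by auto
  have w: "sq_integrable (lebesgue_on \<Omega>) w"
    unfolding w_def
    by (rule sq_integrable_bound[OF _ fi]) (use f_on in \<open>auto intro!: power_mono nle measurable_compose[OF f_on] borel_measurable_continuous continuous_intros\<close>)
  have G: "sq_integrable (lebesgue_on \<Omega>) (G k)" for k
    unfolding G_def
    by (rule sq_integrable_bound[OF _ fi]) (use f_on in \<open>auto intro!: power_mono nle measurable_compose[OF f_on] borel_measurable_continuous continuous_intros\<close>)
  have fw: "W = l2_class (ext_pair w G)"
    unfolding f(2)
  proof (subst l2_class_eq_iff)
    show "AE x in lebesgue. f x = ext_pair w G x"
      using out by eventually_elim (auto simp: ext_pair_def w_def G_def)
  qed (use f sq_integrable_ext_pair w G in auto)
  \<comment> \<open>The relation passes from jets of test functions to W because orthogonality to a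
    fixed test field is a closed condition.\<close>
  have wp: "has_weak_partial \<Omega> k w (G k)" for k
  proof (subst has_weak_partial_iff_orthogonal[OF w G], intro ballI)
    fix v assume v: "v \<in> test_functions \<Omega>"
    show "inner (l2_class (ext_pair w G)) (l2_class (test_field k v)) = 0"
      unfolding fw[symmetric]
      by (rule jet0_induct_closed[OF W])
         (auto intro!: closed_Collect_eq continuous_intros jet_orthogonal_test_field test_H1 v)
  qed
  have wH: "w \<in> H1 \<Omega>" by (intro H1_I[of _ G] w G wp)
  have "jet w = W" unfolding fw by (intro jet_eq_ext_pair wH wp G)
  then show thesis using that[of w] wH W by (simp add: H1_0_iff)
qed

end

section \<open>The elliptic operator\<close>

lemma integrable_bounded_mult_cnj:
  fixes h f g :: "'a \<Rightarrow> complex"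
  assumes h: "h \<in> borel_measurable M" "\<And>x. x \<in> space M \<Longrightarrow> norm (h x) \<le> A"
    and f: "sq_integrable M f" and g: "sq_integrable M g"
  shows "integrable M (\<lambda>x. h x * f x * cnj (g x))"
proof (rule Bochner_Integration.integrable_bound)
  show "integrable M (\<lambda>x. A * ((norm (f x))\<^sup>2 + (norm (g x))\<^sup>2))"
    using f g by (auto simp: sq_integrable_def)
  have "(\<lambda>x. cnj (g x)) \<in> borel_measurable M"
    using g by (intro measurable_compose[of g M borel cnj]) (auto simp: sq_integrable_def intro: continuous_intros)
  then show "(\<lambda>x. h x * f x * cnj (g x)) \<in> borel_measurable M"
    using h f by (auto simp: sq_integrable_def)
  show "AE x in M. norm (h x * f x * cnj (g x)) \<le> norm (A * ((norm (f x))\<^sup>2 + (norm (g x))\<^sup>2))"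
  proof (rule AE_I2)
    fix x assume x: "x \<in> space M"
    have A: "0 \<le> A" using h(2)[OF x] norm_ge_zero order_trans by blast
    have "norm (f x) * norm (g x) \<le> (norm (f x))\<^sup>2 + (norm (g x))\<^sup>2"
      using sum_squares_bound[of "norm (f x)" "norm (g x)"] mult_nonneg_nonneg[OF norm_ge_zero[of "f x"] norm_ge_zero[of "g x"]]
      by linarith
    then have "norm (h x) * (norm (f x) * norm (g x)) \<le> A * ((norm (f x))\<^sup>2 + (norm (g x))\<^sup>2)"
      using h(2)[OF x] A by (intro mult_mono) auto
    then show "norm (h x * f x * cnj (g x)) \<le> norm (A * ((norm (f x))\<^sup>2 + (norm (g x))\<^sup>2))"
      using A by (simp add: norm_mult mult.assoc)
  qed
qed

locale elliptic_problem = open_domain \<Omega> for \<Omega> :: "(real^'n) set" +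
  fixes a :: "'n \<Rightarrow> 'n \<Rightarrow> real^'n \<Rightarrow> real"
    and b :: "'n \<Rightarrow> real^'n \<Rightarrow> complex"
    and c :: "'n \<Rightarrow> real^'n \<Rightarrow> real"
    and c0 :: "real^'n \<Rightarrow> complex"
    and \<mu> :: real
  assumes bounded_domain: "bounded \<Omega>"
    and a: "\<And>k l. a k l \<in> borel_measurable (lebesgue_on \<Omega>)" "\<And>k l. bounded (a k l ` \<Omega>)"
    and b: "\<And>k. b k \<in> borel_measurable (lebesgue_on \<Omega>)" "\<And>k. bounded (b k ` \<Omega>)"
    and c: "\<And>k. c k \<in> borel_measurable (lebesgue_on \<Omega>)" "\<And>k. bounded (c k ` \<Omega>)"
    and c0: "c0 \<in> borel_measurable (lebesgue_on \<Omega>)" "bounded (c0 ` \<Omega>)"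
    and mu: "0 < \<mu>"
    and elliptic: "\<And>x (\<xi> :: complex^'n). x \<in> \<Omega> \<Longrightarrow>
        Re (\<Sum>k\<in>UNIV. \<Sum>l\<in>UNIV. of_real (a k l x) * \<xi> $ k * cnj (\<xi> $ l)) \<ge> \<mu> * (norm \<xi>)\<^sup>2"
begin

section \<open>The coefficients as a bounded operator\<close>

lemma coefficient_bound:
  obtains A where "A \<ge> 0" "\<And>x k l. x \<in> \<Omega> \<Longrightarrow> \<bar>a k l x\<bar> \<le> A" "\<And>x k. x \<in> \<Omega> \<Longrightarrow> norm (b k x) \<le> A"
    "\<And>x k. x \<in> \<Omega> \<Longrightarrow> \<bar>c k x\<bar> \<le> A" "\<And>x. x \<in> \<Omega> \<Longrightarrow> norm (c0 x) \<le> A"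
proof -
  have "\<exists>B. \<forall>x\<in>\<Omega>. \<bar>a k l x\<bar> \<le> B" for k l using a(2)[of k l] by (auto simp: bounded_iff)
  then obtain Ba where Ba: "\<And>k l x. x \<in> \<Omega> \<Longrightarrow> \<bar>a k l x\<bar> \<le> Ba k l" by metis
  have "\<exists>B. \<forall>x\<in>\<Omega>. norm (b k x) \<le> B" for k using b(2)[of k] by (auto simp: bounded_iff)
  then obtain Bb where Bb: "\<And>k x. x \<in> \<Omega> \<Longrightarrow> norm (b k x) \<le> Bb k" by metis
  have "\<exists>B. \<forall>x\<in>\<Omega>. \<bar>c k x\<bar> \<le> B" for k using c(2)[of k] by (auto simp: bounded_iff)
  then obtain Bc where Bc: "\<And>k x. x \<in> \<Omega> \<Longrightarrow> \<bar>c k x\<bar> \<le> Bc k" by metis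
  obtain B0 where B0: "\<And>x. x \<in> \<Omega> \<Longrightarrow> norm (c0 x) \<le> B0" using c0(2) by (auto simp: bounded_iff)
  define F where "F = insert 0 (insert B0 (range Bb \<union> range Bc \<union> range (\<lambda>(k, l). Ba k l)))"
  have F: "finite F" by (simp add: F_def)
  have le: "z \<in> F \<Longrightarrow> z \<le> Max F" for z using F by (rule Max_ge)
  show thesis
  proof (rule that[of "Max F"])
    show "0 \<le> Max F" by (rule le) (simp add: F_def)
    fix x assume x: "x \<in> \<Omega>"
    show "\<bar>a k l x\<bar> \<le> Max F" for k l
      by (rule order_trans[OF Ba[OF x] le]) (auto simp: F_def image_iff)
    show "norm (b k x) \<le> Max F" for k by (rule order_trans[OF Bb[OF x] le]) (simp add: F_def)
    show "\<bar>c k x\<bar> \<le> Max F" for k by (rule order_trans[OF Bc[OF x] le]) (simp add: F_def)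
    show "norm (c0 x) \<le> Max F" by (rule order_trans[OF B0[OF x] le]) (simp add: F_def)
  qed
qed

text \<open>Grouped by what multiplies the test function: the first component collects the terms
  paired with v, the second those paired with its partial derivatives. The real inner product of
  \<open>coef x\<close> (u, grad u) with (v, grad v) is then the real part of the integrand of
  A.\<close>

definition coef :: "real^'n \<Rightarrow> complex \<times> (complex^'n) \<Rightarrow> complex \<times> (complex^'n)"
  where "coef x p = (if x \<in> \<Omega> then
    ((\<Sum>k\<in>UNIV. of_real (c k x) * snd p $ k) + c0 x * fst p,
     \<chi> k. (\<Sum>l\<in>UNIV. of_real (a k l x) * snd p $ l) + b k x * fst p) else 0)"

lemma coef_add: "coef x (p + q) = coef x p + coef x q"
  by (auto simp: coef_def vec_eq_iff distrib_left sum.distrib)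

lemma coef_scaleR: "coef x (r *\<^sub>R p) = r *\<^sub>R coef x p"
  by (auto simp: coef_def vec_eq_iff scaleR_conv_of_real[where 'a=complex] distrib_left sum_distrib_left
      mult.left_commute)

lemma coef_bound: obtains C where "\<And>x p. norm (coef x p) \<le> C * norm p"
proof -
  obtain A where A: "A \<ge> 0" "\<And>x k l. x \<in> \<Omega> \<Longrightarrow> \<bar>a k l x\<bar> \<le> A" "\<And>x k. x \<in> \<Omega> \<Longrightarrow> norm (b k x) \<le> A"
    "\<And>x k. x \<in> \<Omega> \<Longrightarrow> \<bar>c k x\<bar> \<le> A" "\<And>x. x \<in> \<Omega> \<Longrightarrow> norm (c0 x) \<le> A"
    using coefficient_bound by metis
  define N where "N = real CARD('n)"
  have nle: "norm (fst p) \<le> norm p" "norm (snd p $ k) \<le> norm p" for p :: "complex \<times> (complex^'n)" and k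
    using norm_fst_le[of "fst p" "snd p"] norm_snd_le[of "snd p" "fst p"] Finite_Cartesian_Product.norm_nth_le[of "snd p" k]
    by auto
  have row: "norm ((\<Sum>k\<in>UNIV. of_real (f k) * snd p $ k) + g * fst p) \<le> (N + 1) * A * norm p"
    if "\<And>k. \<bar>f k\<bar> \<le> A" "norm g \<le> A" for f g and p :: "complex \<times> (complex^'n)"
  proof -
    have "norm (\<Sum>k\<in>UNIV. of_real (f k) * snd p $ k) \<le> (\<Sum>k\<in>(UNIV::'n set). A * norm p)"
      using A(1) by (intro sum_norm_le) (simp add: norm_mult mult_mono[OF that(1) nle(2)])
    moreover have "norm (g * fst p) \<le> A * norm p"
      using A(1) by (simp add: norm_mult mult_mono[OF that(2) nle(1)])
    ultimately show ?thesis
      using norm_triangle_ineq[of "\<Sum>k\<in>UNIV. of_real (f k) * snd p $ k" "g * fst p"]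
      by (simp add: N_def algebra_simps)
  qed
  have "norm (coef x p) \<le> ((N + 1) * A + N * ((N + 1) * A)) * norm p" for x p
  proof (cases "x \<in> \<Omega>")
    case True
    let ?z = "(\<Sum>k\<in>UNIV. of_real (c k x) * snd p $ k) + c0 x * fst p"
    let ?G = "\<chi> k. (\<Sum>l\<in>UNIV. of_real (a k l x) * snd p $ l) + b k x * fst p"
    have "norm (coef x p) \<le> norm ?z + norm ?G"
      using norm_Pair_le[of ?z ?G] True by (simp add: coef_def)
    also have "norm ?G \<le> (\<Sum>k\<in>UNIV. norm (?G $ k))"
      by (simp add: norm_vec_def L2_set_le_sum)
    also have "\<dots> \<le> (\<Sum>k\<in>(UNIV::'n set). (N + 1) * A * norm p)"
      using A True by (intro sum_mono) (simp add: row)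
    also have "norm ?z \<le> (N + 1) * A * norm p" using A True by (intro row) auto
    finally show ?thesis by (simp add: N_def algebra_simps)
  next
    case False
    then show ?thesis using A(1) by (simp add: coef_def N_def)
  qed
  then show thesis using that by blast
qed

lemma coef_measurable:
  assumes f: "f \<in> borel_measurable lebesgue"
  shows "(\<lambda>x. coef x (f x)) \<in> borel_measurable lebesgue"
proof -
  have f': "f \<in> borel_measurable (lebesgue_on \<Omega>)" using f by (rule measurable_restrict_space1)
  have comp: "(\<lambda>x. fst (f x)) \<in> borel_measurable (lebesgue_on \<Omega>)"
    "(\<lambda>x. snd (f x) $ k) \<in> borel_measurable (lebesgue_on \<Omega>)" for k
    by (auto intro!: measurable_compose[OF f'] borel_measurable_continuous continuous_intros)
  have "(\<lambda>x. ((\<Sum>k\<in>UNIV. of_real (c k x) * snd (f x) $ k) + c0 x * fst (f x),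
     \<chi> k. (\<Sum>l\<in>UNIV. of_real (a k l x) * snd (f x) $ l) + b k x * fst (f x))) \<in> borel_measurable (lebesgue_on \<Omega>)"
    using comp a(1) b(1) c(1) c0(1)
    by (intro borel_measurable_Pair borel_measurable_vecI) auto
  then show ?thesis unfolding borel_measurable_if[OF lebesgue_\<Omega>, symmetric] coef_def .
qed

lemma sq_integrable_coef:
  assumes f: "sq_integrable lebesgue f"
  shows "sq_integrable lebesgue (\<lambda>x. coef x (f x))"
proof -
  obtain C where C: "\<And>x p. norm (coef x p) \<le> C * norm p" using coef_bound by metis
  show ?thesis
  proof (rule sq_integrable_bound)
    show "(\<lambda>x. coef x (f x)) \<in> borel_measurable lebesgue"
      using f by (intro coef_measurable) (simp add: sq_integrable_def)
    show "integrable lebesgue (\<lambda>x. C\<^sup>2 * (norm (f x))\<^sup>2)"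
      using f by (simp add: sq_integrable_def)
    show "AE x in lebesgue. (norm (coef x (f x)))\<^sup>2 \<le> C\<^sup>2 * (norm (f x))\<^sup>2"
      using C power_mono[OF C norm_ge_zero, of _ _ 2] by (simp add: power_mult_distrib)
  qed
qed

definition coef_op :: "(real^'n, complex \<times> (complex^'n)) l2 \<Rightarrow> (real^'n, complex \<times> (complex^'n)) l2"
  where "coef_op U = l2_class (\<lambda>x. coef x (l2_fun U x))"

text \<open>The action is pointwise, so the representative picked by \<open>l2_fun\<close> does not
  matter.\<close>

lemma coef_op_class:
  assumes f: "sq_integrable lebesgue f"
  shows "coef_op (l2_class f) = l2_class (\<lambda>x. coef x (f x))"
  unfolding coef_op_def
proof (subst l2_class_eq_iff)
  show "AE x in lebesgue. coef x (l2_fun (l2_class f) x) = coef x (f x)"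
    using l2_fun_class[OF f] by eventually_elim simp
qed (intro sq_integrable_coef sq_integrable_l2_fun f)+

lemma bounded_linear_coef_op: "bounded_linear coef_op"
proof -
  obtain C where C: "\<And>x p. norm (coef x p) \<le> C * norm p" using coef_bound by metis
  have C0: "0 \<le> max C 0" "norm (coef x p) \<le> max C 0 * norm p" for x p
    using order_trans[OF C mult_right_mono[of C "max C 0" "norm p"]] by auto
  show ?thesis
  proof (rule bounded_linear_intro[of _ "max C 0"])
    fix U W :: "(real^'n, complex \<times> (complex^'n)) l2" and r :: real
    define f g where "f = l2_fun U" and "g = l2_fun W"
    have f: "sq_integrable lebesgue f" "U = l2_class f" and g: "sq_integrable lebesgue g" "W = l2_class g"
      by (simp_all add: f_def g_def sq_integrable_l2_fun l2_class_fun)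
    show "coef_op (U + W) = coef_op U + coef_op W"
      by (simp add: f(2) g(2) l2_class_add f(1) g(1) coef_op_class sq_integrable_add sq_integrable_coef coef_add)
    show "coef_op (r *\<^sub>R U) = r *\<^sub>R coef_op U"
      by (simp add: f(2) l2_class_scaleR f(1) coef_op_class sq_integrable_scaleR sq_integrable_coef coef_scaleR)
    have "(norm (coef_op U))\<^sup>2 = (LINT x|lebesgue. (norm (coef x (f x)))\<^sup>2)"
      by (simp add: f coef_op_class norm_l2_class sq_integrable_coef)
    also have "\<dots> \<le> (LINT x|lebesgue. (max C 0)\<^sup>2 * (norm (f x))\<^sup>2)"
      using sq_integrable_norm[OF sq_integrable_coef[OF f(1)]] sq_integrable_norm[OF f(1)]
        power_mono[OF C0(2) norm_ge_zero, of _ _ 2]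
      by (intro integral_mono) (auto simp: power_mult_distrib)
    also have "\<dots> = (norm U * max C 0)\<^sup>2"
      by (simp add: f norm_l2_class power_mult_distrib mult.commute)
    finally show "norm (coef_op U) \<le> norm U * max C 0"
      by (rule power2_le_imp_le) (simp add: C0)
  qed
qed

abbreviation A_form :: "(real^'n \<Rightarrow> complex) \<Rightarrow> (real^'n \<Rightarrow> complex) \<Rightarrow> complex"
  where "A_form \<equiv> ell_op \<Omega> a b c c0"

lemma inner_coef_op_jet:
  assumes u: "u \<in> H1 \<Omega>" and v: "v \<in> test_functions \<Omega>"
  shows "inner (coef_op (jet u)) (jet v) = Re (A_form u v)"
proof -
  obtain A where A: "A \<ge> 0" "\<And>x k l. x \<in> \<Omega> \<Longrightarrow> \<bar>a k l x\<bar> \<le> A" "\<And>x k. x \<in> \<Omega> \<Longrightarrow> norm (b k x) \<le> A"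
    "\<And>x k. x \<in> \<Omega> \<Longrightarrow> \<bar>c k x\<bar> \<le> A" "\<And>x. x \<in> \<Omega> \<Longrightarrow> norm (c0 x) \<le> A"
    using coefficient_bound by metis
  define D where "D = (\<lambda>k. weak_partial \<Omega> k u)"
  have sqD: "sq_integrable (lebesgue_on \<Omega>) (D k)" for k unfolding D_def by (rule H1_D(3)[OF u])
  note sq = H1_D(1)[OF u] sqD test_sq_integrable[OF v] test_sq_integrable[OF test_partial[OF v]]
  have ints: "integrable (lebesgue_on \<Omega>) (\<lambda>x. of_real (a k l x) * D l x * cnj (partial k v x))"
    "integrable (lebesgue_on \<Omega>) (\<lambda>x. b k x * u x * cnj (partial k v x))"
    "integrable (lebesgue_on \<Omega>) (\<lambda>x. of_real (c k x) * D k x * cnj (v x))"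
    "integrable (lebesgue_on \<Omega>) (\<lambda>x. c0 x * u x * cnj (v x))" for k l
    using A a(1) b(1) c(1) c0(1) sq by (auto intro!: integrable_bounded_mult_cnj[where A=A])
  define I where "I = (\<lambda>x. (\<Sum>k\<in>UNIV. \<Sum>l\<in>UNIV. of_real (a k l x) * D l x * cnj (partial k v x))
      + (\<Sum>k\<in>UNIV. b k x * u x * cnj (partial k v x))
      + (\<Sum>k\<in>UNIV. of_real (c k x) * D k x * cnj (v x)) + c0 x * u x * cnj (v x))"
  have I: "integrable (lebesgue_on \<Omega>) I" unfolding I_def
    by (intro Bochner_Integration.integrable_add Bochner_Integration.integrable_sum ints)
  have IA: "(LINT x|lebesgue_on \<Omega>. I x) = A_form u v"
    unfolding I_def ell_op_def by (simp add: ints) (simp add: D_def)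
  have sv: "sq_integrable lebesgue (ext_pair v (\<lambda>k. partial k v))"
    by (intro sq_integrable_ext_pair sq)
  have jv: "jet v = l2_class (ext_pair v (\<lambda>k. partial k v))"
    using v by (intro jet_eq_ext_pair test_H1 test_has_weak_partial test_sq_integrable test_partial)
  have "inner (coef_op (jet u)) (jet v)
      = (LINT x|lebesgue. inner (coef x (ext_pair u D x)) (ext_pair v (\<lambda>k. partial k v) x))"
    using sq_integrable_jet[OF u]
    by (simp add: jv) (simp add: jet_def D_def coef_op_class inner_l2_class sv sq_integrable_coef)
  also have "\<dots> = (LINT x|lebesgue. (if x \<in> \<Omega> then Re (I x) else 0))"
  proof (rule Bochner_Integration.integral_cong[OF refl])
    fix x
    show "inner (coef x (ext_pair u D x)) (ext_pair v (\<lambda>k. partial k v) x) = (if x \<in> \<Omega> then Re (I x) else 0)"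
    proof (cases "x \<in> \<Omega>")
      case True
      then have "inner (coef x (ext_pair u D x)) (ext_pair v (\<lambda>k. partial k v) x)
        = Re (((\<Sum>k\<in>UNIV. of_real (c k x) * D k x) + c0 x * u x) * cnj (v x)
          + (\<Sum>k\<in>UNIV. ((\<Sum>l\<in>UNIV. of_real (a k l x) * D l x) + b k x * u x) * cnj (partial k v x)))"
        by (simp add: coef_def ext_pair_def inner_vec_def inner_complex_Re)
      also have "((\<Sum>k\<in>UNIV. of_real (c k x) * D k x) + c0 x * u x) * cnj (v x)
          + (\<Sum>k\<in>UNIV. ((\<Sum>l\<in>UNIV. of_real (a k l x) * D l x) + b k x * u x) * cnj (partial k v x)) = I x"
        by (simp add: I_def distrib_right sum_distrib_right sum.distrib)
      finally show ?thesis using True by simp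
    qed (simp add: ext_pair_def)
  qed
  also have "\<dots> = (LINT x|lebesgue_on \<Omega>. Re (I x))"
    by (rule Lebesgue_Measure.integral_restrict_UNIV[OF lebesgue_\<Omega>])
  also have "\<dots> = Re (A_form u v)" using I by (simp add: IA[symmetric])
  finally show ?thesis .
qed

lemma A_form_imaginary:
  assumes v: "v \<in> test_functions \<Omega>"
  shows "A_form u (\<lambda>x. \<i> * v x) = - \<i> * A_form u v"
proof -
  have p: "partial k (\<lambda>x. \<i> * v x) = (\<lambda>x. \<i> * partial k v x)" for k
    using partial_cmult[OF test_differentiable[OF v]] by blast
  have eq: "z * cnj (\<i> * w) = - \<i> * (z * cnj w)" for z w by simp
  show ?thesis
    unfolding ell_op_def p eq by (simp add: sum_distrib_left distrib_left sum_negf)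
qed

lemma jet_test_mem_jet0: "v \<in> test_functions \<Omega> \<Longrightarrow> jet v \<in> jet0"
  unfolding jet0_def by (rule subsetD[OF closure_subset]) (rule imageI)

text \<open>Forward by density of test functions. Backward, the real part of the form vanishes at v
  and at \<i> v; since the form is antilinear in v, the latter is the imaginary part at v.\<close>

lemma ell_null_iff:
  assumes u: "u \<in> H1 \<Omega>"
  shows "ell_null \<Omega> a b c c0 u \<longleftrightarrow> (\<forall>V\<in>jet0. inner (coef_op (jet u)) V = 0)"
proof
  assume "ell_null \<Omega> a b c c0 u"
  then have test: "inner (coef_op (jet u)) (jet v) = 0" if "v \<in> test_functions \<Omega>" for v
    using inner_coef_op_jet[OF u that] that by (simp add: ell_null_def)
  have closed: "closed {V. inner (coef_op (jet u)) V = 0}"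
    by (intro closed_Collect_eq continuous_intros)
  show "\<forall>V\<in>jet0. inner (coef_op (jet u)) V = 0"
    using jet0_induct_closed[OF _ closed test] by blast
next
  assume "\<forall>V\<in>jet0. inner (coef_op (jet u)) V = 0"
  then have 0: "Re (A_form u v) = 0" if "v \<in> test_functions \<Omega>" for v
    using inner_coef_op_jet[OF u that] jet_test_mem_jet0[OF that] by simp
  show "ell_null \<Omega> a b c c0 u"
    unfolding ell_null_def
  proof
    fix v assume v: "v \<in> test_functions \<Omega>"
    have "Re (- \<i> * A_form u v) = 0" using 0[OF test_cmult[OF v, of \<i>]] A_form_imaginary[OF v] by simp
    then show "A_form u v = 0" using 0[OF v] by (simp add: complex_eq_iff)
  qed
qed

text \<open>Pointwise Garding inequality: ellipticity controls the principal part, and the mixed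
  terms are split by Young's inequality so that they use up only half of \<mu>.\<close>

lemma coef_lower_bound:
  obtains \<kappa> where "\<kappa> \<ge> 0"
    "\<And>x p. x \<in> \<Omega> \<Longrightarrow> \<mu> / 2 * (norm (snd p))\<^sup>2 - \<kappa> * (norm (fst p))\<^sup>2 \<le> inner (coef x p) p"
proof -
  obtain A where A: "A \<ge> 0" "\<And>x k l. x \<in> \<Omega> \<Longrightarrow> \<bar>a k l x\<bar> \<le> A" "\<And>x k. x \<in> \<Omega> \<Longrightarrow> norm (b k x) \<le> A"
    "\<And>x k. x \<in> \<Omega> \<Longrightarrow> \<bar>c k x\<bar> \<le> A" "\<And>x. x \<in> \<Omega> \<Longrightarrow> norm (c0 x) \<le> A"
    using coefficient_bound by metis
  \<comment> \<open>Each first-order sum has CARD('n) terms of size at most A |G| |z|.\<close>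
  define B where "B = real CARD('n) * A"
  have "\<mu> / 2 * (norm G)\<^sup>2 - (A + 2 * B\<^sup>2 / \<mu>) * (norm z)\<^sup>2 \<le> inner (coef x (z, G)) (z, G)" if x: "x \<in> \<Omega>" for x z G
  proof -
    have lower: "\<bar>Re (\<Sum>k\<in>UNIV. f k)\<bar> \<le> B * (norm G * norm z)"
      if "\<And>k. norm (f k) \<le> A * (norm (G $ k) * norm z)" for f :: "'n \<Rightarrow> complex"
    proof -
      have "\<bar>Re (\<Sum>k\<in>UNIV. f k)\<bar> \<le> norm (\<Sum>k\<in>UNIV. f k)" by (rule abs_Re_le_cmod)
      also have "\<dots> \<le> (\<Sum>k\<in>(UNIV::'n set). A * (norm G * norm z))"
        using A(1) by (intro sum_norm_le order_trans[OF that] mult_left_mono mult_right_mono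
            Finite_Cartesian_Product.norm_nth_le) auto
      finally show ?thesis by (simp add: B_def mult.assoc)
    qed
    have split: "inner (coef x (z, G)) (z, G) =
        Re (\<Sum>k\<in>UNIV. \<Sum>l\<in>UNIV. of_real (a k l x) * G $ l * cnj (G $ k))
        + Re (\<Sum>k\<in>UNIV. b k x * z * cnj (G $ k)) + Re (\<Sum>k\<in>UNIV. of_real (c k x) * G $ k * cnj z)
        + Re (c0 x * z * cnj z)"
    proof -
      have "inner (coef x (z, G)) (z, G) = Re (((\<Sum>k\<in>UNIV. of_real (c k x) * G $ k) + c0 x * z) * cnj z
          + (\<Sum>k\<in>UNIV. ((\<Sum>l\<in>UNIV. of_real (a k l x) * G $ l) + b k x * z) * cnj (G $ k)))"
        using x by (simp add: coef_def inner_vec_def inner_complex_Re)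
      also have "((\<Sum>k\<in>UNIV. of_real (c k x) * G $ k) + c0 x * z) * cnj z
          + (\<Sum>k\<in>UNIV. ((\<Sum>l\<in>UNIV. of_real (a k l x) * G $ l) + b k x * z) * cnj (G $ k))
        = (\<Sum>k\<in>UNIV. \<Sum>l\<in>UNIV. of_real (a k l x) * G $ l * cnj (G $ k))
        + (\<Sum>k\<in>UNIV. b k x * z * cnj (G $ k)) + (\<Sum>k\<in>UNIV. of_real (c k x) * G $ k * cnj z)
        + c0 x * z * cnj z"
        by (simp add: distrib_right sum_distrib_right sum.distrib)
      finally show ?thesis by (simp only: plus_complex.sel)
    qed
    \<comment> \<open>The form and the ellipticity condition place the conjugate on different
      indices. The coefficients are real, so exchanging the conjugate only conjugates each term and
      keeps its real part.\<close>
    have "Re (\<Sum>k\<in>UNIV. \<Sum>l\<in>UNIV. of_real (a k l x) * G $ l * cnj (G $ k))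
        = Re (\<Sum>k\<in>UNIV. \<Sum>l\<in>UNIV. of_real (a k l x) * G $ k * cnj (G $ l))"
      unfolding Re_sum by (intro sum.cong refl) (simp add: algebra_simps)
    then have 1: "\<mu> * (norm G)\<^sup>2 \<le> Re (\<Sum>k\<in>UNIV. \<Sum>l\<in>UNIV. of_real (a k l x) * G $ l * cnj (G $ k))"
      using elliptic[OF x, of G] by simp
    have 2: "\<bar>Re (\<Sum>k\<in>UNIV. b k x * z * cnj (G $ k))\<bar> \<le> B * (norm G * norm z)"
    proof (rule lower)
      fix k
      have "norm (b k x * z * cnj (G $ k)) = norm (b k x) * (norm (G $ k) * norm z)"
        by (simp add: norm_mult)
      also have "\<dots> \<le> A * (norm (G $ k) * norm z)" using A x by (intro mult_right_mono) auto
      finally show "norm (b k x * z * cnj (G $ k)) \<le> A * (norm (G $ k) * norm z)" .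
    qed
    have 3: "\<bar>Re (\<Sum>k\<in>UNIV. of_real (c k x) * G $ k * cnj z)\<bar> \<le> B * (norm G * norm z)"
    proof (rule lower)
      fix k
      have "norm (of_real (c k x) * G $ k * cnj z) = \<bar>c k x\<bar> * (norm (G $ k) * norm z)"
        by (simp add: norm_mult)
      also have "\<dots> \<le> A * (norm (G $ k) * norm z)" using A x by (intro mult_right_mono) auto
      finally show "norm (of_real (c k x) * G $ k * cnj z) \<le> A * (norm (G $ k) * norm z)" .
    qed
    have 4: "\<bar>Re (c0 x * z * cnj z)\<bar> \<le> A * (norm z)\<^sup>2"
    proof -
      have "\<bar>Re (c0 x * z * cnj z)\<bar> \<le> norm (c0 x * z * cnj z)" by (rule abs_Re_le_cmod)
      also have "\<dots> = norm (c0 x) * (norm z)\<^sup>2" by (simp add: norm_mult power2_eq_square)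
      also have "\<dots> \<le> A * (norm z)\<^sup>2" using A x by (intro mult_right_mono) auto
      finally show ?thesis .
    qed
    have 5: "2 * (B * (norm G * norm z)) \<le> \<mu> / 2 * (norm G)\<^sup>2 + 2 * B\<^sup>2 / \<mu> * (norm z)\<^sup>2"
    proof -
      \<comment> \<open>Young's inequality as a completed square, weighted so that |G|^2 receives
        \<mu>/2; this is the origin of the summand 2 B^2 / \<mu> in \<kappa>.\<close>
      have "0 \<le> (\<mu> * norm G - 2 * B * norm z)\<^sup>2 / (2 * \<mu>)" using mu by simp
      also have "\<dots> = \<mu> / 2 * (norm G)\<^sup>2 + 2 * B\<^sup>2 / \<mu> * (norm z)\<^sup>2 - 2 * (B * (norm G * norm z))"
        using mu by (simp add: power2_eq_square field_simps)
      finally show ?thesis by simp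
    qed
    have "\<mu> / 2 * (norm G)\<^sup>2 - (A + 2 * B\<^sup>2 / \<mu>) * (norm z)\<^sup>2
        = \<mu> * (norm G)\<^sup>2 - (\<mu> / 2 * (norm G)\<^sup>2 + 2 * B\<^sup>2 / \<mu> * (norm z)\<^sup>2) - A * (norm z)\<^sup>2"
      by (simp add: algebra_simps)
    then show ?thesis unfolding split using 1 2 3 4 5 by linarith
  qed
  then show thesis using that[of "A + 2 * B\<^sup>2 / \<mu>"] A(1) mu by fastforce
qed

text \<open>Represents a real functional on jets: the integral of v over the cell, paired with the
  direction r. The directions 1 and \<i> give its real and imaginary part.\<close>

definition cell_vector :: "(real^'n) set \<times> complex \<Rightarrow> (real^'n, complex \<times> (complex^'n)) l2"
  where "cell_vector i = l2_class (\<lambda>x. (indicator (fst i) x *\<^sub>R snd i, 0))"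

lemma inner_jet_cell_vector:
  assumes v: "v \<in> test_functions \<Omega>" and Q: "Q \<in> sets borel" "bounded Q"
  shows "inner (jet v) (cell_vector (Q, r)) = inner (LINT x|lborel. indicator Q x *\<^sub>R v x) r"
proof -
  have Q': "Q \<in> sets lborel" "emeasure lborel Q < \<infinity>" using Q emeasure_bounded_finite by auto
  have sQ: "sq_integrable lebesgue (\<lambda>x. (indicator Q x *\<^sub>R r, 0 :: complex^'n))"
  proof -
    have m: "(\<lambda>x. (indicator Q x *\<^sub>R r, 0 :: complex^'n)) \<in> borel_measurable lborel"
      using Q'(1) by (intro borel_measurable_Pair) auto
    have eq: "(norm (indicator Q x *\<^sub>R r, 0 :: complex^'n))\<^sup>2 = indicator Q x * (norm r)\<^sup>2" for x
      by (auto simp: norm_Pair indicator_def)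
    have "integrable lborel (\<lambda>x. indicator Q x * (norm r)\<^sup>2)" using Q' by simp
    then have "integrable lebesgue (\<lambda>x. indicator Q x * (norm r)\<^sup>2)"
      using integrable_completion[of "\<lambda>x. indicator Q x * (norm r)\<^sup>2" lborel] Q'(1) by auto
    then show ?thesis unfolding sq_integrable_def eq using m by (auto intro: measurable_completion)
  qed
  have cv: "continuous_on UNIV v" "compact (supp v)"
    using v test_continuous by (auto simp: test_functions_iff)
  have vi: "integrable lborel (\<lambda>x. indicator Q x *\<^sub>R v x)"
    using Q'(1) by (intro integrable_mult_indicator integrable_compact_supp cv)
  have jv: "jet v = l2_class (ext_pair v (\<lambda>k. partial k v))"
    using v by (intro jet_eq_ext_pair test_H1 test_has_weak_partial test_sq_integrable test_partial)
  have "inner (jet v) (cell_vector (Q, r))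
      = (LINT x|lebesgue. inner (ext_pair v (\<lambda>k. partial k v) x) (indicator Q x *\<^sub>R r, 0))"
    unfolding jv cell_vector_def fst_conv snd_conv using v
    by (intro inner_l2_class sQ sq_integrable_ext_pair test_sq_integrable test_partial)
  also have "\<dots> = (LINT x|lebesgue. inner (indicator Q x *\<^sub>R v x) r)"
    using test_zero_outside[OF v] by (intro Bochner_Integration.integral_cong) (auto simp: ext_pair_def zero_prod_def)
  also have "\<dots> = (LINT x|lborel. inner (indicator Q x *\<^sub>R v x) r)"
    using borel_measurable_integrable[OF vi]
    by (intro integral_completion borel_measurable_inner borel_measurable_const)
  also have "\<dots> = inner (LINT x|lborel. indicator Q x *\<^sub>R v x) r"
    by (rule integral_inner_left) (rule vi)
  finally show ?thesis .
qed

text \<open>Write s and g for the squared L2 norms of v and its gradient, q for the sum of squared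
  cell integrals. Garding gives \<mu>/2 g - \<kappa> s, and adding (\<kappa> + 1) times the grid
  inequality leaves s + \<mu>/4 g once (\<kappa> + 1) K q is added to the form.\<close>

lemma coercive_up_to_finite_rank:
  obtains \<alpha> K and I :: "((real^'n) set \<times> complex) set" where "\<alpha> > 0" "finite I"
    "\<And>W. W \<in> jet0 \<Longrightarrow> \<alpha> * (norm W)\<^sup>2 \<le> inner (coef_op W) W + K * (\<Sum>i\<in>I. (inner W (cell_vector i))\<^sup>2)"
proof -
  obtain \<kappa> where \<kappa>: "\<kappa> \<ge> 0"
    "\<And>x p. x \<in> \<Omega> \<Longrightarrow> \<mu> / 2 * (norm (snd p))\<^sup>2 - \<kappa> * (norm (fst p))\<^sup>2 \<le> inner (coef x p) p"
    using coef_lower_bound by metis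
  \<comment> \<open>Makes (\<kappa> + 1) \<epsilon> = \<mu>/4, half of the gradient
    coefficient.\<close>
  define \<epsilon> where "\<epsilon> = \<mu> / (4 * (\<kappa> + 1))"
  have \<epsilon>: "\<epsilon> > 0" using mu \<kappa>(1) by (simp add: \<epsilon>_def)
  have cancel: "m * (\<mu> / (4 * m)) = \<mu> / 4" if "m > 0" for m :: real using that by simp
  have \<epsilon>\<kappa>: "(\<kappa> + 1) * \<epsilon> = \<mu> / 4"
    unfolding \<epsilon>_def by (rule cancel) (use \<kappa>(1) in simp)
  obtain \<Q> K where \<Q>K: "finite \<Q> \<and> (\<forall>Q\<in>\<Q>. Q \<in> sets borel \<and> bounded Q) \<and> 0 \<le> K \<and>
    (\<forall>u\<in>test_functions \<Omega>. (LINT x|lborel. (norm (u x))\<^sup>2)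
      \<le> \<epsilon> * (LINT x|lborel. grad_sq u x) + K * (\<Sum>Q\<in>\<Q>. (norm (LINT x|lborel. indicator Q x *\<^sub>R u x))\<^sup>2))"
    using poincare_grid[OF bounded_domain \<epsilon>] by (elim exE)
  then have \<Q>: "finite \<Q>" "\<And>Q. Q \<in> \<Q> \<Longrightarrow> Q \<in> sets borel \<and> bounded Q"
    by simp_all
  define \<alpha> where "\<alpha> = min 1 (\<mu> / 4)"
  \<comment> \<open>Two real functionals per cell, so that their squares add up to the squared
    modulus of the complex integral.\<close>
  define I where "I = \<Q> \<times> {1, \<i>}"
  have test: "\<alpha> * (norm (jet v))\<^sup>2 \<le> inner (coef_op (jet v)) (jet v) + (\<kappa> + 1) * K * (\<Sum>i\<in>I. (inner (jet v) (cell_vector i))\<^sup>2)"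
    if v: "v \<in> test_functions \<Omega>" for v
  proof -
    define f where "f = (\<lambda>x. (v x, \<chi> k. partial k v x))"
    define s g where "s = (LINT x|lborel. (norm (v x))\<^sup>2)" and "g = (LINT x|lborel. grad_sq v x)"
    have cont: "continuous_on UNIV v" "\<And>k. continuous_on UNIV (partial k v)"
      using v by (auto intro: test_continuous test_partial)
    have f_ext: "f = ext_pair v (\<lambda>k. partial k v)"
      using test_zero_outside[OF v] test_zero_outside[OF test_partial[OF v]]
      by (auto simp: f_def ext_pair_def fun_eq_iff zero_prod_def vec_eq_iff)
    have sf: "sq_integrable lebesgue f"
      unfolding f_ext using v by (intro sq_integrable_ext_pair test_sq_integrable test_partial)
    have jv: "jet v = l2_class f" unfolding f_def by (rule jet_test[OF v])
    have n1: "(norm (fst (f x)))\<^sup>2 = (norm (v x))\<^sup>2" and n2: "(norm (snd (f x)))\<^sup>2 = grad_sq v x" for x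
      by (simp_all add: f_def norm_vec_def L2_set_def grad_sq_def sum_nonneg)
    have n: "(norm (f x))\<^sup>2 = (norm (v x))\<^sup>2 + grad_sq v x" for x
      unfolding n1[symmetric] n2[symmetric] by (simp add: norm_prod_def)
    have i1: "integrable lebesgue (\<lambda>x. (norm (v x))\<^sup>2)" and i2: "integrable lebesgue (grad_sq v)"
    proof -
      have "sq_integrable lebesgue w" if "w \<in> test_functions \<Omega>" for w
        using that by (intro sq_integrable_continuous_compact_supp test_continuous) (auto simp: test_functions_iff)
      then show "integrable lebesgue (\<lambda>x. (norm (v x))\<^sup>2)" "integrable lebesgue (grad_sq v)"
        unfolding grad_sq_def using v
        by (auto intro!: Bochner_Integration.integrable_sum sq_integrable_norm test_partial)
    qed
    have s: "(LINT x|lebesgue. (norm (v x))\<^sup>2) = s"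
      unfolding s_def by (intro integral_completion) (auto intro!: borel_measurable_continuous continuous_intros cont)
    have g: "(LINT x|lebesgue. grad_sq v x) = g"
      unfolding g_def grad_sq_def
      by (intro integral_completion) (auto intro!: borel_measurable_continuous continuous_intros cont)
    have norm: "(norm (jet v))\<^sup>2 = s + g"
      unfolding jv norm_l2_class[OF sf] n by (simp add: i1 i2 s g)
    have "\<mu> / 2 * g - \<kappa> * s = (LINT x|lebesgue. \<mu> / 2 * grad_sq v x - \<kappa> * (norm (v x))\<^sup>2)"
      by (simp add: i1 i2 s g)
    also have "\<dots> \<le> (LINT x|lebesgue. inner (coef x (f x)) (f x))"
    proof (rule integral_mono)
      show "integrable lebesgue (\<lambda>x. inner (coef x (f x)) (f x))"
        by (intro sq_integrable_inner sq_integrable_coef sf)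
      fix x
      show "\<mu> / 2 * grad_sq v x - \<kappa> * (norm (v x))\<^sup>2 \<le> inner (coef x (f x)) (f x)"
      proof (cases "x \<in> \<Omega>")
        case True
        then show ?thesis using \<kappa>(2)[OF True, of "f x"] by (simp add: n1 n2)
      next
        case False
        then have "f x = 0" by (simp add: f_ext ext_pair_def)
        then show ?thesis using n1[of x] n2[of x] by simp
      qed
    qed (simp add: i1 i2)
    also have "\<dots> = inner (coef_op (jet v)) (jet v)"
      unfolding jv by (simp add: coef_op_class sf inner_l2_class sq_integrable_coef)
    finally have lower: "\<mu> / 2 * g - \<kappa> * s \<le> inner (coef_op (jet v)) (jet v)" .
    define q where "q = (\<Sum>Q\<in>\<Q>. (norm (LINT x|lborel. indicator Q x *\<^sub>R v x))\<^sup>2)"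
    have q: "(\<Sum>i\<in>I. (inner (jet v) (cell_vector i))\<^sup>2) = q"
    proof -
      have "(\<Sum>i\<in>I. (inner (jet v) (cell_vector i))\<^sup>2) = (\<Sum>Q\<in>\<Q>. \<Sum>r\<in>{1, \<i>}. (inner (jet v) (cell_vector (Q, r)))\<^sup>2)"
        unfolding I_def by (simp add: sum.cartesian_product del: sum.insert)
      also have "\<dots> = q"
        unfolding q_def
      proof (rule sum.cong[OF refl])
        fix Q assume "Q \<in> \<Q>"
        then show "(\<Sum>r\<in>{1, \<i>}. (inner (jet v) (cell_vector (Q, r)))\<^sup>2) = (norm (LINT x|lborel. indicator Q x *\<^sub>R v x))\<^sup>2"
          using \<Q>(2)[of Q] by (simp add: inner_jet_cell_vector[OF v] inner_complex_def cmod_power2 complex_eq_iff)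
      qed
      finally show ?thesis .
    qed
    have "s \<le> \<epsilon> * g + K * q" using \<Q>K v by (simp add: s_def g_def q_def)
    then have "(\<kappa> + 1) * s \<le> (\<kappa> + 1) * (\<epsilon> * g + K * q)" using \<kappa>(1) by (intro mult_left_mono) auto
    also have "\<dots> = \<mu> / 4 * g + (\<kappa> + 1) * K * q"
      using \<epsilon>\<kappa> by (simp add: distrib_left mult.assoc[symmetric])
    finally have "(\<kappa> + 1) * s \<le> \<mu> / 4 * g + (\<kappa> + 1) * K * q" .
    moreover have "\<alpha> * (s + g) \<le> s + \<mu> / 4 * g"
    proof -
      have "0 \<le> s" by (simp add: s_def)
      moreover have "0 \<le> g" by (simp add: g_def grad_sq_def sum_nonneg)
      ultimately have "\<alpha> * s \<le> 1 * s" "\<alpha> * g \<le> \<mu> / 4 * g" by (intro mult_right_mono; simp add: \<alpha>_def)+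
      then show ?thesis by (simp add: distrib_left)
    qed
    ultimately show ?thesis using lower unfolding norm q by (simp add: algebra_simps)
  qed
  show thesis
  proof (rule that[of \<alpha> I "(\<kappa> + 1) * K"])
    show "\<alpha> > 0" using mu by (simp add: \<alpha>_def)
    show "finite I" using \<Q>(1) by (simp add: I_def)
    have cont: "continuous_on UNIV coef_op"
      by (rule linear_continuous_on[OF bounded_linear_coef_op])
    fix W assume W: "W \<in> jet0"
    \<comment> \<open>Both sides are continuous in W and the sum is finite, so the estimate extends
      from test functions to the closure.\<close>
    show "\<alpha> * (norm W)\<^sup>2 \<le> inner (coef_op W) W + (\<kappa> + 1) * K * (\<Sum>i\<in>I. (inner W (cell_vector i))\<^sup>2)"
      by (rule jet0_induct_closed[OF W])
         (auto intro!: closed_Collect_le continuous_intros cont test)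
  qed
qed

text \<open>The right-hand side is represented by the vector \<open>coef_op (jet u)\<close>, so the
  abstract solvability result applies without a dual space. A null vector W of the form is the jet
  of some w in H^1_0 with Aw = 0, to which the eigenvalue assumption applies.\<close>

lemma H1_decomposition:
  assumes no_eigenvalue: "\<And>u. u \<in> H1_0 \<Omega> \<Longrightarrow> ell_null \<Omega> a b c c0 u \<Longrightarrow> ae_eq (lebesgue_on \<Omega>) u (\<lambda>x. 0)"
    and u: "u \<in> H1 \<Omega>"
  obtains w where "w \<in> H1_0 \<Omega>" "(\<lambda>x. u x - w x) \<in> H1_A \<Omega> a b c c0"
proof -
  interpret T: bounded_linear coef_op by (rule bounded_linear_coef_op)
  obtain \<alpha> K and I :: "((real^'n) set \<times> complex) set" where co: "\<alpha> > 0" "finite I"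
    "\<And>W. W \<in> jet0 \<Longrightarrow> \<alpha> * (norm W)\<^sup>2 \<le> inner (coef_op W) W + K * (\<Sum>i\<in>I. (inner W (cell_vector i))\<^sup>2)"
    using coercive_up_to_finite_rank by metis
  have "\<exists>W\<in>jet0. \<forall>Z\<in>jet0. inner (coef_op W) Z = inner (coef_op (jet u)) Z"
  proof (rule fredholm_finite_rank[OF subspace_jet0 complete_jet0 bounded_linear_coef_op co(2) co(1) co(3)])
    fix W assume W: "W \<in> jet0" and null: "\<And>Z. Z \<in> jet0 \<Longrightarrow> inner (coef_op W) Z = 0"
    obtain w where w: "w \<in> H1_0 \<Omega>" "jet w = W" using jet0_representative[OF W] by metis
    then have wH: "w \<in> H1 \<Omega>" by (simp add: H1_0_iff)
    have "ell_null \<Omega> a b c c0 w" using ell_null_iff[OF wH] null w(2) by simp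
    then show "W = 0" using no_eigenvalue[OF w(1)] jet_eq_0_iff[OF wH] w(2) by simp
  qed
  then obtain W where W: "W \<in> jet0" "\<And>Z. Z \<in> jet0 \<Longrightarrow> inner (coef_op W) Z = inner (coef_op (jet u)) Z" by blast
  obtain w where w: "w \<in> H1_0 \<Omega>" "jet w = W" using jet0_representative[OF W(1)] by metis
  then have wH: "w \<in> H1 \<Omega>" by (simp add: H1_0_iff)
  have d: "(\<lambda>x. u x - w x) \<in> H1 \<Omega>" by (rule H1_diff[OF u wH])
  have "ell_null \<Omega> a b c c0 (\<lambda>x. u x - w x)"
    using W(2) unfolding ell_null_iff[OF d] jet_diff[OF u wH] w(2) T.diff inner_diff_left by simp
  then show thesis using that[OF w(1)] d by (simp add: H1_A_def)
qed

text \<open>Chosen weak derivatives are additive only almost everywhere; jets turn this into honest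
  linearity.\<close>

lemma H1_A_diff:
  assumes u: "u \<in> H1_A \<Omega> a b c c0" and w: "w \<in> H1_A \<Omega> a b c c0"
  shows "(\<lambda>x. u x - w x) \<in> H1_A \<Omega> a b c c0"
proof -
  interpret T: bounded_linear coef_op by (rule bounded_linear_coef_op)
  have H: "u \<in> H1 \<Omega>" "w \<in> H1 \<Omega>" using u w by (simp_all add: H1_A_def)
  have d: "(\<lambda>x. u x - w x) \<in> H1 \<Omega>" by (rule H1_diff[OF H])
  have "ell_null \<Omega> a b c c0 (\<lambda>x. u x - w x)"
    using u w H unfolding ell_null_iff[OF d] jet_diff[OF H] T.diff inner_diff_left H1_A_def
    by (simp add: ell_null_iff)
  then show ?thesis using d by (simp add: H1_A_def)
qed

lemma ae_zero_H1_A: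
  assumes "ae_eq (lebesgue_on \<Omega>) u (\<lambda>x. 0)"
  shows "u \<in> H1_A \<Omega> a b c c0"
proof -
  interpret T: bounded_linear coef_op by (rule bounded_linear_coef_op)
  have u: "u \<in> H1 \<Omega>" by (rule ae_zero_H1[OF assms])
  have "jet u = 0" using jet_eq_0_iff[OF u] assms by simp
  then show ?thesis using u by (simp add: H1_A_def ell_null_iff T.zero)
qed

end

section \<open>Traces\<close>

text \<open>For the boundary measure, which the type \<open>l2\<close> does not cover. Instead of
  the triangle inequality, |a - b|^2 \<le> 2 |a|^2 + 2 |b|^2 suffices for limits equal to 0.\<close>

lemma L2_norm_diff_tendsto_0:
  assumes f: "\<And>n. sq_integrable M (f n)" "(\<lambda>n. L2_norm M (f n)) \<longlonglongrightarrow> 0"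
    and g: "\<And>n. sq_integrable M (g n)" "(\<lambda>n. L2_norm M (g n)) \<longlonglongrightarrow> 0"
  shows "(\<lambda>n. L2_norm M (\<lambda>x. f n x - g n x)) \<longlonglongrightarrow> 0"
proof (rule tendsto_sandwich[of "\<lambda>_. 0" _ _ "\<lambda>n. sqrt (2 * (L2_norm M (f n))\<^sup>2 + 2 * (L2_norm M (g n))\<^sup>2)"])
  show "(\<lambda>n. sqrt (2 * (L2_norm M (f n))\<^sup>2 + 2 * (L2_norm M (g n))\<^sup>2)) \<longlonglongrightarrow> 0"
    using tendsto_real_sqrt[OF tendsto_add[OF tendsto_mult_left[OF tendsto_power[OF f(2)], of 2 2]
          tendsto_mult_left[OF tendsto_power[OF g(2)], of 2 2]]] by simp
  have "L2_norm M (\<lambda>x. f n x - g n x) \<le> sqrt (2 * (L2_norm M (f n))\<^sup>2 + 2 * (L2_norm M (g n))\<^sup>2)" for n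
  proof -
    note i = sq_integrable_norm[OF f(1)[of n]] sq_integrable_norm[OF g(1)[of n]]
    have "(LINT x|M. (norm (f n x - g n x))\<^sup>2) \<le> (LINT x|M. 2 * (norm (f n x))\<^sup>2 + 2 * (norm (g n x))\<^sup>2)"
      using i sq_integrable_norm[OF sq_integrable_diff[OF f(1)[of n] g(1)[of n]]]
      by (intro integral_mono norm_diff_sq_le) auto
    also have "\<dots> = 2 * (LINT x|M. (norm (f n x))\<^sup>2) + 2 * (LINT x|M. (norm (g n x))\<^sup>2)"
      using i by simp
    finally show ?thesis by (simp add: L2_norm_def)
  qed
  then show "\<forall>\<^sub>F n in sequentially. L2_norm M (\<lambda>x. f n x - g n x) \<le> sqrt (2 * (L2_norm M (f n))\<^sup>2 + 2 * (L2_norm M (g n))\<^sup>2)"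
    by simp
qed (simp_all add: L2_norm_def)

context open_domain
begin

text \<open>Subtract the approximating sequences. A function may have several traces, so having a
  trace is a linear relation and not a map.\<close>

lemma has_trace_diff:
  assumes u: "has_trace \<Omega> u \<phi>" and v: "has_trace \<Omega> v \<psi>"
  shows "has_trace \<Omega> (\<lambda>x. u x - v x) (\<lambda>x. \<phi> x - \<psi> x)"
proof -
  let ?M = "boundary_measure \<Omega>"
  have H: "u \<in> H1 \<Omega>" "v \<in> H1 \<Omega>" and L: "sq_integrable ?M \<phi>" "sq_integrable ?M \<psi>"
    using u v by (auto simp: has_trace_def L2_iff)
  have "\<exists>p. (\<forall>n. p n \<in> H1 \<Omega> \<and> continuous_on (closure \<Omega>) (p n) \<and> sq_integrable ?M (p n)) \<and>
      (\<lambda>n. H1_norm \<Omega> (\<lambda>x. p n x - u x)) \<longlonglongrightarrow> 0 \<and> (\<lambda>n. L2_norm ?M (\<lambda>x. p n x - \<phi> x)) \<longlonglongrightarrow> 0"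
    using u unfolding has_trace_def L2_iff by (elim conjE)
  then obtain p where p: "\<And>n. p n \<in> H1 \<Omega>" "\<And>n. continuous_on (closure \<Omega>) (p n)" "\<And>n. sq_integrable ?M (p n)"
    "(\<lambda>n. H1_norm \<Omega> (\<lambda>x. p n x - u x)) \<longlonglongrightarrow> 0" "(\<lambda>n. L2_norm ?M (\<lambda>x. p n x - \<phi> x)) \<longlonglongrightarrow> 0"
    by fast
  have "\<exists>q. (\<forall>n. q n \<in> H1 \<Omega> \<and> continuous_on (closure \<Omega>) (q n) \<and> sq_integrable ?M (q n)) \<and>
      (\<lambda>n. H1_norm \<Omega> (\<lambda>x. q n x - v x)) \<longlonglongrightarrow> 0 \<and> (\<lambda>n. L2_norm ?M (\<lambda>x. q n x - \<psi> x)) \<longlonglongrightarrow> 0"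
    using v unfolding has_trace_def L2_iff by (elim conjE)
  then obtain q where q: "\<And>n. q n \<in> H1 \<Omega>" "\<And>n. continuous_on (closure \<Omega>) (q n)" "\<And>n. sq_integrable ?M (q n)"
    "(\<lambda>n. H1_norm \<Omega> (\<lambda>x. q n x - v x)) \<longlonglongrightarrow> 0" "(\<lambda>n. L2_norm ?M (\<lambda>x. q n x - \<psi> x)) \<longlonglongrightarrow> 0"
    by fast
  have tends: "(\<lambda>n. jet (p n)) \<longlonglongrightarrow> jet u" if "\<And>n. p n \<in> H1 \<Omega>" "u \<in> H1 \<Omega>"
      "(\<lambda>n. H1_norm \<Omega> (\<lambda>x. p n x - u x)) \<longlonglongrightarrow> 0" for p u
  proof -
    have "H1_norm \<Omega> (\<lambda>x. p n x - u x) = dist (jet (p n)) (jet u)" for n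
      unfolding dist_norm jet_diff[OF that(1,2), symmetric] by (rule norm_jet[OF H1_diff[OF that(1,2)], symmetric])
    then show ?thesis using that(3) by (subst tendsto_dist_iff) simp
  qed
  have d: "(\<lambda>x. p n x - q n x) \<in> H1 \<Omega>" for n by (rule H1_diff[OF p(1) q(1)])
  have uv: "(\<lambda>x. u x - v x) \<in> H1 \<Omega>" by (rule H1_diff[OF H])
  have "(\<lambda>n. jet (p n) - jet (q n)) \<longlonglongrightarrow> jet u - jet v"
    by (intro tendsto_diff tends p q H)
  then have "(\<lambda>n. norm (jet (\<lambda>x. (p n x - q n x) - (u x - v x)))) \<longlonglongrightarrow> 0"
    unfolding jet_diff[OF d uv] jet_diff[OF p(1) q(1)] jet_diff[OF H]
    by (intro tendsto_norm_zero LIM_zero)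
  then have H1: "(\<lambda>n. H1_norm \<Omega> (\<lambda>x. (p n x - q n x) - (u x - v x))) \<longlonglongrightarrow> 0"
    by (simp add: norm_jet[OF H1_diff[OF d uv]])
  have "(\<lambda>n. L2_norm ?M (\<lambda>x. (p n x - \<phi> x) - (q n x - \<psi> x))) \<longlonglongrightarrow> 0"
    by (intro L2_norm_diff_tendsto_0 sq_integrable_diff p q L)
  then have L2: "(\<lambda>n. L2_norm ?M (\<lambda>x. (p n x - q n x) - (\<phi> x - \<psi> x))) \<longlonglongrightarrow> 0"
    by (simp add: algebra_simps)
  show ?thesis
    unfolding has_trace_def L2_iff
  proof (intro conjI exI[of _ "\<lambda>n x. p n x - q n x"] allI)
    show "continuous_on (closure \<Omega>) (\<lambda>x. p n x - q n x)" for n using p q by (intro continuous_on_diff)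
  qed (intro d uv H1 L2 sq_integrable_diff p(3) q(3) L)+
qed

lemma H1_0_has_trace_0:
  assumes w: "w \<in> H1_0 \<Omega>"
  shows "has_trace \<Omega> w (\<lambda>x. 0)"
proof -
  let ?M = "boundary_measure \<Omega>"
  obtain v where v: "\<And>n. v n \<in> test_functions \<Omega>" "(\<lambda>n. H1_norm \<Omega> (\<lambda>x. v n x - w x)) \<longlonglongrightarrow> 0"
    using w by (auto simp: H1_0_def)
  have "space ?M \<subseteq> frontier \<Omega>" by (simp add: boundary_measure_def space_restrict_space)
  \<comment> \<open>Test functions vanish off the open domain, which does not meet its frontier;
    their boundary norms are therefore exactly 0.\<close>
  then have v0: "v n x = 0" if "x \<in> space ?M" for n x
    using that test_zero_outside[OF v(1)] \<Omega> by (auto simp: frontier_def interior_open)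
  have sq: "sq_integrable ?M (v n)" for n
  proof -
    have "v n \<in> borel_measurable ?M \<longleftrightarrow> (\<lambda>x. 0 :: complex) \<in> borel_measurable ?M"
      by (intro measurable_cong v0)
    moreover have "integrable ?M (\<lambda>x. (norm (v n x))\<^sup>2) \<longleftrightarrow> integrable ?M (\<lambda>x. 0 :: real)"
      by (intro Bochner_Integration.integrable_cong refl) (simp add: v0)
    ultimately show ?thesis by (simp add: sq_integrable_def)
  qed
  have "L2_norm ?M (\<lambda>x. v n x - 0) = 0" for n
  proof -
    have "(LINT x|?M. (norm (v n x - 0))\<^sup>2) = (LINT x|?M. 0)"
      by (intro Bochner_Integration.integral_cong refl) (simp add: v0)
    then show ?thesis by (simp add: L2_norm_def)
  qed
  then show ?thesis
    unfolding has_trace_def L2_iff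
    using w v sq test_H1 continuous_on_subset[OF test_continuous[OF v(1)]]
    by (intro conjI exI[of _ v]) (auto simp: H1_0_def)
qed

lemma ae_zero_H1_0:
  assumes "ae_eq (lebesgue_on \<Omega>) u (\<lambda>x. 0)"
  shows "u \<in> H1_0 \<Omega>"
proof -
  have u: "u \<in> H1 \<Omega>" by (rule ae_zero_H1[OF assms])
  then have "jet u = 0" using jet_eq_0_iff assms by simp
  then show ?thesis using u subspace_0[OF subspace_jet0] by (simp add: H1_0_iff)
qed

lemma ae_eq_H1_0:
  assumes w: "w \<in> H1_0 \<Omega>" and u: "u \<in> H1 \<Omega>" and "ae_eq (lebesgue_on \<Omega>) (\<lambda>x. u x - w x) (\<lambda>x. 0)"
  shows "u \<in> H1_0 \<Omega>"
proof -
  have wH: "w \<in> H1 \<Omega>" using w by (simp add: H1_0_iff)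
  have "jet u = jet w"
    using jet_eq_0_iff[OF H1_diff[OF u wH]] assms(3) jet_diff[OF u wH] by simp
  then show ?thesis using w u by (simp add: H1_0_iff)
qed

end

theorem theorem5p2:
  fixes \<Omega> :: "(real^'n) set"
    and a :: "'n \<Rightarrow> 'n \<Rightarrow> real^'n \<Rightarrow> real"
    and b :: "'n \<Rightarrow> real^'n \<Rightarrow> complex"
    and c :: "'n \<Rightarrow> real^'n \<Rightarrow> real"
    and c0 :: "real^'n \<Rightarrow> complex"
    and \<mu> :: real
  assumes dim: "CARD('n) \<ge> 2"
    and dom: "open \<Omega>" "bounded \<Omega>"
    and a: "\<And>k l. a k l \<in> borel_measurable (lebesgue_on \<Omega>)" "\<And>k l. bounded (a k l ` \<Omega>)"
    and b: "\<And>k. b k \<in> borel_measurable (lebesgue_on \<Omega>)" "\<And>k. bounded (b k ` \<Omega>)"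
    and c: "\<And>k. c k \<in> borel_measurable (lebesgue_on \<Omega>)" "\<And>k. bounded (c k ` \<Omega>)"
    and c0: "c0 \<in> borel_measurable (lebesgue_on \<Omega>)" "bounded (c0 ` \<Omega>)"
    and mu: "0 < \<mu>" "\<mu> \<le> 1"
    and elliptic: "\<And>x (\<xi> :: complex^'n). x \<in> \<Omega> \<Longrightarrow>
        Re (\<Sum>k\<in>UNIV. \<Sum>l\<in>UNIV. of_real (a k l x) * \<xi> $ k * cnj (\<xi> $ l)) \<ge> \<mu> * (norm \<xi>)\<^sup>2"
    and no_eigenvalue: "\<And>u. u \<in> H1_0 \<Omega> \<Longrightarrow> ell_null \<Omega> a b c c0 u \<Longrightarrow>
        ae_eq (lebesgue_on \<Omega>) u (\<lambda>x. 0)"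
    and finite_boundary:
        "emeasure (hausdorff_measure (CARD('n) - 1)) (frontier \<Omega>) < \<infinity>"
  defines "i \<equiv> \<forall>\<phi>\<in>Tr \<Omega>. \<exists>u. variational_solution \<Omega> a b c c0 \<phi> u \<and>
        (\<forall>w. variational_solution \<Omega> a b c c0 \<phi> w \<longrightarrow> ae_eq (lebesgue_on \<Omega>) w u)"
    and "ii \<equiv> V \<Omega> = H1_0 \<Omega>"
    and "iii \<equiv> V \<Omega> \<inter> H1_A \<Omega> a b c c0 = {u. ae_eq (lebesgue_on \<Omega>) u (\<lambda>x. 0)}"
  shows "(i \<longleftrightarrow> ii) \<and> (ii \<longleftrightarrow> iii)"
proof -
  interpret elliptic_problem \<Omega> a b c c0 \<mu>
    by unfold_locales (fact dom a b c c0 mu(1) elliptic)+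
  have H1_0_V: "H1_0 \<Omega> \<subseteq> V \<Omega>"
    using H1_0_has_trace_0 by (auto simp: V_def H1_0_def)
  have zero_V: "u \<in> V \<Omega> \<inter> H1_A \<Omega> a b c c0" if "ae_eq (lebesgue_on \<Omega>) u (\<lambda>x. 0)" for u
    using ae_zero_H1_0[OF that] ae_zero_H1_A[OF that] H1_0_V by blast
  \<comment> \<open>The zero function and any u in the intersection both solve the problem with
    boundary value 0, so both agree with its unique solution.\<close>
  have "iii" if hyp: "i"
    unfolding iii_def
  proof (intro equalityI subsetI CollectI)
    fix u assume u: "u \<in> V \<Omega> \<inter> H1_A \<Omega> a b c c0"
    have zero: "(\<lambda>x. 0) \<in> V \<Omega> \<inter> H1_A \<Omega> a b c c0" by (rule zero_V) (simp add: ae_eq_def)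
    then have "has_trace \<Omega> (\<lambda>x. 0) (\<lambda>x. 0)" by (simp add: V_def)
    moreover from this have "(\<lambda>x. 0) \<in> H1 \<Omega>" "(\<lambda>x. 0) \<in> L2 (boundary_measure \<Omega>)"
      by (simp_all add: has_trace_def)
    ultimately have "(\<lambda>x. 0) \<in> Tr \<Omega>" by (auto simp: Tr_def)
    then obtain w where w: "\<forall>z. variational_solution \<Omega> a b c c0 (\<lambda>x. 0) z \<longrightarrow> ae_eq (lebesgue_on \<Omega>) z w"
      using hyp unfolding i_def by blast
    have "ae_eq (lebesgue_on \<Omega>) u w" "ae_eq (lebesgue_on \<Omega>) (\<lambda>x. 0) w"
      using u zero w by (auto simp: variational_solution_def V_def)
    then show "ae_eq (lebesgue_on \<Omega>) u (\<lambda>x. 0)"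
      unfolding ae_eq_def by eventually_elim simp
  qed (use zero_V in blast)
  \<comment> \<open>Subtracting the H^1_0 part of u does not disturb the trace 0, so the remainder
    lies in the intersection and vanishes almost everywhere.\<close>
  moreover have "ii" if "iii"
    unfolding ii_def
  proof (intro equalityI subsetI)
    fix u assume u: "u \<in> V \<Omega>"
    then have uH: "u \<in> H1 \<Omega>" and tr: "has_trace \<Omega> u (\<lambda>x. 0)" by (auto simp: V_def)
    obtain w where w: "w \<in> H1_0 \<Omega>" "(\<lambda>x. u x - w x) \<in> H1_A \<Omega> a b c c0"
      using H1_decomposition[OF no_eigenvalue uH] by metis
    have "has_trace \<Omega> (\<lambda>x. u x - w x) (\<lambda>x. 0)"
      using has_trace_diff[OF tr H1_0_has_trace_0[OF w(1)]] by simp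
    then have "(\<lambda>x. u x - w x) \<in> V \<Omega> \<inter> H1_A \<Omega> a b c c0"
      using w(2) by (auto simp: V_def H1_A_def)
    then have "ae_eq (lebesgue_on \<Omega>) (\<lambda>x. u x - w x) (\<lambda>x. 0)"
      using that unfolding iii_def by blast
    then show "u \<in> H1_0 \<Omega>" by (rule ae_eq_H1_0[OF w(1) uH])
  qed (use H1_0_V in blast)
  \<comment> \<open>Existence: remove from any function with trace \<phi> its H^1_0 part, which has
    trace 0.\<close>
  moreover have "i" if "ii"
    unfolding i_def
  proof
    fix \<phi> assume "\<phi> \<in> Tr \<Omega>"
    then obtain u where u: "u \<in> H1 \<Omega>" "has_trace \<Omega> u \<phi>" by (auto simp: Tr_def)
    obtain w where w: "w \<in> H1_0 \<Omega>" "(\<lambda>x. u x - w x) \<in> H1_A \<Omega> a b c c0"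
      using H1_decomposition[OF no_eigenvalue u(1)] by metis
    have "has_trace \<Omega> (\<lambda>x. u x - w x) \<phi>"
      using has_trace_diff[OF u(2) H1_0_has_trace_0[OF w(1)]] by simp
    then have sol: "variational_solution \<Omega> a b c c0 \<phi> (\<lambda>x. u x - w x)"
      using w(2) by (simp add: variational_solution_def)
    \<comment> \<open>The difference of two solutions has trace 0, hence lies in H^1_0 by (ii);
      being annihilated by A, it vanishes because 0 is not a Dirichlet eigenvalue.\<close>
    have unique: "ae_eq (lebesgue_on \<Omega>) p q"
      if p: "variational_solution \<Omega> a b c c0 \<phi> p" and q: "variational_solution \<Omega> a b c c0 \<phi> q" for p q
    proof -
      have A: "(\<lambda>x. p x - q x) \<in> H1_A \<Omega> a b c c0"
        using p q by (auto simp: variational_solution_def intro: H1_A_diff)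
      have "has_trace \<Omega> (\<lambda>x. p x - q x) (\<lambda>x. 0)"
        using p q has_trace_diff[of p \<phi> q \<phi>] by (simp add: variational_solution_def)
      then have "(\<lambda>x. p x - q x) \<in> H1_0 \<Omega>"
        using A \<open>ii\<close> by (auto simp: ii_def V_def H1_A_def)
      then have "ae_eq (lebesgue_on \<Omega>) (\<lambda>x. p x - q x) (\<lambda>x. 0)"
        using no_eigenvalue A by (simp add: H1_A_def)
      then show ?thesis unfolding ae_eq_def by eventually_elim simp
    qed
    show "\<exists>u. variational_solution \<Omega> a b c c0 \<phi> u \<and>
        (\<forall>w. variational_solution \<Omega> a b c c0 \<phi> w \<longrightarrow> ae_eq (lebesgue_on \<Omega>) w u)"
      using sol unique by blast
  qed
  ultimately show ?thesis by blast
qed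

end
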